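(* Let $a \in S_{0,0}^0$ and $u \in \mathscr{S}'(\mathbb{R}^d)$. Then $$WF_G(a^w(x,D)u) \subseteq WF_G(u) \cap \operatorname{conesupp}(a).$$
   Context: Notation: $\langle z\rangle=(1+|z|^2)^{1/2}$; $\mathscr S$ and $\mathscr S'$ are the Schwartz space and the tempered distributions; $(\cdot,\cdot)$ is the action of $\mathscr S'$ on $\mathscr S$, conjugate linear in the second argument and consistent with the $L^2$ inner product; $\widehat f(\xi)=\int f(x)e^{-i\langle x,\xi\rangle}dx$. For $z=(x,\xi)\in\mathbb R^{2d}$, $\Pi(z)=M_\xi T_x$ with $T_xf(y)=f(y-x)$, $M_\xi f(y)=e^{i\langle y,\xi\rangle}f(y)$. For $\varphi\in\mathscr S(\mathbb R^d)\setminus\{0\}$ and $u\in\mathscr S'(\mathbb R^d)$, the short-time Fourier transform is $V_\varphi u(z)=(u,\Pi(z)\varphi)$, $z\in\mathbb R^{2d}$. A set is conic if it is invariant under multiplication by all positive reals. $T^*(\mathbb R^d)$ is identified with $\mathbb R^{2d}$. Symbol class: $S_{0,0}^0$ is the set of $a\in C^\infty(\mathbb R^{2d})$ such that $\sup_{z\in\mathbb R^{2d}}|\partial^\gamma a(z)|<\infty$ for every multiindex $\gamma\in\mathbb N^{2d}$. Weyl quantization: $a^w(x,D)f(x)=(2\pi)^{-d}\iint e^{i\langle x-y,\xi\rangle}a\left(\frac{x+y}{2},\xi\right)f(y)\,dy\,d\xi$, interpreted for general $a\in\mathscr S'(\mathbb R^{2d})$ through $(a^w(x,D)f,g)=(2\pi)^{-d}(a,W(g,f))$,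 $f,g\in\mathscr S(\mathbb R^d)$, where $W(g,f)(x,\xi)=\int g(x+\tau/2)\overline{f(x-\tau/2)}e^{-i\langle\tau,\xi\rangle}d\tau$. For $a\in S_{0,0}^0$, $a^w(x,D)$ is continuous on $\mathscr S(\mathbb R^d)$ and extends to a continuous operator on $\mathscr S'(\mathbb R^d)$ by duality: $(a^w(x,D)u,g)=(u,\overline a^{\,w}(x,D)g)$. Conic support: for $a\in\mathscr D'(\mathbb R^{n})$ (here $n=2d$), $\operatorname{conesupp}(a)$ is the set of all $x\in\mathbb R^{n}\setminus\{0\}$ such that for every open conic set $\Gamma_x\subseteq\mathbb R^{n}\setminus\{0\}$ containing $x$, the set $\overline{\operatorname{supp}(a)\cap\Gamma_x}$ is not compact in $\mathbb R^{n}$. Gabor wave front set: let $\varphi\in\mathscr S(\mathbb R^d)\setminus\{0\}$ and $\Lambda=\alpha\mathbb Z^d\times\beta\mathbb Z^d$ with $\alpha,\beta>0$ sufficiently small that $\{\Pi(\lambda)\varphi\}_{\lambda\in\Lambda}$ is a Gabor frame for $L^2(\mathbb R^d)$, i.e. there are $A,B>0$ with $A\|f\|_{L^2}^2\le\sum_{\lambda\in\Lambda}|(f,\Pi(\lambda)\varphi)|^2\le B\|f\|_{L^2}^2$ for all $f\in L^2(\mathbb R^d)$. For $u\in\mathscr S'(\mathbb R^d)$, $WF_G(u)\subseteq\mathbb R^{2d}\setminus\{0\}$ is defined by: $z_0\in\mathbb R^{2d}\setminus\{0\}$ satisfies $z_0\notin WF_G(u)$ if there is an open conic set $\Gamma\subseteq\mathbb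 R^{2d}\setminus\{0\}$ containing $z_0$ with $\sup_{\lambda\in\Lambda\cap\Gamma}\langle\lambda\rangle^N|V_\varphi u(\lambda)|<\infty$ for all $N\ge0$. (This set does not depend on the choice of such a pair $(\varphi,\Lambda)$.) *)

theory Defs
  imports "HOL-Analysis.Analysis"
begin

definition japanese :: "'a::real_normed_vector \<Rightarrow> real" where
  "japanese z = sqrt (1 + (norm z)\<^sup>2)"

text \<open>
  Partial derivatives are indexed by lists of basis vectors, the head being the outermost
  derivative. For smooth functions the order is irrelevant, so lists range over exactly the
  derivatives given by multiindices, the order of a multiindex being the length of the list.
\<close>

primrec iter_partial :: "'a::euclidean_space list \<Rightarrow> ('a \<Rightarrow> complex) \<Rightarrow> 'a \<Rightarrow> complex" where
  "iter_partial [] f = f"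
| "iter_partial (b # bs) f = (\<lambda>x. frechet_derivative (iter_partial bs f) (at x) b)"

definition smooth :: "('a::euclidean_space \<Rightarrow> complex) \<Rightarrow> bool" where
  "smooth f \<longleftrightarrow> (\<forall>bs. set bs \<subseteq> Basis \<longrightarrow> iter_partial bs f differentiable_on UNIV)"

definition schwartz :: "('a::euclidean_space \<Rightarrow> complex) set" where
  "schwartz = {f. smooth f \<and>
     (\<forall>N bs. set bs \<subseteq> Basis \<longrightarrow>
        bdd_above (range (\<lambda>x. japanese x ^ N * norm (iter_partial bs f x))))}"

definition schwartz_seminorm :: "nat \<Rightarrow> ('a::euclidean_space \<Rightarrow> complex) \<Rightarrow> real" where
  "schwartz_seminorm N f =
     (SUP (bs, x) \<in> {bs. set bs \<subseteq> Basis \<and> length bs \<le> N} \<times> UNIV.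
        japanese x ^ N * norm (iter_partial bs f x))"

text \<open>
  A tempered distribution is represented by its action \<open>\<phi> \<mapsto> (u, \<phi>)\<close>, which is conjugate linear
  and continuous on the Schwartz space. The seminorms above are increasing and generate the
  topology of the Schwartz space, so that continuity is an estimate by one of them.
  Values at arguments outside the Schwartz space carry no meaning and are never used.
\<close>

definition tempered :: "(('a::euclidean_space \<Rightarrow> complex) \<Rightarrow> complex) set" where
  "tempered = {u.
     (\<forall>f\<in>schwartz. \<forall>g\<in>schwartz. u (\<lambda>x. f x + g x) = u f + u g) \<and>
     (\<forall>c. \<forall>f\<in>schwartz. u (\<lambda>x. c * f x) = cnj c * u f) \<and>
     (\<exists>C N. \<forall>f\<in>schwartz. norm (u f) \<le> C * schwartz_seminorm N f)}"

definition dist_of_fun ::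
    "('a::euclidean_space \<Rightarrow> complex) \<Rightarrow> ('a \<Rightarrow> complex) \<Rightarrow> complex" where
  "dist_of_fun f = (\<lambda>\<phi>. LINT x|lborel. f x * cnj (\<phi> x))"

definition tf_shift :: "'a \<times> 'a \<Rightarrow> ('a::euclidean_space \<Rightarrow> complex) \<Rightarrow> 'a \<Rightarrow> complex" where
  "tf_shift z f = (\<lambda>y. cis (y \<bullet> snd z) * f (y - fst z))"

definition stft ::
    "('a::euclidean_space \<Rightarrow> complex) \<Rightarrow> (('a \<Rightarrow> complex) \<Rightarrow> complex) \<Rightarrow> 'a \<times> 'a \<Rightarrow> complex" where
  "stft \<phi> u z = u (tf_shift z \<phi>)"

definition S00 :: "('a::euclidean_space \<Rightarrow> complex) set" where
  "S00 = {a. smooth a \<and>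
     (\<forall>bs. set bs \<subseteq> Basis \<longrightarrow> bdd_above (range (\<lambda>z. norm (iter_partial bs a z))))}"

definition wigner ::
    "('a::euclidean_space \<Rightarrow> complex) \<Rightarrow> ('a \<Rightarrow> complex) \<Rightarrow> 'a \<times> 'a \<Rightarrow> complex" where
  "wigner g f = (\<lambda>(x, \<xi>). LINT \<tau>|lborel.
     g (x + \<tau> /\<^sub>R 2) * cnj (f (x - \<tau> /\<^sub>R 2)) * cis (- (\<tau> \<bullet> \<xi>)))"

text \<open>
  The Weyl quantization of a distribution \<open>b\<close>, mapping a Schwartz function \<open>f\<close> to a distribution:
  \<open>(b\<^sup>w f, g) = (2\<pi>)\<^sup>-\<^sup>d (b, W(g,f))\<close>.
\<close>

definition weyl_dist ::
    "(('a \<times> 'a \<Rightarrow> complex) \<Rightarrow> complex) \<Rightarrow> ('a::euclidean_space \<Rightarrow> complex) \<Rightarrow> ('a \<Rightarrow> complex) \<Rightarrow> complex"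
  where
  "weyl_dist b f = (\<lambda>g. of_real (1 / (2 * pi) ^ DIM('a)) * b (wigner g f))"

text \<open>
  For \<open>a \<in> S00\<close> and Schwartz \<open>f\<close> the distribution \<open>a\<^sup>w f\<close> is a Schwartz function, uniquely
  determined by its action; \<open>weyl a f\<close> is this function.
\<close>

definition weyl ::
    "('a \<times> 'a \<Rightarrow> complex) \<Rightarrow> ('a::euclidean_space \<Rightarrow> complex) \<Rightarrow> 'a \<Rightarrow> complex" where
  "weyl a f = (THE h. h \<in> schwartz \<and>
     (\<forall>g\<in>schwartz. dist_of_fun h g = weyl_dist (dist_of_fun a) f g))"

text \<open>The extension to tempered distributions by duality.\<close>

definition weyl_ext ::
    "('a \<times> 'a \<Rightarrow> complex) \<Rightarrow> (('a::euclidean_space \<Rightarrow> complex) \<Rightarrow> complex) \<Rightarrow>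
      ('a \<Rightarrow> complex) \<Rightarrow> complex" where
  "weyl_ext a u = (\<lambda>g. u (weyl (\<lambda>z. cnj (a z)) g))"

text \<open>
  The library predicate \<^const>\<open>conic\<close> is not usable here: it asks for invariance under
  multiplication by nonnegative reals, hence puts the origin into every nonempty conic set.
\<close>

definition open_conic :: "'a::euclidean_space set \<Rightarrow> bool" where
  "open_conic \<Gamma> \<longleftrightarrow> open \<Gamma> \<and> 0 \<notin> \<Gamma> \<and> (\<forall>x\<in>\<Gamma>. \<forall>t>0. t *\<^sub>R x \<in> \<Gamma>)"

text \<open>
  Only needed for continuous functions, whose support as distributions is the closure of the
  set where they do not vanish.
\<close>

definition supp :: "('a::euclidean_space \<Rightarrow> complex) \<Rightarrow> 'a set" where
  "supp a = closure {x. a x \<noteq> 0}"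

definition conesupp :: "('a::euclidean_space \<Rightarrow> complex) \<Rightarrow> 'a set" where
  "conesupp a = {x. x \<noteq> 0 \<and>
     (\<forall>\<Gamma>. open_conic \<Gamma> \<and> x \<in> \<Gamma> \<longrightarrow> \<not> compact (closure (supp a \<inter> \<Gamma>)))}"

definition gabor_lattice :: "real \<Rightarrow> real \<Rightarrow> ((real ^ 'n) \<times> (real ^ 'n)) set" where
  "gabor_lattice \<alpha> \<beta> =
     {((\<chi> i. \<alpha> * of_int (k i)), (\<chi> i. \<beta> * of_int (l i))) | k l :: 'n \<Rightarrow> int. True}"

text \<open>
  The frame inequalities over \<open>L\<^sup>2\<close>, whose elements are represented by Borel functions.
  Summability is stated explicitly because \<^const>\<open>infsum\<close> is \<open>0\<close> on families that are not summable.
\<close>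

definition gabor_frame :: "(real ^ 'n \<Rightarrow> complex) \<Rightarrow> real \<Rightarrow> real \<Rightarrow> bool" where
  "gabor_frame \<phi> \<alpha> \<beta> \<longleftrightarrow> (\<exists>A>0. \<exists>B>0. \<forall>f \<in> borel_measurable lborel.
     integrable lborel (\<lambda>x. (norm (f x))\<^sup>2) \<longrightarrow>
       (\<lambda>z. (norm (dist_of_fun f (tf_shift z \<phi>)))\<^sup>2) summable_on gabor_lattice \<alpha> \<beta> \<and>
       A * (LINT x|lborel. (norm (f x))\<^sup>2)
         \<le> (\<Sum>\<^sub>\<infinity>z\<in>gabor_lattice \<alpha> \<beta>. (norm (dist_of_fun f (tf_shift z \<phi>)))\<^sup>2) \<and>
       (\<Sum>\<^sub>\<infinity>z\<in>gabor_lattice \<alpha> \<beta>. (norm (dist_of_fun f (tf_shift z \<phi>)))\<^sup>2)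
         \<le> B * (LINT x|lborel. (norm (f x))\<^sup>2))"

definition WF_G ::
    "(real ^ 'n \<Rightarrow> complex) \<Rightarrow> real \<Rightarrow> real \<Rightarrow> ((real ^ 'n \<Rightarrow> complex) \<Rightarrow> complex) \<Rightarrow>
      ((real ^ 'n) \<times> (real ^ 'n)) set" where
  "WF_G \<phi> \<alpha> \<beta> u = {z\<^sub>0. z\<^sub>0 \<noteq> 0 \<and>
     \<not> (\<exists>\<Gamma>. open_conic \<Gamma> \<and> z\<^sub>0 \<in> \<Gamma> \<and>
          (\<forall>N::nat. bdd_above ((\<lambda>z. japanese z ^ N * norm (stft \<phi> u z)) ` (gabor_lattice \<alpha> \<beta> \<inter> \<Gamma>))))}"

end

theory Submission
  imports Defs "HOL-Probability.Sinc_Integral"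
begin

text \<open>
  The frame inequality replaces Fourier inversion. The frame operator \<open>S\<close> of \<open>\<phi>\<close> has commutators with
  \<open>x\<^sub>j\<close> and \<open>-i \<partial>\<^sub>j\<close> that are again operators of frame type, hence bounded on \<open>L\<^sup>2\<close>; since \<open>1 - S/B\<close> is
  a contraction, the Neumann series of \<open>S\<inverse> \<phi>\<close> converges with all its moments. Thus the canonical dual
  window \<open>\<gamma>\<close> is a Schwartz function, and \<open>g = \<Sum>\<^sub>\<lambda> (g, \<Pi>(\<lambda>)\<phi>) \<Pi>(\<lambda>)\<gamma>\<close> for every Schwartz function \<open>g\<close>.

  Inserting this expansion in the definition of the Weyl operator yields the Schwartz function
  \<open>b\<^sup>w \<Pi>(w)\<phi> = (2\<pi>)\<^sup>-\<^sup>d \<Sum>\<^sub>\<lambda> (b, W(\<Pi>(\<lambda>)\<gamma>, \<Pi>(w)\<phi>)) \<Pi>(\<lambda>)\<phi>\<close> for \<open>b\<close> the conjugate of \<open>a\<close>. By covariance of the Wigner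
  distribution and integration by parts its coefficients are \<open>O(\<langle>\<lambda> - w\<rangle>\<^sup>-\<^sup>k)\<close>, with an extra decay in
  the distance from \<open>(\<lambda> + w)/2\<close> to the support of \<open>a\<close>. Applying \<open>u\<close> expresses the short-time Fourier
  transform of \<open>a\<^sup>w u\<close> on the lattice by that of \<open>u\<close> through an almost diagonal matrix, which
  preserves rapid decay in cones and creates it where \<open>a\<close> vanishes.
\<close>

section \<open>Schwartz functions\<close>

text \<open>\<open>weyl\<close> is a definite description, so a Schwartz function realizing
  \<open>weyl_dist\<close> has to be exhibited before anything can be said about it, and
  \<open>u\<close> can be applied to Schwartz functions only. An expansion that merely converges in
  L2 is therefore useless: the synthesis window must be Schwartz, and the series must converge in
  every seminorm so that functionals may be applied term by term. Smoothness and decay of the dual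
  window are thus the main obstacle. Moments are measured by powers of the operators
  \<open>Zop q\<close>, because their commutators with a frame operator contain no factor that grows
  over the lattice.

  At the end a weight \<open>japanese w ^ N\<close> has to be paid for, although \<open>u\<close>
  may itself grow polynomially. The currency is the decay of the matrix in \<open>z - w\<close> and
  in a radius \<open>\<rho>\<close> such that the symbol vanishes within \<open>\<rho>\<close> of
  the midpoint of \<open>z\<close> and \<open>w\<close>. So each pair \<open>w\<close>,
  \<open>z\<close> must either satisfy
  \<open>japanese w \<le> E * (1 + \<rho>) * japanese (z - w)\<close>, or have \<open>z\<close> in a
  cone in which the transform of \<open>u\<close> decays anyway.\<close>

lemma japanese_ge_1: "1 \<le> japanese x"
  by (simp add: japanese_def)

lemma japanese_pos [simp]: "0 < japanese x" and japanese_nonneg [simp]: "0 \<le> japanese x"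
  and japanese_neq_0 [simp]: "japanese x \<noteq> 0"
  using japanese_ge_1[of x] by auto

lemma japanese_power_mono: "m \<le> n \<Longrightarrow> japanese x ^ m \<le> japanese x ^ n"
  by (simp add: japanese_ge_1 power_increasing)

lemma norm_le_japanese: "norm x \<le> japanese x"
  by (simp add: japanese_def real_le_rsqrt)

lemma japanese_le: "japanese x \<le> 1 + norm x"
  unfolding japanese_def by (rule real_le_lsqrt) (auto simp: power2_eq_square algebra_simps)

lemma japanese_minus [simp]: "japanese (- x) = japanese x"
  by (simp add: japanese_def)

lemma japanese_0 [simp]: "japanese 0 = 1"
  by (simp add: japanese_def)

lemma japanese_minus_commute: "japanese (x - y) = japanese (y - x)"
  by (simp add: japanese_def norm_minus_commute)

text \<open>A Peetre-type inequality: it moves weights between \<open>w\<close>, \<open>z\<close>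
  and \<open>z - w\<close> at the cost of a constant.\<close>

lemma japanese_add: "japanese (x + y) \<le> 2 * japanese x * japanese y"
proof -
  have "(norm (x + y))\<^sup>2 \<le> (norm x + norm y)\<^sup>2"
    by (simp add: norm_triangle_ineq power_mono)
  also have "\<dots> \<le> 2 * (norm x)\<^sup>2 + 2 * (norm y)\<^sup>2"
    using sum_squares_bound[of "norm x" "norm y"] by (simp add: power2_sum)
  finally have "(norm (x + y))\<^sup>2 \<le> 2 * (norm x)\<^sup>2 + 2 * (norm y)\<^sup>2" .
  moreover have "0 \<le> (norm x)\<^sup>2 * (norm y)\<^sup>2" "0 \<le> (norm x)\<^sup>2" "0 \<le> (norm y)\<^sup>2"
    by auto
  ultimately have "1 + (norm (x + y))\<^sup>2 \<le> 4 * (1 + (norm x)\<^sup>2) * (1 + (norm y)\<^sup>2)"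
    unfolding distrib_left distrib_right mult_1_left mult_1_right by linarith
  then have "japanese (x + y) \<le> sqrt (4 * (1 + (norm x)\<^sup>2) * (1 + (norm y)\<^sup>2))"
    unfolding japanese_def by simp
  also have "\<dots> = 2 * japanese x * japanese y"
    unfolding japanese_def real_sqrt_mult by simp
  finally show ?thesis .
qed

lemma japanese_add_power: "japanese (x + y) ^ n \<le> 2 ^ n * japanese x ^ n * japanese y ^ n"
  using power_mono[OF japanese_add[of x y], of n] by (simp add: power_mult_distrib)

lemma japanese_diff_power: "japanese x ^ n \<le> 2 ^ n * japanese y ^ n * japanese (x - y) ^ n"
  using japanese_add_power[of y "x - y" n] by simp

lemma japanese_mono: "norm x \<le> norm y \<Longrightarrow> japanese x \<le> japanese y"
  by (simp add: japanese_def power_mono)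

lemma inner_le_japanese: "b \<in> Basis \<Longrightarrow> \<bar>x \<bullet> b\<bar> \<le> japanese x"
  using Basis_le_norm[of b x] norm_le_japanese[of x] by simp

text \<open>Decay is always proved one coordinate at a time, by integration by parts or commutation.
  This lemma and the next reassemble a power of the full weight from pure powers of the
  coordinates.\<close>

lemma japanese_power_le_coords:
  fixes x :: "'a::euclidean_space"
  shows "japanese x ^ k \<le> (real DIM('a) + 1) ^ k * (1 + (\<Sum>b\<in>Basis. \<bar>x \<bullet> b\<bar> ^ k))"
proof -
  \<comment> \<open>The weight is at most (dimension + 1) times \<open>m\<close>, and
    \<open>m ^ k\<close> is either 1 or one of the summands on the right.\<close>
  define m where "m = Max (insert 1 ((\<lambda>b. \<bar>x \<bullet> b\<bar>) ` Basis))"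
  have m: "1 \<le> m" "\<And>b. b \<in> Basis \<Longrightarrow> \<bar>x \<bullet> b\<bar> \<le> m"
    unfolding m_def by (rule Max_ge; simp)+
  have "japanese x \<le> 1 + (\<Sum>b\<in>Basis. \<bar>x \<bullet> b\<bar>)"
    using japanese_le[of x] norm_le_l1[of x] by linarith
  also have "\<dots> \<le> m + real DIM('a) * m"
    using m sum_bounded_above[of Basis "\<lambda>b. \<bar>x \<bullet> b\<bar>" m] by simp
  finally have *: "japanese x ^ k \<le> ((real DIM('a) + 1) * m) ^ k"
    by (intro power_mono) (auto simp: algebra_simps)
  have "m \<in> insert 1 ((\<lambda>b. \<bar>x \<bullet> b\<bar>) ` Basis)"
    unfolding m_def by (rule Max_in) auto
  then have "m ^ k \<le> 1 + (\<Sum>b\<in>Basis. \<bar>x \<bullet> b\<bar> ^ k)"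
  proof
    assume "m \<in> (\<lambda>b. \<bar>x \<bullet> b\<bar>) ` Basis"
    then obtain b where b: "b \<in> Basis" "m = \<bar>x \<bullet> b\<bar>" by blast
    have "\<bar>x \<bullet> b\<bar> ^ k \<le> (\<Sum>b\<in>Basis. \<bar>x \<bullet> b\<bar> ^ k)"
      by (rule member_le_sum) (use b in auto)
    with b show ?thesis by simp
  qed (simp add: sum_nonneg)
  with * show ?thesis
    by (simp add: power_mult_distrib) (meson mult_left_mono order_trans zero_le_power of_nat_0_le_iff
        add_nonneg_nonneg zero_le_one)
qed

lemma japanese_power_boundI:
  fixes x :: "'a::euclidean_space"
  assumes "0 \<le> y" "y \<le> C" "\<And>b. b \<in> Basis \<Longrightarrow> \<bar>x \<bullet> b\<bar> ^ k * y \<le> D b"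
  shows "japanese x ^ k * y \<le> (real DIM('a) + 1) ^ k * (C + (\<Sum>b\<in>Basis. D b))"
proof -
  have "japanese x ^ k * y \<le> (real DIM('a) + 1) ^ k * (1 + (\<Sum>b\<in>Basis. \<bar>x \<bullet> b\<bar> ^ k)) * y"
    by (intro mult_right_mono japanese_power_le_coords assms)
  also have "\<dots> = (real DIM('a) + 1) ^ k * (y + (\<Sum>b\<in>Basis. \<bar>x \<bullet> b\<bar> ^ k * y))"
    by (simp add: algebra_simps sum_distrib_left)
  also have "\<dots> \<le> (real DIM('a) + 1) ^ k * (C + (\<Sum>b\<in>Basis. D b))"
    by (intro mult_left_mono add_mono sum_mono assms) auto
  finally show ?thesis .
qed

text \<open>Twice the dimension is the exponent for which the weight dominates the product over all
  coordinates of \<open>1 + (x \<bullet> b)^2\<close>, each factor being at most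
  \<open>(japanese x)^2\<close>. The integral of the reciprocal product factorizes into arctangent
  integrals.\<close>

lemma integrable_inverse_japanese:
  "integrable lborel (\<lambda>x::'a::euclidean_space. 1 / japanese x ^ (2 * DIM('a)))"
proof (rule Bochner_Integration.integrable_bound)
  let ?g = "\<lambda>x::'a. \<Prod>b\<in>Basis. inverse (1 + (x \<bullet> b)\<^sup>2)"
  have "integrable lborel (\<lambda>x::real. inverse (1 + x\<^sup>2))"
    using integrable_inverse_1_plus_square by (simp add: set_integrable_def einterval_def)
  then have fin: "(\<integral>\<^sup>+x. ennreal (inverse (1 + x\<^sup>2)) \<partial>lborel) < \<infinity>" if "x = x" for x::real
    unfolding integrable_iff_bounded by auto
  have "(\<integral>\<^sup>+x. ennreal (norm (?g x)) \<partial>lborel) = (\<integral>\<^sup>+x. (\<Prod>b\<in>(Basis::'a set). ennreal (inverse (1 + (x \<bullet> b)\<^sup>2))) \<partial>lborel)"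
    by (intro nn_integral_cong) (auto simp: prod_ennreal prod_nonneg abs_prod)
  also have "\<dots> = (\<Prod>b\<in>(Basis::'a set). (\<integral>\<^sup>+x. ennreal (inverse (1 + x\<^sup>2)) \<partial>lborel))"
    by (rule nn_integral_lborel_prod) auto
  also have "\<dots> < \<infinity>"
    using fin by (simp add: less_top[symmetric] ennreal_prod_eq_top power_eq_top_ennreal)
  finally show "integrable lborel ?g"
    by (intro integrableI_bounded) auto
  show "(\<lambda>x::'a. 1 / japanese x ^ (2 * DIM('a))) \<in> borel_measurable lborel"
    unfolding japanese_def by measurable
  have "norm (1 / japanese x ^ (2 * DIM('a))) \<le> norm (?g x)" for x :: 'a
  proof -
    have "?g x = 1 / (\<Prod>b\<in>(Basis::'a set). (1 + (x \<bullet> b)\<^sup>2))"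
      by (simp add: divide_inverse prod_inversef[symmetric] o_def)
    moreover have "(\<Prod>b\<in>(Basis::'a set). (1 + (x \<bullet> b)\<^sup>2)) \<le> (\<Prod>b\<in>(Basis::'a set). (japanese x)\<^sup>2)"
      using Basis_le_norm[of _ x]
      by (intro prod_mono) (auto simp: japanese_def abs_le_square_iff[symmetric])
    moreover have "(\<Prod>b\<in>(Basis::'a set). (japanese x)\<^sup>2) = japanese x ^ (2 * DIM('a))"
      by (simp add: power_mult)
    moreover have "0 < (\<Prod>b\<in>(Basis::'a set). (1 + (x \<bullet> b)\<^sup>2))"
      by (intro prod_pos) (simp add: add_pos_nonneg)
    ultimately show ?thesis
      by (simp add: frac_le)
  qed
  then show "AE x in lborel. norm (1 / japanese (x::'a) ^ (2 * DIM('a))) \<le> norm (?g x)"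
    by simp
qed

section \<open>Partial derivatives and Schwartz functions of finite order\<close>

definition pd :: "'a::euclidean_space \<Rightarrow> ('a \<Rightarrow> complex) \<Rightarrow> 'a \<Rightarrow> complex" where
  "pd b f = (\<lambda>x. frechet_derivative f (at x) b)"

lemma pd_eq: "(f has_derivative f') (at x) \<Longrightarrow> pd b f x = f' b"
  unfolding pd_def using frechet_derivative_at by metis

definition decay :: "('a::euclidean_space \<Rightarrow> complex) \<Rightarrow> bool" where
  "decay f \<longleftrightarrow> (\<forall>N. \<exists>C. \<forall>x. japanese x ^ N * norm (f x) \<le> C)"

text \<open>Finite order of differentiability makes closure properties provable by induction.\<close>

primrec schwartz_upto :: "nat \<Rightarrow> ('a::euclidean_space \<Rightarrow> complex) \<Rightarrow> bool" where
  "schwartz_upto 0 f = decay f"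
| "schwartz_upto (Suc n) f = (decay f \<and> (\<forall>x. f differentiable (at x)) \<and> (\<forall>b\<in>Basis. schwartz_upto n (pd b f)))"

lemma iter_partial_Cons: "iter_partial (b # bs) f = pd b (iter_partial bs f)"
  by (simp add: pd_def)

lemma iter_partial_append: "iter_partial (bs @ cs) f = iter_partial bs (iter_partial cs f)"
  by (induction bs) auto

text \<open>Splitting off the innermost derivative lets an induction replace \<open>f\<close> by
  \<open>pd b f\<close>, which is the form in which the product and shift rules apply.\<close>

lemma iter_partial_snoc: "iter_partial (bs @ [b]) f = iter_partial bs (pd b f)"
  by (simp add: iter_partial_append pd_def)

lemma schwartz_pd: "f \<in> schwartz \<Longrightarrow> b \<in> Basis \<Longrightarrow> pd b f \<in> schwartz"
  unfolding schwartz_def smooth_def by (auto simp flip: iter_partial_snoc)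

lemma schwartz_differentiable: "f \<in> schwartz \<Longrightarrow> f differentiable (at x)"
  unfolding schwartz_def smooth_def differentiable_on_def
  by (auto dest!: spec[of _ "[]"])

lemma schwartz_has_derivative: "f \<in> schwartz \<Longrightarrow> (f has_derivative (\<lambda>h. pd h f x)) (at x)"
  unfolding pd_def using frechet_derivative_works schwartz_differentiable by blast

lemma schwartz_decay: "f \<in> schwartz \<Longrightarrow> decay f"
proof -
  assume f: "f \<in> schwartz"
  have "bdd_above (range (\<lambda>x. japanese x ^ N * norm (f x)))" for N
    using f unfolding schwartz_def by (auto dest!: spec[of _ N] spec[of _ "[]"])
  then show ?thesis
    unfolding decay_def bdd_above_def by fastforce
qed

text \<open>In the converse direction each entry of \<open>bs\<close> uses up one order of
  differentiability, so the induction over \<open>bs\<close> has to carry all orders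
  \<open>n\<close> at once.\<close>

lemma schwartz_iff_upto: "f \<in> schwartz \<longleftrightarrow> (\<forall>n. schwartz_upto n f)"
proof safe
  fix n assume "f \<in> schwartz"
  then show "schwartz_upto n f"
    by (induction n arbitrary: f)
      (auto simp: schwartz_decay schwartz_differentiable schwartz_pd)
next
  assume f: "\<forall>n. schwartz_upto n f"
  have it: "\<forall>n. schwartz_upto n (iter_partial bs f)" if "set bs \<subseteq> Basis" for bs
    using that
  proof (induction bs)
    case (Cons b bs)
    then have "schwartz_upto (Suc n) (iter_partial bs f)" for n by auto
    then show ?case
      using Cons.prems by (auto simp: iter_partial_Cons simp del: iter_partial.simps)
  qed (use f in simp)
  show "f \<in> schwartz"
    unfolding schwartz_def smooth_def
  proof (safe, goal_cases)
    case (1 bs)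
    then show ?case
      using it[of bs] by (auto simp: differentiable_on_def differentiable_at_withinI dest: spec[of _ "Suc 0"])
  next
    case (2 N bs)
    then have "decay (iter_partial bs f)"
      using it[of bs] by (auto dest: spec[of _ 0])
    then obtain C where "\<And>x. japanese x ^ N * norm (iter_partial bs f x) \<le> C"
      by (auto simp: decay_def)
    then show ?case by (rule bdd_aboveI2)
  qed
qed

lemma schwartz_upto_Suc: "schwartz_upto (Suc n) f \<Longrightarrow> schwartz_upto n f"
  by (induction n arbitrary: f) auto

lemma decay_bounded:
  assumes "decay f"
  obtains C where "0 < C" "\<And>x. norm (f x) \<le> C / japanese x ^ N"
proof -
  obtain C where C: "\<And>x. japanese x ^ N * norm (f x) \<le> C"
    using assms by (auto simp: decay_def)
  show ?thesis
  proof (rule that[of "max C 1"])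
    show "norm (f x) \<le> max C 1 / japanese x ^ N" for x
      using C[of x] by (simp add: field_simps le_max_iff_disj)
  qed auto
qed

lemma decay_boundedI:
  assumes "\<And>N. \<exists>C. \<forall>x. norm (f x) \<le> C / japanese x ^ N"
  shows "decay f"
  unfolding decay_def
proof
  fix N
  obtain C where "\<forall>x. norm (f x) \<le> C / japanese x ^ N" using assms by blast
  then show "\<exists>C. \<forall>x. japanese x ^ N * norm (f x) \<le> C"
    by (intro exI[of _ C]) (simp add: field_simps)
qed

lemma decay_add: "decay f \<Longrightarrow> decay g \<Longrightarrow> decay (\<lambda>x. f x + g x)"
proof (rule decay_boundedI)
  fix N assume "decay f" "decay g"
  then obtain C D where "\<And>x. norm (f x) \<le> C / japanese x ^ N" "\<And>x. norm (g x) \<le> D / japanese x ^ N"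
    by (metis decay_bounded)
  then have "norm (f x + g x) \<le> (C + D) / japanese x ^ N" for x
    by (metis add_divide_distrib add_mono norm_triangle_le)
  then show "\<exists>C. \<forall>x. norm (f x + g x) \<le> C / japanese x ^ N" by blast
qed

lemma decay_mult:
  assumes "\<And>x. norm (g x) \<le> C * japanese x ^ M" and "decay f"
  shows "decay (\<lambda>x. g x * f x)"
proof (rule decay_boundedI)
  fix N
  obtain D where D: "\<And>x. norm (f x) \<le> D / japanese x ^ (M + N)" "0 < D"
    using assms(2) by (metis decay_bounded)
  have "norm (g x * f x) \<le> (C * D) / japanese x ^ N" for x
  proof -
    have "norm (g x * f x) \<le> (C * japanese x ^ M) * (D / japanese x ^ (M + N))"
      unfolding norm_mult by (intro mult_mono' assms(1) D norm_ge_zero)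
    then show ?thesis by (simp add: power_add)
  qed
  then show "\<exists>C. \<forall>x. norm (g x * f x) \<le> C / japanese x ^ N" by blast
qed

lemma decay_cmult: "decay f \<Longrightarrow> decay (\<lambda>x. c * f x)"
  using decay_mult[of "\<lambda>_. c" "norm c" 0 f] by simp

lemma pd_add:
  assumes "\<And>x. f differentiable (at x)" "\<And>x. g differentiable (at x)"
  shows "pd b (\<lambda>x. f x + g x) = (\<lambda>x. pd b f x + pd b g x)"
proof
  fix x
  show "pd b (\<lambda>x. f x + g x) x = pd b f x + pd b g x"
    using assms unfolding frechet_derivative_works by (subst pd_eq) (auto intro: has_derivative_add simp: pd_def)
qed

lemma pd_cmult:
  assumes "\<And>x. f differentiable (at x)"
  shows "pd b (\<lambda>x. c * f x) = (\<lambda>x. c * pd b f x)"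
proof
  fix x
  show "pd b (\<lambda>x. c * f x) x = c * pd b f x"
    using assms unfolding frechet_derivative_works by (subst pd_eq) (auto intro: has_derivative_mult_right simp: pd_def)
qed

lemma schwartz_upto_add: "schwartz_upto n f \<Longrightarrow> schwartz_upto n g \<Longrightarrow> schwartz_upto n (\<lambda>x. f x + g x)"
  by (induction n arbitrary: f g) (auto simp: decay_add pd_add)

lemma schwartz_upto_cmult: "schwartz_upto n f \<Longrightarrow> schwartz_upto n (\<lambda>x. c * f x)"
  by (induction n arbitrary: f) (auto simp: decay_cmult pd_cmult)

lemma schwartz_add: "f \<in> schwartz \<Longrightarrow> g \<in> schwartz \<Longrightarrow> (\<lambda>x. f x + g x) \<in> schwartz"
  by (simp add: schwartz_iff_upto schwartz_upto_add)

lemma schwartz_cmult: "f \<in> schwartz \<Longrightarrow> (\<lambda>x. c * f x) \<in> schwartz"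
  by (simp add: schwartz_iff_upto schwartz_upto_cmult)

lemma schwartz_uminus: "f \<in> schwartz \<Longrightarrow> (\<lambda>x. - f x) \<in> schwartz"
  using schwartz_cmult[of f "-1"] by simp

lemma schwartz_diff: "f \<in> schwartz \<Longrightarrow> g \<in> schwartz \<Longrightarrow> (\<lambda>x. f x - g x) \<in> schwartz"
  using schwartz_add[OF _ schwartz_uminus[of g], of f] by simp

lemma schwartz_0: "(\<lambda>_::'a::euclidean_space. 0) \<in> schwartz"
proof -
  have "schwartz_upto n (\<lambda>_::'a. 0)" for n
    by (induction n) (auto simp: decay_def pd_def frechet_derivative_const intro!: exI[of _ 0])
  then show ?thesis by (simp add: schwartz_iff_upto)
qed

lemma schwartz_sum:
  "(\<And>i. i \<in> I \<Longrightarrow> f i \<in> schwartz) \<Longrightarrow> (\<lambda>x. \<Sum>i\<in>I. f i x) \<in> schwartz"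
  by (induction I rule: infinite_finite_induct) (auto simp: schwartz_0 schwartz_add)

lemma schwartz_pd_any:
  assumes "f \<in> schwartz" shows "pd v f \<in> schwartz"
proof -
  have "pd v f x = (\<Sum>b\<in>Basis. of_real (v \<bullet> b) * pd b f x)" for x
  proof -
    have lin: "linear (\<lambda>h. pd h f x)"
      by (rule has_derivative_linear[OF schwartz_has_derivative[OF assms]])
    have "pd (\<Sum>b\<in>Basis. (v \<bullet> b) *\<^sub>R b) f x = (\<Sum>b\<in>Basis. (v \<bullet> b) *\<^sub>R pd b f x)"
      by (simp add: linear_sum[OF lin] linear_scale[OF lin])
    then show ?thesis by (simp add: euclidean_representation scaleR_conv_of_real)
  qed
  then have "pd v f = (\<lambda>x. \<Sum>b\<in>Basis. of_real (v \<bullet> b) * pd b f x)" by auto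
  then show ?thesis
    using assms by (auto intro!: schwartz_sum schwartz_cmult schwartz_pd)
qed

lemma pd_linear:
  assumes "f \<in> schwartz" shows "linear (\<lambda>h. pd h f x)"
  by (rule has_derivative_linear[OF schwartz_has_derivative[OF assms]])

lemma pd_mulX:
  assumes "\<And>x. f differentiable (at x)"
  shows "pd b (\<lambda>x. of_real (x \<bullet> v) * f x) = (\<lambda>x. of_real (b \<bullet> v) * f x + of_real (x \<bullet> v) * pd b f x)"
proof
  fix x
  have f: "(f has_derivative (\<lambda>h. pd h f x)) (at x)"
    using assms unfolding frechet_derivative_works pd_def by blast
  have "((\<lambda>x. of_real (x \<bullet> v) * f x) has_derivative
      (\<lambda>h. of_real (x \<bullet> v) * pd h f x + of_real (h \<bullet> v) * f x)) (at x)"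
    by (intro has_derivative_mult f has_derivative_of_real has_derivative_inner_left has_derivative_ident)
  from pd_eq[OF this]
  show "pd b (\<lambda>x. of_real (x \<bullet> v) * f x) x = of_real (b \<bullet> v) * f x + of_real (x \<bullet> v) * pd b f x"
    by simp
qed

lemma schwartz_upto_mulX: "schwartz_upto n f \<Longrightarrow> schwartz_upto n (\<lambda>x. of_real (x \<bullet> v) * f x)"
proof (induction n arbitrary: f)
  have dec: "decay (\<lambda>x. of_real (x \<bullet> v) * f x)" if "decay f" for f :: "'a \<Rightarrow> complex"
  proof (rule decay_mult[OF _ that])
    fix x
    have "\<bar>x \<bullet> v\<bar> \<le> norm v * norm x"
      using Cauchy_Schwarz_ineq2[of x v] by (simp add: mult.commute)
    also have "\<dots> \<le> norm v * japanese x"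
      by (intro mult_left_mono norm_le_japanese) simp
    finally show "norm (complex_of_real (x \<bullet> v)) \<le> norm v * japanese x ^ 1" by simp
  qed
  {
    case 0
    then show ?case by (simp add: dec)
  next
    case (Suc n)
    have "(\<lambda>x. complex_of_real (x \<bullet> v) * f x) differentiable (at x)" for x
    proof -
      have "f differentiable (at x)" using Suc.prems by simp
      then obtain f' where "(f has_derivative f') (at x)" by (auto simp: differentiable_def)
      from has_derivative_mult[OF has_derivative_of_real[OF has_derivative_inner_left[OF has_derivative_ident]] this]
      show ?thesis unfolding differentiable_def by blast
    qed
    with Suc show ?case
      by (auto simp: dec pd_mulX intro!: schwartz_upto_add schwartz_upto_cmult
          schwartz_upto_Suc[OF Suc.prems])
  }
qed

lemma schwartz_mulX: "f \<in> schwartz \<Longrightarrow> (\<lambda>x. of_real (x \<bullet> v) * f x) \<in> schwartz"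
  by (simp add: schwartz_iff_upto schwartz_upto_mulX)

section \<open>Time-frequency shifts and Schwartz seminorms\<close>

lemma has_derivative_cis_inner:
  "((\<lambda>y. cis (y \<bullet> \<xi>)) has_derivative (\<lambda>h. \<i> * of_real (h \<bullet> \<xi>) * cis (x \<bullet> \<xi>))) (at x)"
proof -
  have "((\<lambda>y. \<i> * complex_of_real (y \<bullet> \<xi>)) has_derivative (\<lambda>h. \<i> * of_real (h \<bullet> \<xi>))) (at x)"
    by (intro has_derivative_mult_right has_derivative_of_real has_derivative_inner_left has_derivative_ident)
  from has_derivative_compose[OF this has_field_derivative_imp_has_derivative[OF DERIV_exp]]
  show ?thesis unfolding cis_conv_exp by (simp add: mult.commute)
qed

lemma tf_shift_has_derivative:
  assumes "f \<in> schwartz"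
  shows "(tf_shift z f has_derivative
    (\<lambda>h. tf_shift z (pd h f) x + \<i> * of_real (h \<bullet> snd z) * tf_shift z f x)) (at x)"
proof -
  have "((\<lambda>y. f (y - fst z)) has_derivative (\<lambda>h. pd h f (x - fst z))) (at x)"
    by (rule has_derivative_compose[OF _ schwartz_has_derivative[OF assms]])
      (auto intro!: derivative_eq_intros)
  from has_derivative_mult[OF has_derivative_cis_inner[of "snd z"] this]
  show ?thesis
    unfolding tf_shift_def by (rule has_derivative_eq_rhs) (auto simp: algebra_simps)
qed

lemma pd_tf_shift:
  assumes "f \<in> schwartz"
  shows "pd b (tf_shift z f) = (\<lambda>x. tf_shift z (pd b f) x + \<i> * of_real (b \<bullet> snd z) * tf_shift z f x)"
  by (rule ext, rule pd_eq[OF tf_shift_has_derivative[OF assms]])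

lemma norm_tf_shift: "norm (tf_shift z f x) = norm (f (x - fst z))"
  by (simp add: tf_shift_def norm_mult)

lemma decay_tf_shift:
  assumes "decay f"
  shows "\<exists>C. \<forall>z x. japanese x ^ N * norm (tf_shift z f x) \<le> C * japanese z ^ N"
proof -
  obtain D where D: "\<And>x. norm (f x) \<le> D / japanese x ^ N" "0 < D"
    using assms by (metis decay_bounded)
  have "japanese x ^ N * norm (tf_shift z f x) \<le> (2 ^ N * D) * japanese z ^ N" for z x
  proof -
    have "japanese x ^ N * norm (tf_shift z f x)
        \<le> (2 ^ N * japanese (fst z) ^ N * japanese (x - fst z) ^ N) * (D / japanese (x - fst z) ^ N)"
      unfolding norm_tf_shift by (intro mult_mono japanese_diff_power D) auto
    also have "\<dots> = 2 ^ N * D * japanese (fst z) ^ N" by simp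
    also have "\<dots> \<le> 2 ^ N * D * japanese z ^ N"
      using D norm_fst_le[of "fst z" "snd z"] by (intro mult_left_mono power_mono japanese_mono) auto
    finally show ?thesis .
  qed
  then show ?thesis by blast
qed

lemma schwartz_tf_shift:
  assumes "f \<in> schwartz" shows "tf_shift z f \<in> schwartz"
proof -
  have dec: "decay (tf_shift z f)" if "f \<in> schwartz" for f
    using decay_tf_shift[OF schwartz_decay[OF that]] unfolding decay_def by blast
  have "schwartz_upto n (tf_shift z f)" for n
    using assms
  proof (induction n arbitrary: f)
    case (Suc n)
    have "tf_shift z f differentiable (at x)" for x
      using tf_shift_has_derivative[OF Suc.prems] differentiable_def by blast
    with Suc show ?case
      by (auto simp: dec pd_tf_shift intro!: schwartz_upto_add schwartz_upto_cmult schwartz_pd)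
  qed (simp add: dec)
  then show ?thesis by (simp add: schwartz_iff_upto)
qed

lemma iter_partial_add:
  "f \<in> schwartz \<Longrightarrow> g \<in> schwartz \<Longrightarrow> set bs \<subseteq> Basis \<Longrightarrow>
    iter_partial bs (\<lambda>x. f x + g x) = (\<lambda>x. iter_partial bs f x + iter_partial bs g x)"
proof (induction bs arbitrary: f g rule: rev_induct)
  case (snoc b bs)
  then show ?case
    by (simp add: iter_partial_snoc pd_add schwartz_differentiable schwartz_pd)
qed simp

lemma iter_partial_cmult:
  "f \<in> schwartz \<Longrightarrow> set bs \<subseteq> Basis \<Longrightarrow>
    iter_partial bs (\<lambda>x. c * f x) = (\<lambda>x. c * iter_partial bs f x)"
proof (induction bs arbitrary: f rule: rev_induct)
  case (snoc b bs)
  then show ?case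
    by (simp add: iter_partial_snoc pd_cmult schwartz_differentiable schwartz_pd)
qed simp

lemma schwartz_iter_partial: "f \<in> schwartz \<Longrightarrow> set bs \<subseteq> Basis \<Longrightarrow> iter_partial bs f \<in> schwartz"
  by (induction bs) (auto simp: iter_partial_Cons schwartz_pd simp del: iter_partial.simps(2))

text \<open>Translation costs a power of \<open>japanese z\<close> by Peetre's inequality, and each
  derivative falling on the modulation brings down a component of the frequency. The resulting
  polynomial growth in \<open>z\<close> will be absorbed by rapidly decreasing coefficients.\<close>

lemma iter_partial_tf_shift_bound:
  assumes "f \<in> schwartz" "set bs \<subseteq> Basis"
  shows "\<exists>C M. \<forall>z x. japanese x ^ N * norm (iter_partial bs (tf_shift z f) x) \<le> C * japanese z ^ M"
  using assms
proof (induction bs arbitrary: f rule: rev_induct)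
  case Nil
  then show ?case
    using decay_tf_shift[OF schwartz_decay, of f N] by auto
next
  case (snoc b bs)
  then have b: "b \<in> Basis" "set bs \<subseteq> Basis" by auto
  obtain C1 M1 where 1: "\<And>z x. japanese x ^ N * norm (iter_partial bs (tf_shift z (pd b f)) x) \<le> C1 * japanese z ^ M1"
    using snoc.IH[of "pd b f"] snoc.prems b schwartz_pd by meson
  obtain C2 M2 where 2: "\<And>z x. japanese x ^ N * norm (iter_partial bs (tf_shift z f) x) \<le> C2 * japanese z ^ M2"
    using snoc.IH[of f] snoc.prems b by meson
  have C1: "0 \<le> C1"
    using order_trans[OF _ 1[of 0 0]] by simp
  have C2: "0 \<le> C2"
    using order_trans[OF _ 2[of 0 0]] by simp
  have "japanese x ^ N * norm (iter_partial (bs @ [b]) (tf_shift z f) x) \<le> (C1 + C2) * japanese z ^ (M1 + M2 + 1)" for z x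
  proof -
    have "norm (iter_partial (bs @ [b]) (tf_shift z f) x)
        = norm (iter_partial bs (tf_shift z (pd b f)) x + \<i> * of_real (b \<bullet> snd z) * iter_partial bs (tf_shift z f) x)"
      using snoc.prems b by (simp add: iter_partial_snoc pd_tf_shift iter_partial_add iter_partial_cmult
          schwartz_tf_shift schwartz_pd schwartz_cmult)
    also have "\<dots> \<le> norm (iter_partial bs (tf_shift z (pd b f)) x) + \<bar>b \<bullet> snd z\<bar> * norm (iter_partial bs (tf_shift z f) x)"
      by (rule norm_triangle_le) (simp add: norm_mult)
    finally have "japanese x ^ N * norm (iter_partial (bs @ [b]) (tf_shift z f) x)
        \<le> japanese x ^ N * (norm (iter_partial bs (tf_shift z (pd b f)) x) + \<bar>b \<bullet> snd z\<bar> * norm (iter_partial bs (tf_shift z f) x))"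
      by (rule mult_left_mono) auto
    also have "\<dots> = japanese x ^ N * norm (iter_partial bs (tf_shift z (pd b f)) x)
        + \<bar>b \<bullet> snd z\<bar> * (japanese x ^ N * norm (iter_partial bs (tf_shift z f) x))"
      by (simp add: algebra_simps)
    also have "\<dots> \<le> C1 * japanese z ^ M1 + japanese z * (C2 * japanese z ^ M2)"
    proof (rule add_mono[OF 1 mult_mono[OF _ 2]])
      have "\<bar>b \<bullet> snd z\<bar> \<le> norm (snd z)"
        using Basis_le_norm[OF b(1), of "snd z"] by (simp add: inner_commute)
      also have "\<dots> \<le> japanese z"
        using norm_snd_le[of "snd z" "fst z"] norm_le_japanese[of z] by simp
      finally show "\<bar>b \<bullet> snd z\<bar> \<le> japanese z" .
    qed auto
    also have "\<dots> = C1 * japanese z ^ M1 + C2 * japanese z ^ (M2 + 1)"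
      by simp
    also have "\<dots> \<le> C1 * japanese z ^ (M1 + M2 + 1) + C2 * japanese z ^ (M1 + M2 + 1)"
      using C1 C2 by (intro add_mono mult_left_mono japanese_power_mono) auto
    finally show ?thesis by (simp add: algebra_simps)
  qed
  then show ?case by blast
qed

text \<open>A real supremum says something only over a set that is bounded above. Here the index
  lists are finite in number and each contributes a bounded family.\<close>

lemma schwartz_seminorm_ge:
  assumes "f \<in> schwartz" "set bs \<subseteq> Basis" "length bs \<le> N"
  shows "japanese x ^ N * norm (iter_partial bs f x) \<le> schwartz_seminorm N f"
proof -
  let ?B = "{bs :: 'a list. set bs \<subseteq> Basis \<and> length bs \<le> N}"
  let ?h = "\<lambda>(bs, x). japanese x ^ N * norm (iter_partial bs f x)"
  have fin: "finite ?B" using finite_lists_length_le[of "Basis :: 'a set" N] by simp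
  have "bdd_above (range (\<lambda>x. japanese x ^ N * norm (iter_partial bs f x)))" if "bs \<in> ?B" for bs
    using assms(1) that by (auto simp: schwartz_def)
  then have "bdd_above (\<Union>bs\<in>?B. range (\<lambda>x. japanese x ^ N * norm (iter_partial bs f x)))"
    using fin by (subst bdd_above_UN) auto
  moreover have "?h ` (?B \<times> UNIV) = (\<Union>bs\<in>?B. range (\<lambda>x. japanese x ^ N * norm (iter_partial bs f x)))"
    by auto
  ultimately have "bdd_above (?h ` (?B \<times> UNIV))" by (simp only:)
  from cSUP_upper[OF _ this, of "(bs, x)"] show ?thesis
    using assms unfolding schwartz_seminorm_def by auto
qed

lemma schwartz_seminorm_le:
  assumes "\<And>bs x. set bs \<subseteq> Basis \<Longrightarrow> length bs \<le> N \<Longrightarrow> japanese x ^ N * norm (iter_partial bs f x) \<le> M"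
  shows "schwartz_seminorm N f \<le> M"
  unfolding schwartz_seminorm_def
proof (rule cSUP_least)
  have "([], 0) \<in> {bs::'a list. set bs \<subseteq> Basis \<and> length bs \<le> N} \<times> (UNIV::'a set)" by auto
  then show "{bs::'a list. set bs \<subseteq> Basis \<and> length bs \<le> N} \<times> (UNIV::'a set) \<noteq> {}" by blast
qed (use assms in auto)

lemma schwartz_seminorm_nonneg: "f \<in> schwartz \<Longrightarrow> 0 \<le> schwartz_seminorm N f"
  using schwartz_seminorm_ge[of f "[]" N 0] by (simp add: order_trans[OF norm_ge_zero])

lemma schwartz_seminorm_tf_shift:
  assumes "f \<in> schwartz"
  shows "\<exists>C M. 0 \<le> C \<and> (\<forall>z. schwartz_seminorm N (tf_shift z f) \<le> C * japanese z ^ M)"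
proof -
  let ?B = "{bs :: 'a list. set bs \<subseteq> Basis \<and> length bs \<le> N}"
  have fin: "finite ?B" using finite_lists_length_le[of "Basis :: 'a set" N] by simp
  have "\<forall>bs\<in>?B. \<exists>C M. \<forall>z x. japanese x ^ N * norm (iter_partial bs (tf_shift z f) x) \<le> C * japanese z ^ M"
    using iter_partial_tf_shift_bound[OF assms] by auto
  then obtain C M where CM: "\<And>bs z x. bs \<in> ?B \<Longrightarrow>
      japanese x ^ N * norm (iter_partial bs (tf_shift z f) x) \<le> C bs * japanese z ^ M bs"
    by metis
  \<comment> \<open>Sums over the finitely many lists take the place of maxima.\<close>
  define C0 where "C0 = (\<Sum>bs\<in>?B. \<bar>C bs\<bar>)"
  define M0 where "M0 = (\<Sum>bs\<in>?B. M bs)"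
  have "schwartz_seminorm N (tf_shift z f) \<le> C0 * japanese z ^ M0" for z
  proof (rule schwartz_seminorm_le)
    fix bs :: "'a list" and x assume "set bs \<subseteq> Basis" "length bs \<le> N"
    then have bs: "bs \<in> ?B" by auto
    have "C bs * japanese z ^ M bs \<le> \<bar>C bs\<bar> * japanese z ^ M bs"
      by (intro mult_right_mono) auto
    also have "\<dots> \<le> C0 * japanese z ^ M0"
    proof (intro mult_mono japanese_power_mono)
      show "\<bar>C bs\<bar> \<le> C0" unfolding C0_def
        using member_le_sum[of bs ?B "\<lambda>bs. \<bar>C bs\<bar>"] fin bs by auto
      then show "0 \<le> C0" by linarith
      show "M bs \<le> M0" unfolding M0_def using fin bs member_le_sum[of bs ?B M] by auto
    qed auto
    finally show "japanese x ^ N * norm (iter_partial bs (tf_shift z f) x) \<le> C0 * japanese z ^ M0"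
      using CM[OF bs, of x z] by linarith
  qed
  moreover have "0 \<le> C0" by (simp add: C0_def sum_nonneg)
  ultimately show ?thesis by blast
qed

section \<open>Symbols with bounded derivatives\<close>

lemma S00_pd: "a \<in> S00 \<Longrightarrow> b \<in> Basis \<Longrightarrow> pd b a \<in> S00"
  unfolding S00_def smooth_def by (auto simp flip: iter_partial_snoc)

lemma S00_has_derivative: "a \<in> S00 \<Longrightarrow> (a has_derivative (\<lambda>h. pd h a x)) (at x)"
  unfolding S00_def smooth_def differentiable_on_def
  by (auto simp: pd_def frechet_derivative_works dest!: spec[of _ "[]"])

lemma S00_bounded: assumes "a \<in> S00" obtains C where "0 < C" "\<And>x. norm (a x) \<le> C"
proof -
  have "bdd_above (range (\<lambda>x. norm (a x)))"
    using assms unfolding S00_def by (auto dest!: spec[of _ "[]"])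
  then obtain C where "\<And>x. norm (a x) \<le> C" by (auto simp: bdd_above_def)
  then show ?thesis by (intro that[of "max C 1"]) (auto simp: le_max_iff_disj)
qed

text \<open>The extension by duality uses the operator of the conjugate symbol, so it is this symbol
  to which the matrix estimates will be applied.\<close>

lemma S00_cnj: assumes "a \<in> S00" shows "(\<lambda>z. cnj (a z)) \<in> S00"
proof -
  have it: "iter_partial bs (\<lambda>z. cnj (a z)) = (\<lambda>z. cnj (iter_partial bs a z))" if "set bs \<subseteq> Basis" for bs
    using that
  proof (induction bs)
    case (Cons b bs)
    have "(iter_partial bs a has_derivative (\<lambda>h. pd h (iter_partial bs a) x)) (at x)" for x
      using Cons.prems assms unfolding S00_def smooth_def differentiable_on_def
      by (auto simp: pd_def frechet_derivative_works)
    from has_derivative_cnj[OF this]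
    have "pd b (\<lambda>z. cnj (iter_partial bs a z)) x = cnj (pd b (iter_partial bs a) x)" for x
      by (rule pd_eq)
    then show ?case
      using Cons by (simp add: iter_partial_Cons del: iter_partial.simps)
  qed simp
  have "(\<lambda>z. cnj (iter_partial bs a z)) differentiable (at x)" if "set bs \<subseteq> Basis" for bs x
  proof -
    have "iter_partial bs a differentiable (at x)"
      using that assms unfolding S00_def smooth_def differentiable_on_def by auto
    then show ?thesis unfolding differentiable_def using has_derivative_cnj by blast
  qed
  with it assms show ?thesis
    unfolding S00_def smooth_def differentiable_on_def by (auto simp: differentiable_at_withinI)
qed

section \<open>The inner product on Schwartz functions\<close>

abbreviation japanese_int :: "'a::euclidean_space itself \<Rightarrow> real" where
  "japanese_int _ \<equiv> (LINT x|lborel. 1 / japanese (x::'a) ^ (2 * DIM('a)))"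

section \<open>Integrals of rapidly decreasing functions and integration by parts\<close>

lemma lborel_integral_translate:
  fixes f :: "'a::euclidean_space \<Rightarrow> 'b::{banach, second_countable_topology}"
  assumes "f \<in> borel_measurable borel"
  shows "(LINT x|lborel. f (x + t)) = (LINT x|lborel. f x)"
proof -
  have "(LINT x|lborel. f x) = (LINT x|distr lborel borel ((+) t). f x)"
    by (simp add: lborel_distr_plus)
  also have "\<dots> = (LINT x|lborel. f (t + x))"
    using assms by (intro integral_distr) auto
  finally show ?thesis by (simp add: add.commute)
qed

lemma lborel_integrable_translate:
  fixes f :: "'a::euclidean_space \<Rightarrow> 'b::{banach, second_countable_topology}"
  assumes "integrable lborel f"
  shows "integrable lborel (\<lambda>x. f (x + t))"
proof -
  have [measurable]: "f \<in> borel_measurable borel" using assms by auto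
  have "integrable (distr lborel borel ((+) t)) f"
    using assms by (simp add: lborel_distr_plus)
  then show ?thesis
    by (subst (asm) integrable_distr_eq) (auto simp: add.commute)
qed

lemma integrable_inverse_japanese_shift:
  "integrable lborel (\<lambda>x::'a::euclidean_space. C / japanese (x - m) ^ (2 * DIM('a)))"
proof -
  have "integrable lborel (\<lambda>x::'a. C * (1 / japanese (x + (- m)) ^ (2 * DIM('a))))"
    by (intro integrable_mult_right lborel_integrable_translate[OF integrable_inverse_japanese])
  then show ?thesis by simp
qed

lemma integral_inverse_japanese_shift:
  fixes m :: "'a::euclidean_space"
  shows "(LINT x|lborel. C / japanese (x - m) ^ (2 * DIM('a))) = C * japanese_int TYPE('a)"
proof -
  have "(LINT x|lborel. C / japanese (x - m) ^ (2 * DIM('a))) = (LINT x|lborel. C * (1 / japanese (x + (- m) :: 'a) ^ (2 * DIM('a))))"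
    by simp
  also have "\<dots> = C * (LINT x|lborel. (1 / japanese (x + (- m) :: 'a) ^ (2 * DIM('a))))"
    by (rule integral_mult_right_zero)
  also have "\<dots> = C * japanese_int TYPE('a)"
    by (subst lborel_integral_translate) (auto simp: japanese_def)
  finally show ?thesis .
qed

lemma integrable_decay:
  fixes g :: "'a::euclidean_space \<Rightarrow> complex"
  assumes "g \<in> borel_measurable borel" "\<And>x. norm (g x) \<le> C / japanese (x - m) ^ (2 * DIM('a))"
  shows "integrable lborel g"
proof (rule Bochner_Integration.integrable_bound)
  show "integrable lborel (\<lambda>x::'a. C / japanese (x - m) ^ (2 * DIM('a)))"
    by (rule integrable_inverse_japanese_shift)
  show "AE x in lborel. norm (g x) \<le> norm (C / japanese (x - m) ^ (2 * DIM('a)))"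
  proof (rule AE_I2)
    fix x
    show "norm (g x) \<le> norm (C / japanese (x - m) ^ (2 * DIM('a)))"
      using assms(2)[of x] abs_ge_self[of "C / japanese (x - m) ^ (2 * DIM('a))"]
      unfolding real_norm_def by linarith
  qed
qed (use assms in auto)

lemma integral_decay_bound:
  fixes g :: "'a::euclidean_space \<Rightarrow> complex"
  assumes "g \<in> borel_measurable borel" "\<And>x. norm (g x) \<le> C / japanese (x - m) ^ (2 * DIM('a))"
  shows "norm (LINT x|lborel. g x) \<le> C * japanese_int TYPE('a)"
  using Bochner_Integration.integral_norm_bound_integral[OF integrable_decay[OF assms] integrable_inverse_japanese_shift assms(2)]
  by (simp only: integral_inverse_japanese_shift)

lemma japanese_int_nonneg: "0 \<le> japanese_int TYPE('a::euclidean_space)"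
  by (simp add: integral_nonneg_AE)

lemma schwartz_continuous: "f \<in> schwartz \<Longrightarrow> continuous_on UNIV f"
  using schwartz_has_derivative by (metis continuous_at_imp_continuous_on has_derivative_continuous)

lemma schwartz_measurable [measurable_dest]: "f \<in> schwartz \<Longrightarrow> f \<in> borel_measurable borel"
  by (rule borel_measurable_continuous_onI[OF schwartz_continuous])

lemma schwartz_bounded:
  assumes "f \<in> schwartz"
  obtains C where "0 < C" "\<And>x. norm (f x) \<le> C"
  using decay_bounded[OF schwartz_decay[OF assms], of 0] by auto

lemma schwartz_mult_integrable:
  assumes "f \<in> schwartz" "g \<in> borel_measurable borel" "\<And>x. norm (g x) \<le> C"
  shows "integrable lborel (\<lambda>x. f x * g x)"
proof -
  obtain D where D: "0 < D" "\<And>x. norm (f x) \<le> D / japanese x ^ (2 * DIM('a))"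
    using decay_bounded[OF schwartz_decay[OF assms(1)]] by blast
  have "norm (f x * g x) \<le> (D * C) / japanese (x - 0) ^ (2 * DIM('a))" for x
    using mult_mono'[OF D(2) assms(3), of x x] by (simp add: norm_mult)
  with assms show ?thesis by (intro integrable_decay[of _ "D * C" 0]) auto
qed

lemma borel_measurable_cnj [measurable]:
  assumes "f \<in> borel_measurable M" shows "(\<lambda>x. cnj (f x)) \<in> borel_measurable M"
  using borel_measurable_continuous_on[OF _ assms, of cnj] by (simp add: continuous_intros)

lemma schwartz_ip_integrable: "f \<in> schwartz \<Longrightarrow> g \<in> schwartz \<Longrightarrow> integrable lborel (\<lambda>x. f x * cnj (g x))"
  by (rule schwartz_bounded[of g], assumption, rule schwartz_mult_integrable)
    (auto intro: borel_measurable_cnj schwartz_measurable)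

text \<open>The directional derivative as the limit along a sequence of steps, the form that
  dominated convergence requires.\<close>

lemma has_derivative_difference_quotient:
  fixes F :: "'a::real_normed_vector \<Rightarrow> 'b::real_normed_vector"
  assumes "(F has_derivative F') (at x)"
  shows "(\<lambda>n. real (Suc n) *\<^sub>R (F (x + (1 / real (Suc n)) *\<^sub>R b) - F x)) \<longlonglongrightarrow> F' b"
proof (cases "b = 0")
  case True
  then show ?thesis using has_derivative_linear[OF assms] by (simp add: linear_0)
next
  case False
  define h where "h n = (1 / real (Suc n)) *\<^sub>R b" for n
  have "h \<longlonglongrightarrow> 0 *\<^sub>R b"
    unfolding h_def by (intro tendsto_scaleR tendsto_const LIMSEQ_Suc[OF lim_1_over_n])
  then have lim: "filterlim h (at 0) sequentially"
    using False by (auto simp: filterlim_at h_def)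
  have "(\<lambda>n. norm (F (x + h n) - F x - F' (h n)) / norm (h n) * norm b) \<longlonglongrightarrow> 0 * norm b"
    using assms unfolding has_derivative_at
    by (intro tendsto_mult tendsto_const filterlim_compose[OF _ lim]) auto
  moreover have "norm (F (x + h n) - F x - F' (h n)) / norm (h n) * norm b
     = norm (real (Suc n) *\<^sub>R (F (x + h n) - F x) - F' b)" for n
  proof -
    have "F' (h n) = (1 / real (Suc n)) *\<^sub>R F' b"
      unfolding h_def using has_derivative_linear[OF assms] by (simp add: linear_scale)
    then have "real (Suc n) *\<^sub>R (F (x + h n) - F x) - F' b = real (Suc n) *\<^sub>R (F (x + h n) - F x - F' (h n))"
      by (simp add: scaleR_right_diff_distrib)
    moreover have "norm (h n) = norm b / real (Suc n)" by (simp add: h_def)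
    ultimately show ?thesis using False by (simp del: of_nat_Suc)
  qed
  ultimately show ?thesis
    unfolding h_def by (subst tendsto_norm_zero_iff[symmetric, THEN trans[OF LIM_zero_iff[symmetric]]]) simp
qed

text \<open>Integration by parts without iterated integrals or boundary terms: difference quotients
  of \<open>F\<close> integrate to zero by translation invariance, and dominated convergence carries
  this over to the derivative.\<close>

lemma integral_directional_derivative_zero:
  fixes F :: "'a::euclidean_space \<Rightarrow> complex"
  assumes F: "\<And>x. (F has_derivative F' x) (at x)"
    and meas: "(\<lambda>x. F' x b) \<in> borel_measurable borel"
    and bF: "\<And>x. norm (F x) \<le> C / japanese x ^ (2 * DIM('a))"
    and bF': "\<And>x. norm (F' x b) \<le> C / japanese x ^ (2 * DIM('a))"
  shows "(LINT x|lborel. F' x b) = 0"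
proof -
  let ?D = "2 * DIM('a)"
  define G where "G n x = real (Suc n) *\<^sub>R (F (x + (1 / real (Suc n)) *\<^sub>R b) - F x)" for n x
  have "continuous_on UNIV F"
    using F by (metis continuous_at_imp_continuous_on has_derivative_continuous)
  then have [measurable]: "F \<in> borel_measurable borel" by (rule borel_measurable_continuous_onI)
  have "C / japanese (0::'a) ^ ?D \<ge> 0" using order_trans[OF norm_ge_zero bF] .
  then have C0: "0 \<le> C" by simp
  have intF: "integrable lborel F"
    using integrable_decay[of F C 0] bF by auto
  \<comment> \<open>By the mean value theorem the quotient is bounded by the derivative at a point
    of the segment from \<open>x\<close> to \<open>x + b\<close>. Peetre's inequality compares the
    weight there with the weight at \<open>x\<close>, so the majorant is independent of
    \<open>n\<close>.\<close>
  have bound: "norm (G n x) \<le> (C * 2 ^ ?D * japanese b ^ ?D) / japanese (x - 0) ^ ?D" for n x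
  proof -
    define t where "t = 1 / real (Suc n)"
    have t: "0 < t" "t \<le> 1" by (auto simp: t_def)
    define g where "g s = F (x + s *\<^sub>R b)" for s
    have g: "(g has_derivative (\<lambda>h. F' (x + s *\<^sub>R b) (h *\<^sub>R b))) (at s)" for s
      unfolding g_def by (rule has_derivative_compose[OF _ F]) (auto intro!: derivative_eq_intros)
    have "\<exists>s\<in>{0<..<t}. norm (g t - g 0) \<le> norm (F' (x + s *\<^sub>R b) ((t - 0) *\<^sub>R b))"
      using t(1) g by (intro mvt_general) (auto intro!: continuous_at_imp_continuous_on has_derivative_continuous)
    then obtain s where s: "0 < s" "s < t" "norm (g t - g 0) \<le> norm (F' (x + s *\<^sub>R b) (t *\<^sub>R b))" by auto
    have "norm (G n x) = norm (g t - g 0) / t"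
      by (simp add: G_def g_def t_def)
    also have "\<dots> \<le> norm (F' (x + s *\<^sub>R b) (t *\<^sub>R b)) / t"
      using s t by (intro divide_right_mono) auto
    also have "\<dots> = norm (F' (x + s *\<^sub>R b) b)"
      using has_derivative_linear[OF F] t by (simp add: linear_scale)
    also have "\<dots> \<le> C / japanese (x + s *\<^sub>R b) ^ ?D" by (rule bF')
    also have "\<dots> \<le> (C * 2 ^ ?D * japanese b ^ ?D) / japanese x ^ ?D"
    proof -
      have "japanese x ^ ?D \<le> 2 ^ ?D * japanese (x + s *\<^sub>R b) ^ ?D * japanese (- s *\<^sub>R b) ^ ?D"
        using japanese_add_power[of "x + s *\<^sub>R b" "- s *\<^sub>R b" ?D] by simp
      also have "\<dots> \<le> 2 ^ ?D * japanese (x + s *\<^sub>R b) ^ ?D * japanese b ^ ?D"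
        using s t by (intro mult_left_mono power_mono japanese_mono) (auto intro!: mult_left_le_one_le)
      finally have "C * japanese x ^ ?D \<le> C * (2 ^ ?D * japanese (x + s *\<^sub>R b) ^ ?D * japanese b ^ ?D)"
        using C0 by (rule mult_left_mono)
      then show ?thesis by (simp add: field_simps)
    qed
    finally show ?thesis by simp
  qed
  have "(\<lambda>n. LINT x|lborel. G n x) \<longlonglongrightarrow> (LINT x|lborel. F' x b)"
  proof (rule integral_dominated_convergence)
    show "integrable lborel (\<lambda>x::'a. (C * 2 ^ ?D * japanese b ^ ?D) / japanese (x - 0) ^ ?D)"
      by (rule integrable_inverse_japanese_shift)
    show "AE x in lborel. (\<lambda>n. G n x) \<longlonglongrightarrow> F' x b"
      unfolding G_def using has_derivative_difference_quotient[OF F] by auto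
    show "AE x in lborel. norm (G n x) \<le> (C * 2 ^ ?D * japanese b ^ ?D) / japanese (x - 0) ^ ?D" for n
      using bound by auto
    show "(\<lambda>x. F' x b) \<in> borel_measurable lborel" using meas by simp
    show "G n \<in> borel_measurable lborel" for n unfolding G_def[abs_def] by measurable
  qed
  moreover have "(LINT x|lborel. G n x) = 0" for n
  proof -
    have "(LINT x|lborel. F (x + (1 / real (Suc n)) *\<^sub>R b) - F x) = 0"
      using intF lborel_integrable_translate[OF intF] lborel_integral_translate[of F]
      by (subst Bochner_Integration.integral_diff) auto
    then show ?thesis by (simp add: G_def)
  qed
  ultimately show ?thesis by (simp add: LIMSEQ_const_iff)
qed

section \<open>The L2 inner product on Schwartz functions\<close>

abbreviation ip :: "('a::euclidean_space \<Rightarrow> complex) \<Rightarrow> ('a \<Rightarrow> complex) \<Rightarrow> complex" where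
  "ip \<equiv> dist_of_fun"

definition l2norm :: "('a::euclidean_space \<Rightarrow> complex) \<Rightarrow> real" where
  "l2norm f = sqrt (LINT x|lborel. (norm (f x))\<^sup>2)"

lemma l2norm_nonneg [simp]: "0 \<le> l2norm f"
  by (simp add: l2norm_def)

lemma l2norm_square: "(l2norm f)\<^sup>2 = (LINT x|lborel. (norm (f x))\<^sup>2)"
  by (simp add: l2norm_def)

lemma ip_self: "ip f f = of_real ((l2norm f)\<^sup>2)"
proof -
  have "ip f f = (LINT x|lborel. complex_of_real ((norm (f x))\<^sup>2))"
    by (simp add: dist_of_fun_def complex_norm_square del: of_real_power)
  then show ?thesis by (simp only: integral_complex_of_real l2norm_square)
qed

lemma ip_cnj: "ip g f = cnj (ip f g)"
proof -
  have "cnj (ip f g) = (LINT x|lborel. cnj (f x * cnj (g x)))"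
    unfolding dist_of_fun_def by (rule Bochner_Integration.integral_cnj[symmetric])
  then show ?thesis by (simp add: dist_of_fun_def mult.commute)
qed

lemma ip_add_left: "f \<in> schwartz \<Longrightarrow> g \<in> schwartz \<Longrightarrow> h \<in> schwartz \<Longrightarrow>
    ip (\<lambda>x. f x + g x) h = ip f h + ip g h"
  unfolding dist_of_fun_def distrib_right
  by (rule Bochner_Integration.integral_add) (auto intro: schwartz_ip_integrable)

lemma ip_diff_left: "f \<in> schwartz \<Longrightarrow> g \<in> schwartz \<Longrightarrow> h \<in> schwartz \<Longrightarrow>
    ip (\<lambda>x. f x - g x) h = ip f h - ip g h"
  unfolding dist_of_fun_def left_diff_distrib
  by (rule Bochner_Integration.integral_diff) (auto intro: schwartz_ip_integrable)

lemma ip_cmult_left: "ip (\<lambda>x. c * f x) h = c * ip f h"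
  by (simp add: dist_of_fun_def mult.assoc)

lemma ip_add_right: "f \<in> schwartz \<Longrightarrow> g \<in> schwartz \<Longrightarrow> h \<in> schwartz \<Longrightarrow>
    ip h (\<lambda>x. f x + g x) = ip h f + ip h g"
  by (simp add: ip_add_left ip_cnj[of h])

lemma ip_diff_right: "f \<in> schwartz \<Longrightarrow> g \<in> schwartz \<Longrightarrow> h \<in> schwartz \<Longrightarrow>
    ip h (\<lambda>x. f x - g x) = ip h f - ip h g"
  by (simp add: ip_diff_left ip_cnj[of h])

lemma ip_cmult_right: "ip h (\<lambda>x. c * f x) = cnj c * ip h f"
  by (simp add: ip_cmult_left ip_cnj[of h])

lemma schwartz_norm_integrable:
  assumes "f \<in> schwartz" "g \<in> schwartz"
  shows "integrable lborel (\<lambda>x. norm (f x) * norm (g x))"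
  using integrable_norm[OF schwartz_ip_integrable[OF assms]] by (simp add: norm_mult)

lemma schwartz_norm2_integrable: "f \<in> schwartz \<Longrightarrow> integrable lborel (\<lambda>x. (norm (f x))\<^sup>2)"
  using schwartz_norm_integrable[of f f] by (simp add: power2_eq_square)

text \<open>Transferred from the inequality for nonnegative integrals; integrability of products of
  Schwartz functions identifies these with real integrals.\<close>

lemma ip_Cauchy_Schwarz:
  assumes f: "f \<in> schwartz" and g: "g \<in> schwartz"
  shows "norm (ip f g) \<le> l2norm f * l2norm g"
proof -
  note [measurable] = schwartz_measurable[OF f] schwartz_measurable[OF g]
  define I where "I = (LINT x|lborel. norm (f x) * norm (g x))"
  have I0: "0 \<le> I" by (simp add: I_def)
  have "ennreal I = (\<integral>\<^sup>+x. ennreal (norm (f x)) * ennreal (norm (g x)) \<partial>lborel)"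
    unfolding I_def
    by (subst nn_integral_eq_integral[symmetric]) (auto simp: schwartz_norm_integrable f g ennreal_mult)
  moreover have "ennreal ((l2norm f)\<^sup>2) = (\<integral>\<^sup>+x. ennreal (norm (f x)) ^ 2 \<partial>lborel)" if "f \<in> schwartz" for f :: "'a \<Rightarrow> complex"
    unfolding l2norm_square
    by (subst nn_integral_eq_integral[symmetric]) (auto simp: schwartz_norm2_integrable that ennreal_power)
  ultimately have "(ennreal I)\<^sup>2 \<le> ennreal ((l2norm f)\<^sup>2) * ennreal ((l2norm g)\<^sup>2)"
    using Cauchy_Schwarz_nn_integral[of "\<lambda>x. ennreal (norm (f x))" lborel "\<lambda>x. ennreal (norm (g x))"] f g
    by simp
  then have "ennreal (I\<^sup>2) \<le> ennreal ((l2norm f * l2norm g)\<^sup>2)"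
    using I0 by (simp add: ennreal_power ennreal_mult[symmetric] power_mult_distrib)
  then have "I\<^sup>2 \<le> (l2norm f * l2norm g)\<^sup>2" by (simp add: ennreal_le_iff)
  then have "I \<le> l2norm f * l2norm g" by (rule power2_le_imp_le) simp
  moreover have "norm (ip f g) \<le> I"
    unfolding dist_of_fun_def I_def using integral_norm_bound[of lborel "\<lambda>x. f x * cnj (g x)"] by (simp add: norm_mult)
  ultimately show ?thesis by simp
qed

lemma l2norm_add:
  assumes f: "f \<in> schwartz" and g: "g \<in> schwartz"
  shows "l2norm (\<lambda>x. f x + g x) \<le> l2norm f + l2norm g"
proof (rule power2_le_imp_le)
  have "complex_of_real ((l2norm (\<lambda>x. f x + g x))\<^sup>2) = ip f f + ip f g + ip g f + ip g g"
    using f g by (simp add: ip_self[symmetric] ip_add_left ip_add_right schwartz_add del: of_real_power)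
  then have "(l2norm (\<lambda>x. f x + g x))\<^sup>2 = Re (ip f f + ip f g + ip g f + ip g g)"
    by (metis Re_complex_of_real)
  also have "\<dots> = (l2norm f)\<^sup>2 + 2 * Re (ip f g) + (l2norm g)\<^sup>2"
    by (simp add: ip_self ip_cnj[of g f])
  also have "\<dots> \<le> (l2norm f + l2norm g)\<^sup>2"
    using ip_Cauchy_Schwarz[OF f g] complex_Re_le_cmod[of "ip f g"] by (simp add: power2_sum)
  finally show "(l2norm (\<lambda>x. f x + g x))\<^sup>2 \<le> (l2norm f + l2norm g)\<^sup>2" .
qed simp

lemma l2norm_cmult: "l2norm (\<lambda>x. c * f x) = norm c * l2norm f"
  by (simp add: l2norm_def norm_mult power_mult_distrib real_sqrt_mult)

lemma l2norm_uminus: "l2norm (\<lambda>x. - f x) = l2norm f"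
  by (simp add: l2norm_def)

lemma l2norm_diff:
  assumes f: "f \<in> schwartz" and g: "g \<in> schwartz"
  shows "l2norm (\<lambda>x. f x - g x) \<le> l2norm f + l2norm g"
  using l2norm_add[OF f schwartz_uminus[OF g]] by (simp add: l2norm_uminus)

text \<open>The set where \<open>f\<close> does not vanish is open by continuity and null by
  hypothesis, hence empty.\<close>

lemma l2norm_eq_0:
  assumes f: "f \<in> schwartz" and "l2norm f = 0"
  shows "f = (\<lambda>_. 0)"
proof (rule ccontr)
  assume "f \<noteq> (\<lambda>_. 0)"
  define U where "U = {x. f x \<noteq> 0}"
  have "open U"
    unfolding U_def by (rule open_Collect_neq) (auto intro: schwartz_continuous f)
  moreover have "U \<noteq> {}" using \<open>f \<noteq> (\<lambda>_. 0)\<close> by (auto simp: U_def)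
  ultimately have "\<not> negligible U" by (rule open_not_negligible)
  moreover have "AE x in lborel. (norm (f x))\<^sup>2 = 0"
    using assms schwartz_norm2_integrable[OF f]
    by (subst integral_nonneg_eq_0_iff_AE[symmetric]) (auto simp: l2norm_def)
  then have "AE x in lborel. x \<notin> U" by (simp add: U_def)
  then have "U \<in> null_sets lborel"
    using \<open>open U\<close> by (subst (asm) AE_iff_null_sets[symmetric]) auto
  then have "negligible U"
    by (simp add: negligible_iff_null_sets null_sets_completionI)
  ultimately show False by simp
qed

lemma tf_shift_add: "tf_shift z (\<lambda>x. f x + g x) = (\<lambda>x. tf_shift z f x + tf_shift z g x)"
  and tf_shift_cmult: "tf_shift z (\<lambda>x. c * f x) = (\<lambda>x. c * tf_shift z f x)"
  by (auto simp: tf_shift_def algebra_simps)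

lemma tf_shift_0 [simp]: "tf_shift 0 f = f"
  by (simp add: tf_shift_def)

text \<open>Translating the variable by the position part of \<open>z\<close> makes the shift by
  \<open>z\<close> disappear up to a phase. Hence the modulus of a Gram matrix entry depends on
  \<open>w - z\<close> only, which makes row sums uniform.\<close>

lemma ip_tf_shift:
  assumes f: "f \<in> schwartz" and g: "g \<in> schwartz"
  shows "ip (tf_shift z f) (tf_shift w g) = cis (fst z \<bullet> (snd z - snd w)) * ip f (tf_shift (w - z) g)"
proof -
  note [measurable] = schwartz_measurable[OF schwartz_tf_shift[OF f]] schwartz_measurable[OF schwartz_tf_shift[OF g]]
  have "ip (tf_shift z f) (tf_shift w g)
      = (LINT x|lborel. tf_shift z f (x + fst z) * cnj (tf_shift w g (x + fst z)))"
    unfolding dist_of_fun_def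
    by (rule lborel_integral_translate[symmetric, of "\<lambda>x. tf_shift z f x * cnj (tf_shift w g x)"]) measurable
  also have "\<dots> = (LINT x|lborel. cis (fst z \<bullet> (snd z - snd w)) * (f x * cnj (tf_shift (w - z) g x)))"
  proof (rule Bochner_Integration.integral_cong[OF refl])
    fix x
    have "tf_shift z f (x + fst z) * cnj (tf_shift w g (x + fst z))
       = (cis ((x + fst z) \<bullet> snd z) * cis (- ((x + fst z) \<bullet> snd w))) * (f x * cnj (g (x + fst z - fst w)))"
      by (simp add: tf_shift_def cis_cnj)
    also have "cis ((x + fst z) \<bullet> snd z) * cis (- ((x + fst z) \<bullet> snd w))
       = cis (fst z \<bullet> (snd z - snd w)) * cis (- (x \<bullet> snd (w - z)))"
      by (simp add: cis_mult algebra_simps)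
    finally show "tf_shift z f (x + fst z) * cnj (tf_shift w g (x + fst z))
      = cis (fst z \<bullet> (snd z - snd w)) * (f x * cnj (tf_shift (w - z) g x))"
      by (simp add: tf_shift_def cis_cnj algebra_simps)
  qed
  also have "\<dots> = cis (fst z \<bullet> (snd z - snd w)) * ip f (tf_shift (w - z) g)"
    by (simp add: dist_of_fun_def)
  finally show ?thesis .
qed

lemma norm_ip_tf_shift:
  "f \<in> schwartz \<Longrightarrow> g \<in> schwartz \<Longrightarrow> norm (ip (tf_shift z f) (tf_shift w g)) = norm (ip f (tf_shift (w - z) g))"
  by (simp add: ip_tf_shift norm_mult)

lemma l2norm_tf_shift: assumes "f \<in> schwartz" shows "l2norm (tf_shift z f) = l2norm f"
proof -
  have "complex_of_real ((l2norm (tf_shift z f))\<^sup>2) = complex_of_real ((l2norm f)\<^sup>2)"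
    using ip_tf_shift[OF assms assms, of z z] by (simp add: ip_self del: of_real_power)
  then show ?thesis by (simp add: power2_eq_iff_nonneg del: of_real_power)
qed

text \<open>
  The operator \<open>x \<bullet> q\<^sub>1 - i \<partial>\<^bsub>q\<^sub>2\<^esub>\<close>. It is symmetric, and conjugation by a time-frequency shift
  by \<open>z\<close> adds the number \<open>z \<bullet> q\<close> to it, so that it plays the role of the coordinate \<open>z \<bullet> q\<close> of
  phase space.
\<close>

definition Zop :: "'a \<times> 'a \<Rightarrow> ('a::euclidean_space \<Rightarrow> complex) \<Rightarrow> 'a \<Rightarrow> complex" where
  "Zop q f = (\<lambda>x. of_real (x \<bullet> fst q) * f x - \<i> * pd (snd q) f x)"

lemma schwartz_Zop: "f \<in> schwartz \<Longrightarrow> Zop q f \<in> schwartz"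
  unfolding Zop_def by (intro schwartz_diff schwartz_mulX schwartz_cmult schwartz_pd_any)

lemma schwartz_Zop_funpow: "f \<in> schwartz \<Longrightarrow> (Zop q ^^ k) f \<in> schwartz"
  by (induction k) (auto simp: schwartz_Zop)

lemma Zop_add: "f \<in> schwartz \<Longrightarrow> g \<in> schwartz \<Longrightarrow> Zop q (\<lambda>x. f x + g x) = (\<lambda>x. Zop q f x + Zop q g x)"
  by (auto simp: Zop_def pd_add schwartz_differentiable algebra_simps)

lemma Zop_cmult: "f \<in> schwartz \<Longrightarrow> Zop q (\<lambda>x. c * f x) = (\<lambda>x. c * Zop q f x)"
  by (auto simp: Zop_def pd_cmult schwartz_differentiable algebra_simps)

lemma Zop_diff: "f \<in> schwartz \<Longrightarrow> g \<in> schwartz \<Longrightarrow> Zop q (\<lambda>x. f x - g x) = (\<lambda>x. Zop q f x - Zop q g x)"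
  using Zop_add[of f "\<lambda>x. (-1) * g x" q] Zop_cmult[of g q "-1"] schwartz_cmult[of g "-1"] by simp

lemma Zop_tf_shift:
  "f \<in> schwartz \<Longrightarrow> Zop q (tf_shift z f) = (\<lambda>x. tf_shift z (Zop q f) x + of_real (z \<bullet> q) * tf_shift z f x)"
  by (rule ext) (simp add: Zop_def pd_tf_shift, simp add: tf_shift_def inner_prod_def algebra_simps inner_commute)

section \<open>Decay of the short-time Fourier transform\<close>

lemma integral_pd_ip:
  assumes f: "f \<in> schwartz" and g: "g \<in> schwartz"
  shows "ip (pd b f) g + ip f (pd b g) = 0"
proof -
  let ?D = "2 * DIM('a)"
  define F where "F x = f x * cnj (g x)" for x
  define F' where "F' x h = f x * cnj (pd h g x) + pd h f x * cnj (g x)" for x h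
  obtain G where G: "\<And>x. norm (g x) \<le> G" using schwartz_bounded[OF g] by blast
  obtain G' where G': "\<And>x. norm (pd b g x) \<le> G'" using schwartz_bounded[OF schwartz_pd_any[OF g]] by blast
  obtain C1 where C1: "0 < C1" "\<And>x. norm (f x) \<le> C1 / japanese x ^ ?D"
    using decay_bounded[OF schwartz_decay[OF f]] by blast
  obtain C2 where C2: "0 < C2" "\<And>x. norm (pd b f x) \<le> C2 / japanese x ^ ?D"
    using decay_bounded[OF schwartz_decay[OF schwartz_pd_any[OF f]]] by blast
  have G0: "0 \<le> G" "0 \<le> G'" using order_trans[OF norm_ge_zero G] order_trans[OF norm_ge_zero G'] by auto
  define C where "C = C1 * G + C1 * G' + C2 * G"
  have bF: "norm (F x) \<le> C / japanese x ^ ?D" for x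
  proof -
    have "norm (F x) \<le> (C1 / japanese x ^ ?D) * G"
      unfolding F_def norm_mult using mult_mono'[OF C1(2) G, of x x] by simp
    also have "\<dots> = (C1 * G) / japanese x ^ ?D" by simp
    also have "\<dots> \<le> C / japanese x ^ ?D"
      using G0 C1 C2 by (intro divide_right_mono) (auto simp: C_def)
    finally show ?thesis .
  qed
  have bF': "norm (F' x b) \<le> C / japanese x ^ ?D" for x
  proof -
    have "norm (F' x b) \<le> norm (f x) * norm (pd b g x) + norm (pd b f x) * norm (g x)"
      unfolding F'_def by (rule norm_triangle_le) (simp add: norm_mult)
    also have "\<dots> \<le> (C1 / japanese x ^ ?D) * G' + (C2 / japanese x ^ ?D) * G"
      by (intro add_mono mult_mono' C1 C2 G G') auto
    also have "\<dots> = (C1 * G' + C2 * G) / japanese x ^ ?D" by (simp add: add_divide_distrib)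
    also have "\<dots> \<le> C / japanese x ^ ?D"
      using G0 C1 C2 by (intro divide_right_mono) (auto simp: C_def)
    finally show ?thesis .
  qed
  have "(LINT x|lborel. F' x b) = 0"
  proof (rule integral_directional_derivative_zero[where F = F and F' = F', OF _ _ bF bF'])
    show "(F has_derivative F' x) (at x)" for x
      unfolding F_def F'_def
      by (rule has_derivative_mult[OF schwartz_has_derivative[OF f] has_derivative_cnj[OF schwartz_has_derivative[OF g]]])
    note [measurable] = f[THEN schwartz_measurable] g[THEN schwartz_measurable]
      f[THEN schwartz_pd_any, THEN schwartz_measurable] g[THEN schwartz_pd_any, THEN schwartz_measurable]
    show "(\<lambda>x. F' x b) \<in> borel_measurable borel"
      unfolding F'_def by measurable
  qed
  then show ?thesis
    unfolding F'_def dist_of_fun_def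
    by (subst (asm) Bochner_Integration.integral_add) (auto intro!: schwartz_ip_integrable schwartz_pd_any f g simp: add.commute)
qed

lemma ip_Zop:
  assumes f: "f \<in> schwartz" and g: "g \<in> schwartz"
  shows "ip (Zop q f) g = ip f (Zop q g)"
proof -
  have 1: "ip (\<lambda>x. of_real (x \<bullet> fst q) * f x) g = ip f (\<lambda>x. of_real (x \<bullet> fst q) * g x)"
    by (simp add: dist_of_fun_def mult.assoc mult.left_commute)
  have 2: "ip (pd (snd q) f) g = - ip f (pd (snd q) g)"
    using integral_pd_ip[OF f g] by (simp add: eq_neg_iff_add_eq_0)
  show ?thesis
    unfolding Zop_def using f g 1 2
    by (simp add: ip_diff_left ip_diff_right schwartz_mulX schwartz_cmult schwartz_pd_any ip_cmult_left ip_cmult_right)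
qed

text \<open>Moving \<open>Zop q\<close> across the inner product expresses
  \<open>z \<bullet> q\<close> times the transform as the transform of \<open>Zop q f\<close> minus
  the transform of \<open>f\<close> with window \<open>Zop q \<psi>\<close>. Because of the second
  term the induction ranges over all windows.\<close>

lemma stft_coordinate_bound:
  assumes "\<psi> \<in> schwartz"
  shows "\<exists>C\<ge>0. \<forall>f\<in>schwartz. \<forall>z. \<bar>z \<bullet> q\<bar> ^ k * norm (ip f (tf_shift z \<psi>)) \<le> C * (\<Sum>j\<le>k. l2norm ((Zop q ^^ j) f))"
  using assms
proof (induction k arbitrary: \<psi>)
  case 0
  have "\<forall>f\<in>schwartz. \<forall>z. \<bar>z \<bullet> q\<bar> ^ 0 * norm (ip f (tf_shift z \<psi>)) \<le> l2norm \<psi> * (\<Sum>j\<le>0. l2norm ((Zop q ^^ j) f))"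
    using ip_Cauchy_Schwarz[OF _ schwartz_tf_shift[OF 0]] by (simp add: l2norm_tf_shift[OF 0] mult.commute)
  then show ?case using l2norm_nonneg by blast
next
  case (Suc k)
  obtain C1 where C1: "C1 \<ge> 0" "\<And>f z. f \<in> schwartz \<Longrightarrow>
      \<bar>z \<bullet> q\<bar> ^ k * norm (ip f (tf_shift z \<psi>)) \<le> C1 * (\<Sum>j\<le>k. l2norm ((Zop q ^^ j) f))"
    using Suc.IH[OF Suc.prems] by blast
  obtain C2 where C2: "C2 \<ge> 0" "\<And>f z. f \<in> schwartz \<Longrightarrow>
      \<bar>z \<bullet> q\<bar> ^ k * norm (ip f (tf_shift z (Zop q \<psi>))) \<le> C2 * (\<Sum>j\<le>k. l2norm ((Zop q ^^ j) f))"
    using Suc.IH[OF schwartz_Zop[OF Suc.prems]] by blast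
  have "\<bar>z \<bullet> q\<bar> ^ Suc k * norm (ip f (tf_shift z \<psi>)) \<le> (C1 + C2) * (\<Sum>j\<le>Suc k. l2norm ((Zop q ^^ j) f))"
    if f: "f \<in> schwartz" for f z
  proof -
    have "ip (Zop q f) (tf_shift z \<psi>) = ip f (Zop q (tf_shift z \<psi>))"
      by (rule ip_Zop[OF f schwartz_tf_shift[OF Suc.prems]])
    also have "\<dots> = ip f (tf_shift z (Zop q \<psi>)) + of_real (z \<bullet> q) * ip f (tf_shift z \<psi>)"
      using f Suc.prems by (simp add: Zop_tf_shift ip_add_right schwartz_tf_shift schwartz_Zop schwartz_cmult ip_cmult_right)
    finally have "of_real (z \<bullet> q) * ip f (tf_shift z \<psi>) = ip (Zop q f) (tf_shift z \<psi>) - ip f (tf_shift z (Zop q \<psi>))"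
      by simp
    then have "\<bar>z \<bullet> q\<bar> * norm (ip f (tf_shift z \<psi>)) = norm (ip (Zop q f) (tf_shift z \<psi>) - ip f (tf_shift z (Zop q \<psi>)))"
      by (metis norm_mult norm_of_real)
    also have "\<dots> \<le> norm (ip (Zop q f) (tf_shift z \<psi>)) + norm (ip f (tf_shift z (Zop q \<psi>)))"
      by (rule norm_triangle_ineq4)
    finally have "\<bar>z \<bullet> q\<bar> ^ k * (\<bar>z \<bullet> q\<bar> * norm (ip f (tf_shift z \<psi>)))
       \<le> \<bar>z \<bullet> q\<bar> ^ k * (norm (ip (Zop q f) (tf_shift z \<psi>)) + norm (ip f (tf_shift z (Zop q \<psi>))))"
      by (rule mult_left_mono) simp
    then have "\<bar>z \<bullet> q\<bar> ^ Suc k * norm (ip f (tf_shift z \<psi>))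
       \<le> \<bar>z \<bullet> q\<bar> ^ k * norm (ip (Zop q f) (tf_shift z \<psi>)) + \<bar>z \<bullet> q\<bar> ^ k * norm (ip f (tf_shift z (Zop q \<psi>)))"
      by (simp add: algebra_simps)
    also have "\<dots> \<le> C1 * (\<Sum>j\<le>k. l2norm ((Zop q ^^ j) (Zop q f))) + C2 * (\<Sum>j\<le>k. l2norm ((Zop q ^^ j) f))"
      by (intro add_mono C1 C2 f schwartz_Zop)
    also have "\<dots> \<le> C1 * (\<Sum>j\<le>Suc k. l2norm ((Zop q ^^ j) f)) + C2 * (\<Sum>j\<le>Suc k. l2norm ((Zop q ^^ j) f))"
    proof (intro add_mono mult_left_mono C1 C2)
      have "(\<Sum>j\<le>k. l2norm ((Zop q ^^ j) (Zop q f))) = (\<Sum>j\<le>k. l2norm ((Zop q ^^ Suc j) f))"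
        by (simp add: funpow_swap1)
      also have "\<dots> \<le> (\<Sum>j\<le>Suc k. l2norm ((Zop q ^^ j) f))"
        by (subst sum.atMost_Suc_shift) simp
      finally show "(\<Sum>j\<le>k. l2norm ((Zop q ^^ j) (Zop q f))) \<le> (\<Sum>j\<le>Suc k. l2norm ((Zop q ^^ j) f))" .
    qed simp
    finally show ?thesis by (simp add: algebra_simps)
  qed
  then show ?case using C1(1) C2(1) by (meson add_nonneg_nonneg)
qed

text \<open>Pure powers of one \<open>Zop q\<close> at a time suffice, since powers of the weight
  are recovered from pure powers of the coordinates.\<close>

definition energy :: "nat \<Rightarrow> ('a::euclidean_space \<Rightarrow> complex) \<Rightarrow> real" where
  "energy k f = (\<Sum>q\<in>Basis. \<Sum>j\<le>k. l2norm ((Zop q ^^ j) f))"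

text \<open>The bound sees \<open>f\<close> only through L2 norms of its moments, which can be
  followed through the Neumann series, whereas suprema could not be.\<close>

lemma stft_bound:
  assumes "\<psi> \<in> schwartz"
  shows "\<exists>C\<ge>0. \<forall>f\<in>schwartz. \<forall>z. japanese z ^ k * norm (ip f (tf_shift z \<psi>)) \<le> C * energy k f"
proof -
  have "\<forall>q. \<exists>C\<ge>0. \<forall>f\<in>schwartz. \<forall>z. \<bar>z \<bullet> q\<bar> ^ k * norm (ip f (tf_shift z \<psi>)) \<le> C * (\<Sum>j\<le>k. l2norm ((Zop q ^^ j) f))"
    using stft_coordinate_bound[OF assms] by blast
  from choice[OF this]
  obtain C where C: "\<And>q. C q \<ge> 0" "\<And>q f z. f \<in> schwartz \<Longrightarrow>
     \<bar>z \<bullet> q\<bar> ^ k * norm (ip f (tf_shift z \<psi>)) \<le> C q * (\<Sum>j\<le>k. l2norm ((Zop q ^^ j) f))"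
    by blast
  obtain q0 :: "'a \<times> 'a" where q0: "q0 \<in> Basis" using nonempty_Basis by blast
  define D where "D = (real DIM('a \<times> 'a) + 1) ^ k * (l2norm \<psi> + (\<Sum>q\<in>Basis. C q))"
  have "japanese z ^ k * norm (ip f (tf_shift z \<psi>)) \<le> D * energy k f" if f: "f \<in> schwartz" for f z
  proof -
    have q: "(\<Sum>j\<le>k. l2norm ((Zop q ^^ j) f)) \<le> energy k f" if "q \<in> Basis" for q
      unfolding energy_def by (rule member_le_sum) (use that in \<open>auto intro: sum_nonneg\<close>)
    have "l2norm f \<le> (\<Sum>j\<le>k. l2norm ((Zop q0 ^^ j) f))"
      using member_le_sum[of 0 "{..k}" "\<lambda>j. l2norm ((Zop q0 ^^ j) f)"] by simp
    with q[OF q0] have l2norm: "l2norm f \<le> energy k f" by simp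
    have "norm (ip f (tf_shift z \<psi>)) \<le> l2norm f * l2norm \<psi>"
      using ip_Cauchy_Schwarz[OF f schwartz_tf_shift[OF assms]] by (simp add: l2norm_tf_shift[OF assms])
    also have "\<dots> \<le> l2norm \<psi> * energy k f"
      using mult_right_mono[OF l2norm, of "l2norm \<psi>"] by (simp add: mult.commute)
    finally have 0: "norm (ip f (tf_shift z \<psi>)) \<le> l2norm \<psi> * energy k f" .
    have "japanese z ^ k * norm (ip f (tf_shift z \<psi>))
       \<le> (real DIM('a \<times> 'a) + 1) ^ k * (l2norm \<psi> * energy k f + (\<Sum>q\<in>Basis. C q * energy k f))"
    proof (rule japanese_power_boundI[OF norm_ge_zero 0])
      fix q :: "'a \<times> 'a" assume "q \<in> Basis"
      then have "C q * (\<Sum>j\<le>k. l2norm ((Zop q ^^ j) f)) \<le> C q * energy k f"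
        by (intro mult_left_mono q C)
      with C(2)[OF f, of z q] show "\<bar>z \<bullet> q\<bar> ^ k * norm (ip f (tf_shift z \<psi>)) \<le> C q * energy k f"
        by linarith
    qed
    also have "\<dots> = D * energy k f"
      by (simp add: D_def distrib_left distrib_right sum_distrib_right[symmetric] mult.assoc)
    finally show ?thesis .
  qed
  moreover have "0 \<le> D"
    unfolding D_def using C(1) by (intro mult_nonneg_nonneg add_nonneg_nonneg sum_nonneg) auto
  ultimately show ?thesis by blast
qed

lemma stft_decay:
  assumes "f \<in> schwartz" "\<psi> \<in> schwartz"
  shows "\<exists>C>0. \<forall>z. norm (ip f (tf_shift z \<psi>)) \<le> C / japanese z ^ k"
proof -
  obtain C where C: "\<And>z. japanese z ^ k * norm (ip f (tf_shift z \<psi>)) \<le> C"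
    using stft_bound[OF assms(2), of k] assms(1) by blast
  have "norm (ip f (tf_shift z \<psi>)) \<le> max C 1 / japanese z ^ k" for z
    using C[of z] by (simp add: field_simps le_max_iff_disj)
  then show ?thesis by (intro exI[of _ "max C 1"]) auto
qed

text \<open>For a basis vector \<open>q\<close> one of its two components is zero, so
  \<open>Zop q\<close> is either multiplication by a coordinate or \<open>-\<i>\<close> times a
  partial derivative, and its powers are explicit. The first kind costs \<open>j\<close> weights,
  the second kind \<open>j\<close> derivatives; the index \<open>K + j\<close> allows for
  both.\<close>

lemma Zop_funpow_bound:
  fixes q :: "'a::euclidean_space \<times> 'a"
  assumes f: "f \<in> schwartz" and q: "q \<in> Basis"
  shows "japanese x ^ K * norm ((Zop q ^^ j) f x) \<le> schwartz_seminorm (K + j) f"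
proof -
  have pd0: "pd 0 g x = 0" if "g \<in> schwartz" for g :: "'a \<Rightarrow> complex" and x
    using linear_0[OF pd_linear[OF that]] .
  from q consider b where "b \<in> Basis" "q = (b, 0)" | b where "b \<in> Basis" "q = (0, b)"
    by (auto simp: Basis_prod_def)
  then show ?thesis
  proof cases
    case 1
    have Z: "Zop q g = (\<lambda>x. of_real (x \<bullet> b) * g x)" if "g \<in> schwartz" for g
      using that 1 by (auto simp: Zop_def pd0)
    have "(Zop q ^^ j) f = (\<lambda>x. of_real ((x \<bullet> b) ^ j) * f x)"
    proof (induction j)
      case (Suc j)
      have "(Zop q ^^ Suc j) f = (\<lambda>x. of_real (x \<bullet> b) * (Zop q ^^ j) f x)"
        using Z[OF schwartz_Zop_funpow[OF f]] by simp
      then show ?case by (simp add: Suc mult.assoc)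
    qed simp
    then have "norm ((Zop q ^^ j) f x) = \<bar>x \<bullet> b\<bar> ^ j * norm (f x)"
      by (simp add: norm_mult norm_power)
    also have "\<dots> \<le> japanese x ^ j * norm (f x)"
      using inner_le_japanese[OF 1(1)] by (intro mult_right_mono power_mono) auto
    finally have "japanese x ^ K * norm ((Zop q ^^ j) f x) \<le> japanese x ^ K * (japanese x ^ j * norm (f x))"
      by (rule mult_left_mono) simp
    also have "\<dots> \<le> schwartz_seminorm (K + j) f"
      using schwartz_seminorm_ge[OF f, of "[]" "K + j" x] by (simp add: power_add)
    finally show ?thesis .
  next
    case 2
    have Z: "Zop q g = (\<lambda>x. - \<i> * pd b g x)" for g
      using 2 by (auto simp: Zop_def)
    have "(Zop q ^^ j) f = (\<lambda>x. (- \<i>) ^ j * iter_partial (replicate j b) f x)"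
    proof (induction j)
      case (Suc j)
      have "iter_partial (replicate j b) f \<in> schwartz"
        by (rule schwartz_iter_partial[OF f]) (use 2 in auto)
      then show ?case
        using Suc by (simp add: Z pd_cmult schwartz_differentiable iter_partial_Cons mult.assoc del: iter_partial.simps(2))
    qed simp
    then have "norm ((Zop q ^^ j) f x) = norm (iter_partial (replicate j b) f x)"
      by (simp add: norm_mult norm_power)
    then have "japanese x ^ K * norm ((Zop q ^^ j) f x) \<le> japanese x ^ (K + j) * norm (iter_partial (replicate j b) f x)"
      by (simp add: mult_right_mono japanese_power_mono)
    moreover have "set (replicate j b) \<subseteq> Basis" using 2 by auto
    ultimately show ?thesis
      using schwartz_seminorm_ge[OF f, of "replicate j b" "K + j" x] by simp
  qed
qed

lemma schwartz_seminorm_mono: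
  assumes "f \<in> schwartz" "m \<le> n" shows "schwartz_seminorm m f \<le> schwartz_seminorm n f"
proof (rule schwartz_seminorm_le)
  fix bs :: "'a list" and x assume bs: "set bs \<subseteq> Basis" "length bs \<le> m"
  have "japanese x ^ m * norm (iter_partial bs f x) \<le> japanese x ^ n * norm (iter_partial bs f x)"
    using assms(2) by (intro mult_right_mono japanese_power_mono) auto
  also have "\<dots> \<le> schwartz_seminorm n f"
    using bs assms by (intro schwartz_seminorm_ge) auto
  finally show "japanese x ^ m * norm (iter_partial bs f x) \<le> schwartz_seminorm n f" .
qed

lemma l2norm_le:
  fixes f :: "'a::euclidean_space \<Rightarrow> complex"
  assumes f: "f \<in> schwartz" and M: "\<And>x. japanese x ^ (2 * DIM('a)) * norm (f x) \<le> M"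
  shows "l2norm f \<le> sqrt (japanese_int TYPE('a)) * M"
proof -
  let ?D = "2 * DIM('a)"
  have M0: "0 \<le> M" using order_trans[OF _ M[of 0]] by simp
  have "(norm (f x))\<^sup>2 \<le> M\<^sup>2 / japanese (x - 0) ^ ?D" for x
  proof -
    have sq: "(M / P)\<^sup>2 = M\<^sup>2 / (P * P)" for P :: real
      by (simp add: power2_eq_square)
    have "norm (f x) \<le> M / japanese x ^ ?D" using M[of x] by (simp add: field_simps)
    then have "(norm (f x))\<^sup>2 \<le> (M / japanese x ^ ?D)\<^sup>2" by (rule power_mono) simp
    also have "\<dots> = M\<^sup>2 / japanese x ^ (?D + ?D)" by (simp only: sq power_add)
    also have "\<dots> \<le> M\<^sup>2 / japanese x ^ ?D"
      by (intro divide_left_mono japanese_power_mono) auto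
    finally show ?thesis by simp
  qed
  then have "(LINT x|lborel. (norm (f x))\<^sup>2) \<le> (LINT x|lborel. M\<^sup>2 / japanese (x - 0 :: 'a) ^ ?D)"
    by (intro integral_mono schwartz_norm2_integrable f integrable_inverse_japanese_shift) auto
  also have "\<dots> = M\<^sup>2 * japanese_int TYPE('a)"
    by (rule integral_inverse_japanese_shift)
  finally have "l2norm f \<le> sqrt (M\<^sup>2 * japanese_int TYPE('a))"
    unfolding l2norm_def by (rule real_sqrt_le_mono)
  then show ?thesis using M0 by (simp add: real_sqrt_mult mult.commute)
qed

text \<open>For \<open>k = 0\<close> this bounds the L2 norm by a Schwartz seminorm, so that pairing
  with a Schwartz function becomes a tempered distribution.\<close>

lemma energy_le_seminorm:
  "\<exists>C\<ge>0. \<forall>f::'a::euclidean_space \<Rightarrow> complex. f \<in> schwartz \<longrightarrow>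
     energy k f \<le> C * schwartz_seminorm (2 * DIM('a) + k) f"
proof -
  let ?J = "sqrt (japanese_int TYPE('a))"
  define C where "C = real (card (Basis :: ('a \<times> 'a) set)) * (real (k + 1) * ?J)"
  have "energy k f \<le> C * schwartz_seminorm (2 * DIM('a) + k) f" if f: "f \<in> schwartz" for f :: "'a \<Rightarrow> complex"
  proof -
    have n: "l2norm ((Zop q ^^ j) f) \<le> ?J * schwartz_seminorm (2 * DIM('a) + k) f" if "q \<in> Basis" "j \<le> k" for q j
    proof (rule l2norm_le[OF schwartz_Zop_funpow[OF f]])
      fix x
      show "japanese x ^ (2 * DIM('a)) * norm ((Zop q ^^ j) f x) \<le> schwartz_seminorm (2 * DIM('a) + k) f"
        using Zop_funpow_bound[OF f that(1), of x "2 * DIM('a)" j]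
          schwartz_seminorm_mono[OF f, of "2 * DIM('a) + j" "2 * DIM('a) + k"] that by simp
    qed
    have "energy k f \<le> (\<Sum>q\<in>(Basis::('a \<times> 'a) set). \<Sum>j\<le>k. ?J * schwartz_seminorm (2 * DIM('a) + k) f)"
      unfolding energy_def by (intro sum_mono n) auto
    then show ?thesis by (simp add: C_def mult.assoc)
  qed
  moreover have "0 \<le> C" by (simp add: C_def japanese_int_nonneg)
  ultimately show ?thesis by blast
qed

section \<open>Superpositions of time-frequency shifts\<close>

declare schwartz_tf_shift [simp] schwartz_add [simp] schwartz_diff [simp] schwartz_cmult [simp]
  schwartz_Zop [simp] schwartz_0 [simp]

text \<open>The difference is tested against itself. The identities between frame operators below
  are mostly verified weakly and then lifted by this lemma.\<close>

lemma schwartz_weak_eq: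
  assumes "f \<in> schwartz" "g \<in> schwartz" "\<And>h. h \<in> schwartz \<Longrightarrow> ip f h = ip g h"
  shows "f = g"
proof -
  let ?d = "\<lambda>x. f x - g x"
  have d: "?d \<in> schwartz" using assms by (simp add: schwartz_diff)
  have "ip ?d ?d = 0" using assms d by (simp add: ip_diff_left)
  then have "l2norm ?d = 0" by (simp add: ip_self)
  from l2norm_eq_0[OF d this] show ?thesis by (auto simp: fun_eq_iff)
qed

text \<open>The majorant may change with \<open>bs\<close> and \<open>N\<close>: this is absolute
  convergence in every seminorm. \<open>N = 0\<close> makes the series of derivatives converge
  uniformly, which permits termwise differentiation, and general \<open>N\<close> gives the decay of
  the sum.\<close>

lemma schwartz_suminf:
  fixes f :: "nat \<Rightarrow> 'a::euclidean_space \<Rightarrow> complex"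
  assumes f: "\<And>i. f i \<in> schwartz"
    and bound: "\<And>bs N. set bs \<subseteq> Basis \<Longrightarrow>
      \<exists>M. summable M \<and> (\<forall>i x. japanese x ^ N * norm (iter_partial bs (f i) x) \<le> M i)"
  shows schwartz_suminf_in: "(\<lambda>x. \<Sum>i. f i x) \<in> schwartz"
    and iter_partial_suminf: "set bs \<subseteq> Basis \<Longrightarrow>
      iter_partial bs (\<lambda>x. \<Sum>i. f i x) = (\<lambda>x. \<Sum>i. iter_partial bs (f i) x)"
    and summable_iter_partial: "set bs \<subseteq> Basis \<Longrightarrow> summable (\<lambda>i. norm (iter_partial bs (f i) x))"
proof -
  have summ: "summable (\<lambda>i. norm (iter_partial bs (f i) x))" if bs: "set bs \<subseteq> Basis" for bs x
  proof -
    obtain M where "summable M \<and> (\<forall>i x. norm (iter_partial bs (f i) x) \<le> M i)"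
      using bound[OF bs, of 0] unfolding power_0 mult_1_left by (rule exE)
    then show ?thesis by - (rule summable_comparison_test'[of M 0], auto)
  qed
  define D where "D bs x = (\<Sum>i. iter_partial bs (f i) x)" for bs x
  have deriv: "(D bs has_derivative (\<lambda>h. \<Sum>c\<in>Basis. of_real (h \<bullet> c) * D (c # bs) x)) (at x)"
    if bs: "set bs \<subseteq> Basis" for bs x
  proof -
    have "\<forall>c\<in>Basis. \<exists>M. summable M \<and> (\<forall>i x. norm (iter_partial (c # bs) (f i) x) \<le> M i)"
    proof
      fix c :: 'a assume "c \<in> Basis"
      with bs have "set (c # bs) \<subseteq> Basis" by simp
      from bound[OF this, of 0]
      show "\<exists>M. summable M \<and> (\<forall>i x. norm (iter_partial (c # bs) (f i) x) \<le> M i)"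
        unfolding power_0 mult_1_left .
    qed
    from bchoice[OF this] obtain M where
      MM: "\<forall>c\<in>Basis. summable (M c) \<and> (\<forall>i x. norm (iter_partial (c # bs) (f i) x) \<le> M c i)"
      by (rule exE)
    have M: "summable (M c)" "norm (iter_partial (c # bs) (f i) x) \<le> M c i" if "c \<in> Basis" for c i x
      using bspec[OF MM that] by auto
    let ?f' = "\<lambda>i x h. pd h (iter_partial bs (f i)) x"
    let ?g' = "\<lambda>x h. \<Sum>c\<in>Basis. of_real (h \<bullet> c) * D (c # bs) x"
    have it: "iter_partial bs (f i) \<in> schwartz" for i
      by (rule schwartz_iter_partial[OF f bs])
    have "\<exists>g. \<forall>x\<in>UNIV. (\<lambda>n. iter_partial bs (f n) x) sums g x \<and> (g has_derivative ?g' x) (at x within UNIV)"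
    proof (rule has_derivative_series)
      show "(iter_partial bs (f n) has_derivative ?f' n x) (at x within UNIV)" for n x
        using schwartz_has_derivative[OF it] by simp
      show "(\<lambda>n. iter_partial bs (f n) x) sums D bs x" for x
        unfolding D_def using summable_norm_cancel[OF summ[OF bs]] by (rule summable_sums)
    next
      fix e :: real assume e: "0 < e"
      \<comment> \<open>Adding the majorants over all basis directions lets a single tail control
        the remainder of the derivative series in every direction, uniformly in
        \<open>x\<close>.\<close>
      define MM where "MM i = (\<Sum>c\<in>Basis. M c i)" for i
      have "summable MM" unfolding MM_def by (intro summable_sum M)
      from suminf_exist_split[OF e this] obtain N where N: "\<And>n. n \<ge> N \<Longrightarrow> norm (\<Sum>i. MM (i + n)) < e" by blast
      have "norm ((\<Sum>i<n. ?f' i x h) - ?g' x h) \<le> e * norm h" if n: "n \<ge> N" for n x h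
      proof -
        have 1: "?f' i x h = (\<Sum>c\<in>Basis. of_real (h \<bullet> c) * iter_partial (c # bs) (f i) x)" for i
        proof -
          have lin: "linear (\<lambda>h. pd h (iter_partial bs (f i)) x)" by (rule pd_linear[OF it])
          have "?f' i x (\<Sum>c\<in>Basis. (h \<bullet> c) *\<^sub>R c) = (\<Sum>c\<in>Basis. (h \<bullet> c) *\<^sub>R ?f' i x c)"
            by (simp add: linear_sum[OF lin] linear_scale[OF lin])
          then show ?thesis
            by (simp add: euclidean_representation scaleR_conv_of_real iter_partial_Cons del: iter_partial.simps(2))
        qed
        have "(\<Sum>i<n. ?f' i x h) = (\<Sum>c\<in>Basis. of_real (h \<bullet> c) * (\<Sum>i<n. iter_partial (c # bs) (f i) x))"
          unfolding 1 by (subst sum.swap) (simp add: sum_distrib_left del: iter_partial.simps)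
        then have "?g' x h - (\<Sum>i<n. ?f' i x h)
          = (\<Sum>c\<in>Basis. of_real (h \<bullet> c) * (D (c # bs) x - (\<Sum>i<n. iter_partial (c # bs) (f i) x)))"
          by (simp add: sum_subtractf right_diff_distrib del: iter_partial.simps)
        also have "\<dots> = (\<Sum>c\<in>Basis. of_real (h \<bullet> c) * (\<Sum>i. iter_partial (c # bs) (f (i + n)) x))"
        proof (intro sum.cong refl arg_cong2[where f = times])
          fix c :: 'a assume "c \<in> Basis"
          then have "summable (\<lambda>i. iter_partial (c # bs) (f i) x)"
            using summable_norm_cancel[OF summ[of "c # bs"]] bs by auto
          from suminf_split_initial_segment[OF this, of n]
          show "D (c # bs) x - (\<Sum>i<n. iter_partial (c # bs) (f i) x) = (\<Sum>i. iter_partial (c # bs) (f (i + n)) x)"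
            unfolding D_def by simp
        qed
        finally have d: "?g' x h - (\<Sum>i<n. ?f' i x h)
            = (\<Sum>c\<in>Basis. of_real (h \<bullet> c) * (\<Sum>i. iter_partial (c # bs) (f (i + n)) x))" .
        have "norm ((\<Sum>i<n. ?f' i x h) - ?g' x h)
            = norm (\<Sum>c\<in>Basis. of_real (h \<bullet> c) * (\<Sum>i. iter_partial (c # bs) (f (i + n)) x))"
          unfolding d[symmetric] by (rule norm_minus_commute)
        also have "\<dots> \<le> (\<Sum>c\<in>Basis. norm h * (\<Sum>i. M c (i + n)))"
        proof (rule sum_norm_le)
          fix c :: 'a assume c: "c \<in> Basis"
          have "set (c # bs) \<subseteq> Basis" using c bs by simp
          note sh = summable_ignore_initial_segment[OF summ[OF this, of x], of n]
          have "norm (\<Sum>i. iter_partial (c # bs) (f (i + n)) x) \<le> (\<Sum>i. norm (iter_partial (c # bs) (f (i + n)) x))"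
            by (rule summable_norm[OF sh])
          also have "\<dots> \<le> (\<Sum>i. M c (i + n))"
            by (rule suminf_le[OF M(2)[OF c] sh summable_ignore_initial_segment[OF M(1)[OF c]]])
          finally show "norm (complex_of_real (h \<bullet> c) * (\<Sum>i. iter_partial (c # bs) (f (i + n)) x)) \<le> norm h * (\<Sum>i. M c (i + n))"
            unfolding norm_mult norm_of_real using Basis_le_norm[OF c, of h] by (intro mult_mono) auto
        qed
        also have "\<dots> = norm h * (\<Sum>i. MM (i + n))"
          unfolding MM_def sum_distrib_left[symmetric]
          by (subst suminf_sum) (auto intro: summable_ignore_initial_segment M)
        also have "\<dots> \<le> norm h * e"
          using N[OF n] by (intro mult_left_mono) auto
        finally show ?thesis by (simp add: mult.commute)
      qed
      then show "\<forall>\<^sub>F n in sequentially. \<forall>x\<in>UNIV. \<forall>h. norm ((\<Sum>i<n. ?f' i x h) - ?g' x h) \<le> e * norm h"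
        unfolding eventually_sequentially by blast
    qed auto
    then obtain g where g: "\<And>x. (\<lambda>n. iter_partial bs (f n) x) sums g x" "\<And>x. (g has_derivative ?g' x) (at x)"
      by auto
    have "g = D bs" unfolding D_def using g(1) by (auto simp: sums_iff)
    with g show ?thesis by simp
  qed
  have it: "iter_partial bs (\<lambda>x. \<Sum>i. f i x) = D bs" if "set bs \<subseteq> Basis" for bs
    using that
  proof (induction bs)
    case (Cons b bs)
    have "pd b (D bs) x = D (b # bs) x" for x
    proof -
      have "pd b (D bs) x = (\<Sum>c\<in>Basis. of_real (b \<bullet> c) * D (c # bs) x)"
        by (rule pd_eq[OF deriv]) (use Cons.prems in auto)
      also have "\<dots> = (\<Sum>c\<in>Basis. if c = b then D (c # bs) x else 0)"
        using Cons.prems by (intro sum.cong) (auto simp: inner_Basis)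
      also have "\<dots> = D (b # bs) x" using Cons.prems by simp
      finally show ?thesis .
    qed
    note pb = this
    have ib: "iter_partial bs (\<lambda>x. \<Sum>i. f i x) = D bs" using Cons by simp
    show ?case unfolding iter_partial_Cons ib by (rule ext) (rule pb)
  qed (simp add: D_def fun_eq_iff)
  show "(\<lambda>x. \<Sum>i. f i x) \<in> schwartz"
    unfolding schwartz_def smooth_def
  proof (safe, goal_cases)
    case (1 bs)
    then show ?case
      unfolding it[OF 1] differentiable_on_def differentiable_def using deriv has_derivative_at_withinI by blast
  next
    case (2 N bs)
    obtain M where M: "summable M" "\<And>i x. japanese x ^ N * norm (iter_partial bs (f i) x) \<le> M i"
      using bound[OF 2] by blast
    have "japanese x ^ N * norm (D bs x) \<le> suminf M" for x
    proof -
      have "japanese x ^ N * norm (D bs x) \<le> japanese x ^ N * (\<Sum>i. norm (iter_partial bs (f i) x))"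
        unfolding D_def by (intro mult_left_mono summable_norm summ 2) auto
      also have "\<dots> = (\<Sum>i. japanese x ^ N * norm (iter_partial bs (f i) x))"
        by (rule suminf_mult[symmetric, OF summ[OF 2]])
      also have "\<dots> \<le> suminf M"
        by (intro suminf_le M summable_mult summ 2)
      finally show ?thesis .
    qed
    then show ?case unfolding it[OF 2] by (rule bdd_aboveI2)
  qed
  show "iter_partial bs (\<lambda>x. \<Sum>i. f i x) = (\<lambda>x. \<Sum>i. iter_partial bs (f i) x)" if "set bs \<subseteq> Basis"
    using it[OF that] by (auto simp: D_def)
  show "summable (\<lambda>i. norm (iter_partial bs (f i) x))" if "set bs \<subseteq> Basis"
    by (rule summ[OF that])
qed

lemma tempered_add: "u \<in> tempered \<Longrightarrow> f \<in> schwartz \<Longrightarrow> g \<in> schwartz \<Longrightarrow> u (\<lambda>x. f x + g x) = u f + u g"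
  and tempered_cmult: "u \<in> tempered \<Longrightarrow> f \<in> schwartz \<Longrightarrow> u (\<lambda>x. c * f x) = cnj c * u f"
  by (auto simp: tempered_def)

lemma tempered_bound:
  assumes "u \<in> tempered"
  obtains C N where "0 \<le> C" "\<And>f. f \<in> schwartz \<Longrightarrow> norm (u f) \<le> C * schwartz_seminorm N f"
proof -
  obtain C N where C: "\<And>f. f \<in> schwartz \<Longrightarrow> norm (u f) \<le> C * schwartz_seminorm N f"
    using assms unfolding tempered_def by blast
  have "norm (u f) \<le> \<bar>C\<bar> * schwartz_seminorm N f" if "f \<in> schwartz" for f
    using C[OF that] schwartz_seminorm_nonneg[OF that, of N]
    by (smt (verit) mult_right_mono abs_ge_self)
  then show ?thesis by (intro that[of "\<bar>C\<bar>" N]) auto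
qed

lemma tempered_0: "u \<in> tempered \<Longrightarrow> u (\<lambda>_. 0) = 0"
  using tempered_cmult[OF _ schwartz_0, of u 0] by simp

lemma tempered_sum:
  assumes "u \<in> tempered" "\<And>i. i \<in> I \<Longrightarrow> f i \<in> schwartz"
  shows "u (\<lambda>x. \<Sum>i\<in>I. f i x) = (\<Sum>i\<in>I. u (f i))"
  using assms(2)
proof (induction I rule: infinite_finite_induct)
  case (insert i I)
  then show ?case
    using tempered_add[OF assms(1), of "f i" "\<lambda>x. \<Sum>i\<in>I. f i x"] schwartz_sum[of I f] by simp
qed (auto simp: tempered_0 assms(1))

text \<open>Continuity of \<open>u\<close> involves one seminorm, hence finitely many lists
  \<open>bs\<close>. That seminorm of the tail of the series is at most the tail of the sum of the
  finitely many majorants, so \<open>u\<close> of the tail tends to zero.\<close>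

lemma tempered_suminf:
  fixes f :: "nat \<Rightarrow> 'a::euclidean_space \<Rightarrow> complex"
  assumes u: "u \<in> tempered" and f: "\<And>i. f i \<in> schwartz"
    and bound: "\<And>bs N. set bs \<subseteq> Basis \<Longrightarrow>
      \<exists>M. summable M \<and> (\<forall>i x. japanese x ^ N * norm (iter_partial bs (f i) x) \<le> M i)"
  shows "(\<lambda>i. u (f i)) sums u (\<lambda>x. \<Sum>i. f i x)"
proof -
  obtain C N where C: "0 \<le> C" "\<And>f. f \<in> schwartz \<Longrightarrow> norm (u f) \<le> C * schwartz_seminorm N f"
    using tempered_bound[OF u] by blast
  let ?B = "{bs :: 'a list. set bs \<subseteq> Basis \<and> length bs \<le> N}"
  have fin: "finite ?B" using finite_lists_length_le[of "Basis :: 'a set" N] by simp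
  have "\<forall>bs\<in>?B. \<exists>M. summable M \<and> (\<forall>i x. japanese x ^ N * norm (iter_partial bs (f i) x) \<le> M i)"
    using bound[where N = N] by simp
  from bchoice[OF this] obtain M where
    MM: "\<forall>bs\<in>?B. summable (M bs) \<and> (\<forall>i x. japanese x ^ N * norm (iter_partial bs (f i) x) \<le> M bs i)"
    by (rule exE)
  have M: "summable (M bs)" "japanese x ^ N * norm (iter_partial bs (f i) x) \<le> M bs i" if "bs \<in> ?B" for bs i x
    using bspec[OF MM that] by auto
  have M0: "0 \<le> M bs i" if "bs \<in> ?B" for bs i
    by (rule order_trans[OF _ M(2)[OF that, of undefined i]]) simp
  define MM where "MM i = (\<Sum>bs\<in>?B. M bs i)" for i
  have MM: "summable MM" unfolding MM_def by (intro summable_sum M)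
  define T where "T n = (\<lambda>x. \<Sum>i. f (i + n) x)" for n
  have bT: "\<exists>M. summable M \<and> (\<forall>i x. japanese x ^ N * norm (iter_partial bs (f (i + n)) x) \<le> M i)"
    if bs: "set bs \<subseteq> Basis" for bs N n
  proof -
    obtain M where "summable M" "\<forall>i x. japanese x ^ N * norm (iter_partial bs (f i) x) \<le> M i"
      using bound[OF bs] by blast
    then show ?thesis by (intro exI[of _ "\<lambda>i. M (i + n)"]) (simp add: summable_iff_shift)
  qed
  have TS: "T n \<in> schwartz" for n
    unfolding T_def by (rule schwartz_suminf_in[OF f bT])
  have T2: "iter_partial bs (T n) = (\<lambda>x. \<Sum>i. iter_partial bs (f (i + n)) x)" if "set bs \<subseteq> Basis" for bs n
    unfolding T_def by (rule iter_partial_suminf[OF f bT that])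
  have T3: "summable (\<lambda>i. norm (iter_partial bs (f (i + n)) x))" if "set bs \<subseteq> Basis" for bs n x
    by (rule summable_iter_partial[OF f bT that])
  have sem: "schwartz_seminorm N (T n) \<le> (\<Sum>i. MM (i + n))" for n
  proof (rule schwartz_seminorm_le)
    fix bs :: "'a list" and x assume bs: "set bs \<subseteq> Basis" "length bs \<le> N"
    have "japanese x ^ N * norm (iter_partial bs (T n) x) \<le> japanese x ^ N * (\<Sum>i. norm (iter_partial bs (f (i + n)) x))"
      unfolding T2[OF bs(1)] by (intro mult_left_mono summable_norm T3 bs) auto
    also have "\<dots> = (\<Sum>i. japanese x ^ N * norm (iter_partial bs (f (i + n)) x))"
      by (rule suminf_mult[symmetric, OF T3[OF bs(1)]])
    also have "\<dots> \<le> (\<Sum>i. MM (i + n))"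
    proof (rule suminf_le[OF _ summable_mult[OF T3[OF bs(1)]] summable_ignore_initial_segment[OF MM]])
      fix i
      have "japanese x ^ N * norm (iter_partial bs (f (i + n)) x) \<le> M bs (i + n)"
        using M bs by auto
      also have "\<dots> \<le> MM (i + n)"
        unfolding MM_def by (rule member_le_sum) (use bs fin M0 in auto)
      finally show "japanese x ^ N * norm (iter_partial bs (f (i + n)) x) \<le> MM (i + n)" .
    qed
    finally show "japanese x ^ N * norm (iter_partial bs (T n) x) \<le> (\<Sum>i. MM (i + n))" .
  qed
  have dec: "u (\<lambda>x. \<Sum>i. f i x) = (\<Sum>i<n. u (f i)) + u (T n)" for n
  proof -
    have "(\<lambda>x. \<Sum>i. f i x) = (\<lambda>x. (\<Sum>i<n. f i x) + T n x)"
    proof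
      fix x
      have "summable (\<lambda>i. f i x)"
        using summable_norm_cancel[OF summable_iter_partial[OF f bound, of "[]" x]] by simp
      from suminf_split_initial_segment[OF this, of n]
      show "(\<Sum>i. f i x) = (\<Sum>i<n. f i x) + T n x" by (simp add: T_def)
    qed
    then show ?thesis
      using tempered_add[OF u schwartz_sum[of "{..<n}" f, OF f] TS] tempered_sum[OF u f] by simp
  qed
  have "(\<lambda>n. u (T n)) \<longlonglongrightarrow> 0"
  proof (rule Lim_null_comparison)
    show "\<forall>\<^sub>F n in sequentially. norm (u (T n)) \<le> C * (\<Sum>i. MM (i + n))"
      using C(2)[OF TS] mult_left_mono[OF sem C(1)] by (intro always_eventually allI) (meson order_trans)
    have "(\<lambda>n. \<Sum>i. MM (i + n)) \<longlonglongrightarrow> 0"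
      using suminf_exist_split[OF _ MM] by (auto simp: LIMSEQ_iff)
    then show "(\<lambda>n. C * (\<Sum>i. MM (i + n))) \<longlonglongrightarrow> 0"
      by (rule tendsto_mult_right_zero)
  qed
  then have "(\<lambda>n. u (\<lambda>x. \<Sum>i. f i x) - u (T n)) \<longlonglongrightarrow> u (\<lambda>x. \<Sum>i. f i x) - 0"
    by (intro tendsto_intros)
  moreover have "u (\<lambda>x. \<Sum>i. f i x) - u (T n) = (\<Sum>i<n. u (f i))" for n
    using dec[of n] by simp
  ultimately show ?thesis by (simp add: sums_def)
qed

lemma tempered_dist_of_fun:
  assumes g: "g \<in> schwartz" shows "dist_of_fun g \<in> tempered"
proof -
  obtain C where C: "C \<ge> 0" "\<And>f::'a \<Rightarrow> complex. f \<in> schwartz \<Longrightarrow> energy 0 f \<le> C * schwartz_seminorm (2 * DIM('a) + 0) f"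
    using energy_le_seminorm[of 0] by blast
  have "norm (ip g f) \<le> (l2norm g * C) * schwartz_seminorm (2 * DIM('a) + 0) f" if f: "f \<in> schwartz" for f
  proof -
    obtain q0 :: "'a \<times> 'a" where q0: "q0 \<in> Basis" using nonempty_Basis by blast
    have "l2norm f \<le> energy 0 f"
      unfolding energy_def using member_le_sum[OF q0, of "\<lambda>_. l2norm f"] by simp
    then have "l2norm g * l2norm f \<le> l2norm g * (C * schwartz_seminorm (2 * DIM('a) + 0) f)"
      using C(2)[OF f] by (intro mult_left_mono) auto
    then show ?thesis using ip_Cauchy_Schwarz[OF g f] by (simp add: mult.assoc)
  qed
  then show ?thesis
    unfolding tempered_def using g by (auto simp: ip_add_right ip_cmult_right)
qed

text \<open>The short-time Fourier transform of a tempered distribution grows at most polynomially.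
  The exponent \<open>M\<close> is what the decay of the Weyl matrix will have to beat.\<close>

lemma tempered_tf_shift_bound:
  assumes u: "u \<in> tempered" and "\<eta> \<in> schwartz"
  shows "\<exists>C M. 0 \<le> C \<and> (\<forall>z. norm (u (tf_shift z \<eta>)) \<le> C * japanese z ^ M)"
proof -
  obtain C N where C: "0 \<le> C" "\<And>f. f \<in> schwartz \<Longrightarrow> norm (u f) \<le> C * schwartz_seminorm N f"
    using tempered_bound[OF u] by blast
  obtain D M where D: "0 \<le> D" "\<And>z. schwartz_seminorm N (tf_shift z \<eta>) \<le> D * japanese z ^ M"
    using schwartz_seminorm_tf_shift[OF assms(2)] by blast
  have "norm (u (tf_shift z \<eta>)) \<le> (C * D) * japanese z ^ M" for z
    using C(2)[OF schwartz_tf_shift[OF assms(2)], of z] mult_left_mono[OF D(2) C(1), of z] by (simp add: mult.assoc)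
  then show ?thesis using C(1) D(1) by (meson mult_nonneg_nonneg)
qed

lemma infsum_Cauchy_Schwarz:
  fixes a b :: "'i \<Rightarrow> complex"
  assumes a: "(\<lambda>i. (norm (a i))\<^sup>2) summable_on I" "(\<Sum>\<^sub>\<infinity>i\<in>I. (norm (a i))\<^sup>2) \<le> P\<^sup>2"
    and b: "(\<lambda>i. (norm (b i))\<^sup>2) summable_on I" "(\<Sum>\<^sub>\<infinity>i\<in>I. (norm (b i))\<^sup>2) \<le> Q\<^sup>2"
    and PQ: "0 \<le> P" "0 \<le> Q"
    and ab: "(\<lambda>i. norm (a i * b i)) summable_on I"
  shows "norm (\<Sum>\<^sub>\<infinity>i\<in>I. a i * b i) \<le> P * Q"
proof -
  have fin: "L2_set (\<lambda>i. norm (a i)) F \<le> P" if "finite F" "F \<subseteq> I"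
    "(\<lambda>i. (norm (a i))\<^sup>2) summable_on I" "(\<Sum>\<^sub>\<infinity>i\<in>I. (norm (a i))\<^sup>2) \<le> P\<^sup>2" "0 \<le> P" for F P and a :: "'i \<Rightarrow> complex"
  proof -
    have "(\<Sum>i\<in>F. (norm (a i))\<^sup>2) \<le> P\<^sup>2"
      using finite_sum_le_infsum[OF that(3), of F] that by auto
    then show ?thesis unfolding L2_set_def using that(5) by (simp add: real_le_lsqrt sum_nonneg)
  qed
  have "norm (\<Sum>\<^sub>\<infinity>i\<in>I. a i * b i) \<le> (\<Sum>\<^sub>\<infinity>i\<in>I. norm (a i * b i))"
    by (rule norm_infsum_bound[OF ab])
  also have "\<dots> \<le> P * Q"
  proof (rule infsum_le_finite_sums[OF ab])
    fix F assume F: "finite F" "F \<subseteq> I"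
    have "(\<Sum>i\<in>F. norm (a i * b i)) \<le> L2_set (\<lambda>i. norm (a i)) F * L2_set (\<lambda>i. norm (b i)) F"
      using L2_set_mult_ineq[of "\<lambda>i. norm (a i)" "\<lambda>i. norm (b i)" F] by (simp add: norm_mult)
    also have "\<dots> \<le> P * Q"
      using fin[OF F a PQ(1)] fin[OF F b PQ(2)] PQ by (intro mult_mono) (auto simp: L2_set_nonneg)
    finally show "(\<Sum>i\<in>F. norm (a i * b i)) \<le> P * Q" .
  qed
  finally show ?thesis .
qed

section \<open>Synthesis and frame operators over a lattice\<close>

locale tf_lattice =
  fixes \<Lambda> :: "('a::euclidean_space \<times> 'a) set" and K :: nat
  assumes lattice_0: "0 \<in> \<Lambda>"
    and lattice_add: "z \<in> \<Lambda> \<Longrightarrow> w \<in> \<Lambda> \<Longrightarrow> z + w \<in> \<Lambda>"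
    and lattice_minus: "z \<in> \<Lambda> \<Longrightarrow> - z \<in> \<Lambda>"
    and lattice_infinite: "infinite \<Lambda>"
    and lattice_summable: "(\<lambda>z. 1 / japanese z ^ K) summable_on \<Lambda>"
begin

definition rapid :: "('a \<times> 'a \<Rightarrow> complex) \<Rightarrow> bool" where
  "rapid c \<longleftrightarrow> (\<forall>k. \<exists>C. \<forall>z\<in>\<Lambda>. norm (c z) \<le> C / japanese z ^ k)"

definition synth :: "('a \<Rightarrow> complex) \<Rightarrow> ('a \<times> 'a \<Rightarrow> complex) \<Rightarrow> 'a \<Rightarrow> complex" where
  "synth \<eta> c = (\<lambda>x. \<Sum>\<^sub>\<infinity>z\<in>\<Lambda>. c z * tf_shift z \<eta> x)"

text \<open>Analysis window \<open>\<psi>\<close> and synthesis window \<open>\<eta>\<close> are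
  kept apart, since commutators with \<open>Zop q\<close> and the passage to the dual window alter
  only one of them.\<close>

definition frame_op :: "('a \<Rightarrow> complex) \<Rightarrow> ('a \<Rightarrow> complex) \<Rightarrow> ('a \<Rightarrow> complex) \<Rightarrow> 'a \<Rightarrow> complex" where
  "frame_op \<psi> \<eta> f = synth \<eta> (\<lambda>z. ip f (tf_shift z \<psi>))"

lemma lattice_diff: "z \<in> \<Lambda> \<Longrightarrow> w \<in> \<Lambda> \<Longrightarrow> z - w \<in> \<Lambda>"
  using lattice_add[OF _ lattice_minus, of z w] by simp

lemma lattice_bij: "w \<in> \<Lambda> \<Longrightarrow> bij_betw (\<lambda>z. z + w) \<Lambda> \<Lambda>"
  by (rule bij_betwI[of _ _ _ "\<lambda>z. z - w"]) (auto intro: lattice_add lattice_diff)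

lemma lattice_countable: "countable \<Lambda>"
proof -
  have "countable {z\<in>\<Lambda>. 1 / japanese z ^ K \<noteq> 0}"
    by (rule abs_summable_countable) (use lattice_summable in auto)
  then show ?thesis by simp
qed

lemma lattice_summable_norm:
  fixes g :: "'a \<times> 'a \<Rightarrow> complex"
  assumes "\<And>z. z \<in> \<Lambda> \<Longrightarrow> norm (g z) \<le> C / japanese z ^ K"
  shows "(\<lambda>z. norm (g z)) summable_on \<Lambda>"
proof (rule summable_on_comparison_test)
  show "(\<lambda>z. C * (1 / japanese z ^ K)) summable_on \<Lambda>"
    by (intro summable_on_cmult_right lattice_summable)
qed (use assms in auto)

lemma rapid_norm_summable:
  assumes c: "rapid c" and g: "\<And>z. z \<in> \<Lambda> \<Longrightarrow> norm (g z) \<le> D * japanese z ^ M"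
  shows "\<exists>C\<ge>0. \<forall>z\<in>\<Lambda>. norm (c z * g z) \<le> C / japanese z ^ K"
proof -
  obtain C where C: "\<And>z. z \<in> \<Lambda> \<Longrightarrow> norm (c z) \<le> C / japanese z ^ (M + K)"
    using c unfolding rapid_def by blast
  have "norm (c z * g z) \<le> \<bar>C * D\<bar> / japanese z ^ K" if z: "z \<in> \<Lambda>" for z
  proof -
    have "norm (c z * g z) \<le> (C / japanese z ^ (M + K)) * (D * japanese z ^ M)"
      unfolding norm_mult by (intro mult_mono' C g z) auto
    also have "\<dots> = (C * D) / japanese z ^ K" by (simp add: power_add)
    also have "\<dots> \<le> \<bar>C * D\<bar> / japanese z ^ K" by (intro divide_right_mono) auto
    finally show ?thesis .
  qed
  then show ?thesis by (meson abs_ge_zero)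
qed

text \<open>Termwise differentiation was proved for series, so the unordered sums over the lattice
  are enumerated by natural numbers. Countability comes from summability of a positive weight, and
  \<open>lattice_infinite\<close> makes the enumeration a bijection.\<close>

lemma suminf_enum:
  assumes "(\<lambda>z. norm (g z)) summable_on \<Lambda>"
  shows "summable (\<lambda>i. norm (g (from_nat_into \<Lambda> i)))"
    and "(\<Sum>i. g (from_nat_into \<Lambda> i)) = infsum (g :: _ \<Rightarrow> complex) \<Lambda>"
proof -
  have bij: "bij_betw (from_nat_into \<Lambda>) UNIV \<Lambda>"
    by (rule bij_betw_from_nat_into[OF lattice_countable lattice_infinite])
  have "(\<lambda>i. norm (g (from_nat_into \<Lambda> i))) summable_on UNIV"
    using assms summable_on_reindex_bij_betw[OF bij, of "\<lambda>z. norm (g z)"] by simp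
  then show "summable (\<lambda>i. norm (g (from_nat_into \<Lambda> i)))" by (rule summable_on_imp_summable)
  have "(g has_sum infsum g \<Lambda>) \<Lambda>"
    using abs_summable_summable[OF assms] by simp
  then have "((\<lambda>i. g (from_nat_into \<Lambda> i)) has_sum infsum g \<Lambda>) UNIV"
    using has_sum_reindex_bij_betw[OF bij] by blast
  from has_sum_imp_sums[OF this] show "(\<Sum>i. g (from_nat_into \<Lambda> i)) = infsum g \<Lambda>"
    by (rule sums_unique[symmetric])
qed

text \<open>Each seminorm of a shifted window grows polynomially in the shift, and rapid decrease of
  \<open>c\<close> absorbs this. The synthesis series therefore converges in the Schwartz topology,
  and a tempered distribution can be applied term by term.\<close>

lemma
  assumes \<eta>: "\<eta> \<in> schwartz" and c: "rapid c"
  shows schwartz_synth: "synth \<eta> c \<in> schwartz"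
    and tempered_synth: "u \<in> tempered \<Longrightarrow> u (synth \<eta> c) = (\<Sum>\<^sub>\<infinity>z\<in>\<Lambda>. cnj (c z) * u (tf_shift z \<eta>))"
    and tempered_synth_summable: "u \<in> tempered \<Longrightarrow> (\<lambda>z. norm (cnj (c z) * u (tf_shift z \<eta>))) summable_on \<Lambda>"
proof -
  define e where "e = from_nat_into \<Lambda>"
  have e: "e i \<in> \<Lambda>" for i
    unfolding e_def using from_nat_into[of \<Lambda>] lattice_0 by blast
  define f where "f i = (\<lambda>x. c (e i) * tf_shift (e i) \<eta> x)" for i
  have f: "f i \<in> schwartz" for i
    unfolding f_def by (intro schwartz_cmult schwartz_tf_shift \<eta>)
  have bound: "\<exists>M. summable M \<and> (\<forall>i x. japanese x ^ N * norm (iter_partial bs (f i) x) \<le> M i)"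
    if bs: "set bs \<subseteq> Basis" for bs N
  proof -
    obtain D M where D: "\<And>z x. japanese x ^ N * norm (iter_partial bs (tf_shift z \<eta>) x) \<le> D * japanese z ^ M"
      using iter_partial_tf_shift_bound[OF \<eta> bs] by blast
    define g where "g z = complex_of_real (D * japanese z ^ M)" for z :: "'a \<times> 'a"
    have D0: "0 \<le> D * japanese z ^ M" for z :: "'a \<times> 'a"
      by (rule order_trans[OF _ D[of 0 z]]) simp
    have "\<exists>C\<ge>0. \<forall>z\<in>\<Lambda>. norm (c z * g z) \<le> C / japanese z ^ K"
      by (rule rapid_norm_summable[OF c, of g D M]) (unfold g_def norm_of_real, use D0 in simp)
    then have s: "(\<lambda>z. norm (c z * g z)) summable_on \<Lambda>"
      using lattice_summable_norm[of "\<lambda>z. c z * g z"] by blast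
    have "japanese x ^ N * norm (iter_partial bs (f i) x) \<le> norm (c (e i) * g (e i))" for i x
    proof -
      have "japanese x ^ N * norm (iter_partial bs (f i) x)
          = norm (c (e i)) * (japanese x ^ N * norm (iter_partial bs (tf_shift (e i) \<eta>) x))"
        unfolding f_def by (simp add: iter_partial_cmult[OF schwartz_tf_shift[OF \<eta>] bs] norm_mult)
      also have "\<dots> \<le> norm (c (e i)) * (D * japanese (e i) ^ M)"
        by (intro mult_left_mono D) auto
      also have "\<dots> = norm (c (e i) * g (e i))"
        unfolding g_def norm_mult[of "c (e i)"] norm_of_real using D0[of "e i"] by simp
      finally show ?thesis .
    qed
    with suminf_enum(1)[OF s] show ?thesis unfolding e_def by blast
  qed
  have eq: "synth \<eta> c = (\<lambda>x. \<Sum>i. f i x)"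
  proof
    fix x
    obtain D where D: "\<And>y. norm (\<eta> y) \<le> D" using schwartz_bounded[OF \<eta>] by blast
    have "\<exists>C\<ge>0. \<forall>z\<in>\<Lambda>. norm (c z * tf_shift z \<eta> x) \<le> C / japanese z ^ K"
      by (rule rapid_norm_summable[OF c, of _ D 0]) (simp add: norm_tf_shift D)
    then have "(\<lambda>z. norm (c z * tf_shift z \<eta> x)) summable_on \<Lambda>"
      using lattice_summable_norm[of "\<lambda>z. c z * tf_shift z \<eta> x"] by blast
    from suminf_enum(2)[OF this] show "synth \<eta> c x = (\<Sum>i. f i x)"
      by (simp add: synth_def f_def e_def)
  qed
  show "synth \<eta> c \<in> schwartz"
    unfolding eq by (rule schwartz_suminf_in[OF f bound])
  show summ: "(\<lambda>z. norm (cnj (c z) * u (tf_shift z \<eta>))) summable_on \<Lambda>" if u: "u \<in> tempered"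
  proof -
    obtain D M where D: "\<And>z. norm (u (tf_shift z \<eta>)) \<le> D * japanese z ^ M"
      using tempered_tf_shift_bound[OF u \<eta>] by blast
    have "\<exists>C\<ge>0. \<forall>z\<in>\<Lambda>. norm (c z * u (tf_shift z \<eta>)) \<le> C / japanese z ^ K"
      by (rule rapid_norm_summable[OF c D])
    then show ?thesis
      using lattice_summable_norm[of "\<lambda>z. c z * u (tf_shift z \<eta>)"] by (auto simp: norm_mult)
  qed
  show "u (synth \<eta> c) = (\<Sum>\<^sub>\<infinity>z\<in>\<Lambda>. cnj (c z) * u (tf_shift z \<eta>))" if u: "u \<in> tempered"
  proof -
    have "(\<lambda>i. u (f i)) sums u (\<lambda>x. \<Sum>i. f i x)"
      by (rule tempered_suminf[OF u f bound])
    moreover have "u (f i) = cnj (c (e i)) * u (tf_shift (e i) \<eta>)" for i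
      unfolding f_def by (rule tempered_cmult[OF u schwartz_tf_shift[OF \<eta>]])
    ultimately have "u (\<lambda>x. \<Sum>i. f i x) = (\<Sum>i. cnj (c (e i)) * u (tf_shift (e i) \<eta>))"
      by (simp add: sums_iff)
    also have "\<dots> = (\<Sum>\<^sub>\<infinity>z\<in>\<Lambda>. cnj (c z) * u (tf_shift z \<eta>))"
      unfolding e_def by (rule suminf_enum(2)[OF summ[OF u]])
    finally show ?thesis by (simp add: eq)
  qed
qed

lemma ip_synth:
  assumes "\<eta> \<in> schwartz" "rapid c" "g \<in> schwartz"
  shows "ip (synth \<eta> c) g = (\<Sum>\<^sub>\<infinity>z\<in>\<Lambda>. c z * ip (tf_shift z \<eta>) g)"
proof -
  have "ip (synth \<eta> c) g = cnj (ip g (synth \<eta> c))" by (rule ip_cnj)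
  also have "\<dots> = (\<Sum>\<^sub>\<infinity>z\<in>\<Lambda>. cnj (cnj (c z) * ip g (tf_shift z \<eta>)))"
    unfolding infsum_cnj using tempered_synth[OF assms(1,2) tempered_dist_of_fun[OF assms(3)]] by simp
  also have "\<dots> = (\<Sum>\<^sub>\<infinity>z\<in>\<Lambda>. c z * ip (tf_shift z \<eta>) g)"
    by (simp add: ip_cnj[of "tf_shift _ \<eta>" g])
  finally show ?thesis .
qed

lemma rapid_stft: "f \<in> schwartz \<Longrightarrow> \<psi> \<in> schwartz \<Longrightarrow> rapid (\<lambda>z. ip f (tf_shift z \<psi>))"
  unfolding rapid_def using stft_decay by blast

lemma schwartz_frame_op [simp]: "f \<in> schwartz \<Longrightarrow> \<psi> \<in> schwartz \<Longrightarrow> \<eta> \<in> schwartz \<Longrightarrow> frame_op \<psi> \<eta> f \<in> schwartz"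
  unfolding frame_op_def by (intro schwartz_synth rapid_stft)

lemma ip_frame_op:
  assumes "f \<in> schwartz" "g \<in> schwartz" "\<psi> \<in> schwartz" "\<eta> \<in> schwartz"
  shows "ip (frame_op \<psi> \<eta> f) g = (\<Sum>\<^sub>\<infinity>z\<in>\<Lambda>. ip f (tf_shift z \<psi>) * cnj (ip g (tf_shift z \<eta>)))"
  unfolding frame_op_def using assms by (simp add: ip_synth rapid_stft ip_cnj[of "tf_shift _ \<eta>" g])

lemma stft_product_summable:
  assumes "f \<in> schwartz" "g \<in> schwartz" "\<psi> \<in> schwartz" "\<eta> \<in> schwartz"
  shows "(\<lambda>z. norm (ip f (tf_shift z \<psi>) * cnj (ip g (tf_shift z \<eta>)))) summable_on \<Lambda>"
proof -
  obtain D where D: "\<And>z. norm (ip g (tf_shift z \<eta>)) \<le> D / japanese z ^ 0"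
    using stft_decay[OF assms(2,4)] by blast
  have "\<exists>C\<ge>0. \<forall>z\<in>\<Lambda>. norm (ip f (tf_shift z \<psi>) * cnj (ip g (tf_shift z \<eta>))) \<le> C / japanese z ^ K"
    by (rule rapid_norm_summable[OF rapid_stft[OF assms(1,3)], of _ D 0]) (use D in simp)
  then show ?thesis
    using lattice_summable_norm[of "\<lambda>z. ip f (tf_shift z \<psi>) * cnj (ip g (tf_shift z \<eta>))"] by blast
qed

lemmas stft_product_summable' = abs_summable_summable[OF stft_product_summable]

lemma frame_op_sym:
  assumes "f \<in> schwartz" "g \<in> schwartz" "\<psi> \<in> schwartz" "\<eta> \<in> schwartz"
  shows "ip (frame_op \<psi> \<eta> f) g = ip f (frame_op \<eta> \<psi> g)"
proof -
  have "ip f (frame_op \<eta> \<psi> g) = cnj (ip (frame_op \<eta> \<psi> g) f)" by (rule ip_cnj)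
  then show ?thesis using assms by (simp add: ip_frame_op mult.commute flip: infsum_cnj)
qed

lemma frame_op_add:
  assumes "f \<in> schwartz" "g \<in> schwartz" "\<psi> \<in> schwartz" "\<eta> \<in> schwartz"
  shows "frame_op \<psi> \<eta> (\<lambda>x. f x + g x) = (\<lambda>x. frame_op \<psi> \<eta> f x + frame_op \<psi> \<eta> g x)"
proof (rule schwartz_weak_eq)
  fix h :: "'a \<Rightarrow> complex" assume h: "h \<in> schwartz"
  note S = assms h
  show "ip (frame_op \<psi> \<eta> (\<lambda>x. f x + g x)) h = ip (\<lambda>x. frame_op \<psi> \<eta> f x + frame_op \<psi> \<eta> g x) h"
    using S by (simp add: ip_frame_op ip_add_left distrib_right infsum_add stft_product_summable')
qed (use assms in \<open>auto intro: schwartz_frame_op schwartz_add\<close>)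

lemma frame_op_cmult:
  assumes "f \<in> schwartz" "\<psi> \<in> schwartz" "\<eta> \<in> schwartz"
  shows "frame_op \<psi> \<eta> (\<lambda>x. c * f x) = (\<lambda>x. c * frame_op \<psi> \<eta> f x)"
proof (rule schwartz_weak_eq)
  fix h :: "'a \<Rightarrow> complex" assume h: "h \<in> schwartz"
  note S = assms h
  show "ip (frame_op \<psi> \<eta> (\<lambda>x. c * f x)) h = ip (\<lambda>x. c * frame_op \<psi> \<eta> f x) h"
    using S by (simp add: ip_frame_op ip_cmult_left mult.assoc infsum_cmult_right')
qed (use assms in \<open>auto intro: schwartz_frame_op schwartz_cmult\<close>)

lemma frame_op_diff:
  assumes "f \<in> schwartz" "g \<in> schwartz" "\<psi> \<in> schwartz" "\<eta> \<in> schwartz"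
  shows "frame_op \<psi> \<eta> (\<lambda>x. f x - g x) = (\<lambda>x. frame_op \<psi> \<eta> f x - frame_op \<psi> \<eta> g x)"
  using frame_op_add[OF assms(1) schwartz_cmult[OF assms(2)] assms(3,4), of "-1"] frame_op_cmult[OF assms(2-4), of "-1"] by simp

text \<open>Translation by \<open>w\<close> permutes the lattice, and the phases produced in
  analysis and in synthesis cancel against the phase of the shift itself.\<close>

lemma frame_op_tf_shift:
  assumes "f \<in> schwartz" "\<psi> \<in> schwartz" "\<eta> \<in> schwartz" and w: "w \<in> \<Lambda>"
  shows "frame_op \<psi> \<eta> (tf_shift w f) = tf_shift w (frame_op \<psi> \<eta> f)"
proof (rule schwartz_weak_eq)
  fix g :: "'a \<Rightarrow> complex" assume g: "g \<in> schwartz"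
  note S = assms(1-3) g
  have "ip (tf_shift w (frame_op \<psi> \<eta> f)) g = cis (fst w \<bullet> snd w) * ip (frame_op \<psi> \<eta> f) (tf_shift (- w) g)"
    using ip_tf_shift[OF schwartz_frame_op[OF assms(1-3)] g, of w 0] by simp
  also have "\<dots> = (\<Sum>\<^sub>\<infinity>z\<in>\<Lambda>. cis (fst w \<bullet> snd w) * (ip f (tf_shift z \<psi>) * cnj (ip (tf_shift (- w) g) (tf_shift z \<eta>))))"
    using S by (simp add: ip_frame_op infsum_cmult_right')
  also have "\<dots> = (\<Sum>\<^sub>\<infinity>z\<in>\<Lambda>. ip (tf_shift w f) (tf_shift (z + w) \<psi>) * cnj (ip g (tf_shift (z + w) \<eta>)))"
  proof (rule infsum_cong)
    fix z
    have 1: "ip (tf_shift w f) (tf_shift (z + w) \<psi>) = cis (- (fst w \<bullet> snd z)) * ip f (tf_shift z \<psi>)"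
      using ip_tf_shift[OF assms(1,2), of w "z + w"] by (simp add: inner_diff_right)
    have 2: "ip (tf_shift (- w) g) (tf_shift z \<eta>) = cis (fst w \<bullet> (snd w + snd z)) * ip g (tf_shift (z + w) \<eta>)"
      using ip_tf_shift[OF g assms(3), of "- w" z] by (simp add: inner_diff_right inner_add_right)
    have "cis (fst w \<bullet> snd w) * cis (- (fst w \<bullet> (snd w + snd z))) = cis (- (fst w \<bullet> snd z))"
      by (simp add: cis_mult inner_add_right)
    then show "cis (fst w \<bullet> snd w) * (ip f (tf_shift z \<psi>) * cnj (ip (tf_shift (- w) g) (tf_shift z \<eta>)))
      = ip (tf_shift w f) (tf_shift (z + w) \<psi>) * cnj (ip g (tf_shift (z + w) \<eta>))"
      unfolding 1 2 by (simp add: cis_cnj mult_ac)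
  qed
  also have "\<dots> = (\<Sum>\<^sub>\<infinity>z\<in>\<Lambda>. ip (tf_shift w f) (tf_shift z \<psi>) * cnj (ip g (tf_shift z \<eta>)))"
    by (rule infsum_reindex_bij_betw[OF lattice_bij[OF w], of "\<lambda>z. ip (tf_shift w f) (tf_shift z \<psi>) * cnj (ip g (tf_shift z \<eta>))"])
  also have "\<dots> = ip (frame_op \<psi> \<eta> (tf_shift w f)) g"
    using S by (simp add: ip_frame_op)
  finally show "ip (frame_op \<psi> \<eta> (tf_shift w f)) g = ip (tf_shift w (frame_op \<psi> \<eta> f)) g" by simp
qed (use assms in \<open>auto intro: schwartz_frame_op schwartz_tf_shift\<close>)

text \<open>Schur's test for the Gram matrix.\<close>

lemma bessel:
  assumes \<psi>: "\<psi> \<in> schwartz"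
  shows "\<exists>B\<ge>0. \<forall>f\<in>schwartz. (\<lambda>z. (norm (ip f (tf_shift z \<psi>)))\<^sup>2) summable_on \<Lambda> \<and>
    (\<Sum>\<^sub>\<infinity>z\<in>\<Lambda>. (norm (ip f (tf_shift z \<psi>)))\<^sup>2) \<le> B\<^sup>2 * (l2norm f)\<^sup>2"
proof -
  obtain D where D: "D > 0" "\<And>z. norm (ip \<psi> (tf_shift z \<psi>)) \<le> D / japanese z ^ K"
    using stft_decay[OF \<psi> \<psi>] by blast
  define s where "s = (\<Sum>\<^sub>\<infinity>z\<in>\<Lambda>. 1 / japanese z ^ K)"
  have s0: "0 \<le> s" unfolding s_def by (intro infsum_nonneg) auto
  have fin: "(\<Sum>z\<in>F. (norm (ip f (tf_shift z \<psi>)))\<^sup>2) \<le> (D * s) * (l2norm f)\<^sup>2"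
    if F: "finite F" "F \<subseteq> \<Lambda>" and f: "f \<in> schwartz" for F f
  proof -
    define c where "c z = ip f (tf_shift z \<psi>)" for z
    define S where "S = (\<Sum>z\<in>F. (norm (c z))\<^sup>2)"
    \<comment> \<open>Duality: \<open>g\<close> is chosen such that \<open>ip f g = S\<close>.
      Cauchy-Schwarz and the Gram matrix bound \<open>(l2norm g)^2 \<le> D * s * S\<close> then give
      \<open>S^2 \<le> (l2norm f)^2 * D * s * S\<close>, and one factor \<open>S\<close>
      cancels.\<close>
    define g where "g = (\<lambda>x. \<Sum>z\<in>F. c z * tf_shift z \<psi> x)"
    have S0: "0 \<le> S" by (simp add: S_def sum_nonneg)
    have gS: "g \<in> schwartz" unfolding g_def by (intro schwartz_sum schwartz_cmult schwartz_tf_shift \<psi>)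
    have ipg: "ip h g = (\<Sum>z\<in>F. cnj (c z) * ip h (tf_shift z \<psi>))" if h: "h \<in> schwartz" for h
      unfolding g_def
      by (subst tempered_sum[OF tempered_dist_of_fun[OF h]]) (auto intro!: schwartz_cmult schwartz_tf_shift \<psi> simp: ip_cmult_right)
    have a: "ip f g = of_real S"
      unfolding ipg[OF f] S_def of_real_sum by (intro sum.cong) (auto simp: c_def complex_norm_square mult.commute simp del: of_real_power)
    have row: "(\<Sum>w\<in>F. D / japanese (w - z) ^ K) \<le> D * s" if "z \<in> \<Lambda>" for z
    proof -
      have "bij_betw (\<lambda>w. w - z) \<Lambda> \<Lambda>" using lattice_bij[OF lattice_minus[OF that]] by simp
      note b = this
      have "(\<lambda>w. 1 / japanese (w - z) ^ K) summable_on \<Lambda>"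
        using summable_on_reindex_bij_betw[OF b, of "\<lambda>w. 1 / japanese w ^ K"] lattice_summable by simp
      then have "(\<Sum>w\<in>F. 1 / japanese (w - z) ^ K) \<le> (\<Sum>\<^sub>\<infinity>w\<in>\<Lambda>. 1 / japanese (w - z) ^ K)"
        by (intro finite_sum_le_infsum F) auto
      also have "\<dots> = s"
        unfolding s_def using infsum_reindex_bij_betw[OF b, of "\<lambda>w. 1 / japanese w ^ K"] by simp
      finally have "D * (\<Sum>w\<in>F. 1 / japanese (w - z) ^ K) \<le> D * s"
        using D by (intro mult_left_mono) auto
      then show ?thesis by (simp add: sum_distrib_left)
    qed
    have "complex_of_real ((l2norm g)\<^sup>2) = (\<Sum>w\<in>F. \<Sum>z\<in>F. cnj (c w) * c z * ip (tf_shift z \<psi>) (tf_shift w \<psi>))"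
    proof -
      have "complex_of_real ((l2norm g)\<^sup>2) = (\<Sum>w\<in>F. cnj (c w) * ip g (tf_shift w \<psi>))"
        unfolding ip_self[symmetric] by (rule ipg[OF gS])
      moreover have "ip g (tf_shift w \<psi>) = (\<Sum>z\<in>F. c z * ip (tf_shift z \<psi>) (tf_shift w \<psi>))" for w
      proof -
        have "ip g (tf_shift w \<psi>) = cnj (\<Sum>z\<in>F. cnj (c z) * ip (tf_shift w \<psi>) (tf_shift z \<psi>))"
          using ip_cnj[of g "tf_shift w \<psi>"] ipg[OF schwartz_tf_shift[OF \<psi>], of w] by simp
        then show ?thesis by (simp add: ip_cnj[of "tf_shift w \<psi>"])
      qed
      ultimately show ?thesis by (simp add: sum_distrib_left mult.assoc)
    qed
    then have "(l2norm g)\<^sup>2 = norm (\<Sum>w\<in>F. \<Sum>z\<in>F. cnj (c w) * c z * ip (tf_shift z \<psi>) (tf_shift w \<psi>))"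
      by (metis abs_of_nonneg norm_of_real zero_le_power2)
    also have "\<dots> \<le> (\<Sum>w\<in>F. \<Sum>z\<in>F. ((norm (c w))\<^sup>2 + (norm (c z))\<^sup>2) / 2 * (D / japanese (w - z) ^ K))"
    proof (intro sum_norm_le order_trans[OF norm_sum] sum_mono)
      fix w z
      have "norm (ip (tf_shift z \<psi>) (tf_shift w \<psi>)) \<le> D / japanese (w - z) ^ K"
        using D(2)[of "w - z"] by (simp add: norm_ip_tf_shift \<psi>)
      moreover have "norm (c w) * norm (c z) \<le> ((norm (c w))\<^sup>2 + (norm (c z))\<^sup>2) / 2"
        using sum_squares_bound[of "norm (c w)" "norm (c z)"] by simp
      ultimately show "norm (cnj (c w) * c z * ip (tf_shift z \<psi>) (tf_shift w \<psi>))
         \<le> ((norm (c w))\<^sup>2 + (norm (c z))\<^sup>2) / 2 * (D / japanese (w - z) ^ K)"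
        unfolding norm_mult complex_mod_cnj by (intro mult_mono) auto
    qed
    also have "\<dots> = (\<Sum>w\<in>F. (norm (c w))\<^sup>2 / 2 * (\<Sum>z\<in>F. D / japanese (w - z) ^ K))
        + (\<Sum>w\<in>F. \<Sum>z\<in>F. (norm (c z))\<^sup>2 / 2 * (D / japanese (w - z) ^ K))"
      by (simp add: sum_distrib_left sum.distrib[symmetric] add_divide_distrib distrib_right)
    also have "(\<Sum>w\<in>F. \<Sum>z\<in>F. (norm (c z))\<^sup>2 / 2 * (D / japanese (w - z) ^ K))
        = (\<Sum>z\<in>F. (norm (c z))\<^sup>2 / 2 * (\<Sum>w\<in>F. D / japanese (w - z) ^ K))"
      by (subst sum.swap) (simp add: sum_distrib_left)
    also have "(\<Sum>w\<in>F. (norm (c w))\<^sup>2 / 2 * (\<Sum>z\<in>F. D / japanese (w - z) ^ K)) + \<dots>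
        \<le> (\<Sum>w\<in>F. (norm (c w))\<^sup>2 / 2 * (D * s)) + (\<Sum>z\<in>F. (norm (c z))\<^sup>2 / 2 * (D * s))"
    proof (intro add_mono sum_mono mult_left_mono)
      show "(\<Sum>z\<in>F. D / japanese (w - z) ^ K) \<le> D * s" if "w \<in> F" for w
        using row[of w] that F by (auto simp: japanese_minus_commute[of w])
      show "(\<Sum>w\<in>F. D / japanese (w - z) ^ K) \<le> D * s" if "z \<in> F" for z
        using row[of z] that F by auto
    qed auto
    also have "\<dots> = D * s * S"
      by (simp add: S_def sum_distrib_left sum.distrib[symmetric] sum_distrib_right algebra_simps)
    finally have ng: "(l2norm g)\<^sup>2 \<le> D * s * S" .
    have "S \<le> l2norm f * l2norm g"
      using ip_Cauchy_Schwarz[OF f gS] S0 unfolding a by simp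
    then have "S\<^sup>2 \<le> (l2norm f * l2norm g)\<^sup>2" using S0 by (rule power_mono)
    also have "\<dots> = (l2norm f)\<^sup>2 * (l2norm g)\<^sup>2" by (rule power_mult_distrib)
    also have "\<dots> \<le> (l2norm f)\<^sup>2 * (D * s * S)" using ng by (rule mult_left_mono) simp
    finally have "S * S \<le> (D * s * (l2norm f)\<^sup>2) * S" by (simp add: power2_eq_square algebra_simps)
    then have "S \<le> D * s * (l2norm f)\<^sup>2"
      using S0 D s0 by (cases "S = 0") (auto simp: mult_nonneg_nonneg)
    then show ?thesis by (simp add: S_def c_def)
  qed
  have "(\<lambda>z. (norm (ip f (tf_shift z \<psi>)))\<^sup>2) summable_on \<Lambda> \<and>
    (\<Sum>\<^sub>\<infinity>z\<in>\<Lambda>. (norm (ip f (tf_shift z \<psi>)))\<^sup>2) \<le> (sqrt (D * s))\<^sup>2 * (l2norm f)\<^sup>2" if f: "f \<in> schwartz" for f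
  proof
    show *: "(\<lambda>z. (norm (ip f (tf_shift z \<psi>)))\<^sup>2) summable_on \<Lambda>"
      using stft_product_summable[OF f f \<psi> \<psi>] by (simp add: norm_mult power2_eq_square)
    show "(\<Sum>\<^sub>\<infinity>z\<in>\<Lambda>. (norm (ip f (tf_shift z \<psi>)))\<^sup>2) \<le> (sqrt (D * s))\<^sup>2 * (l2norm f)\<^sup>2"
      using fin f D s0 by (intro infsum_le_finite_sums[OF *]) auto
  qed
  then show ?thesis using D s0 by (intro exI[of _ "sqrt (D * s)"]) auto
qed

text \<open>The image is paired with itself; the Bessel bounds of the two windows leave one factor
  of its norm to cancel.\<close>

lemma frame_op_bounded:
  assumes \<psi>: "\<psi> \<in> schwartz" and \<eta>: "\<eta> \<in> schwartz"
  shows "\<exists>C\<ge>0. \<forall>f\<in>schwartz. l2norm (frame_op \<psi> \<eta> f) \<le> C * l2norm f"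
proof -
  obtain B1 where B1: "B1 \<ge> 0" "\<And>f. f \<in> schwartz \<Longrightarrow> (\<lambda>z. (norm (ip f (tf_shift z \<psi>)))\<^sup>2) summable_on \<Lambda> \<and>
    (\<Sum>\<^sub>\<infinity>z\<in>\<Lambda>. (norm (ip f (tf_shift z \<psi>)))\<^sup>2) \<le> B1\<^sup>2 * (l2norm f)\<^sup>2"
    using bessel[OF \<psi>] by blast
  obtain B2 where B2: "B2 \<ge> 0" "\<And>f. f \<in> schwartz \<Longrightarrow> (\<lambda>z. (norm (ip f (tf_shift z \<eta>)))\<^sup>2) summable_on \<Lambda> \<and>
    (\<Sum>\<^sub>\<infinity>z\<in>\<Lambda>. (norm (ip f (tf_shift z \<eta>)))\<^sup>2) \<le> B2\<^sup>2 * (l2norm f)\<^sup>2"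
    using bessel[OF \<eta>] by blast
  have "l2norm (frame_op \<psi> \<eta> f) \<le> (B1 * B2) * l2norm f" if f: "f \<in> schwartz" for f
  proof -
    let ?F = "frame_op \<psi> \<eta> f"
    have F: "?F \<in> schwartz" by (rule schwartz_frame_op[OF f \<psi> \<eta>])
    have "(l2norm ?F)\<^sup>2 = norm (ip ?F ?F)" unfolding ip_self by (simp del: of_real_power)
    also have "\<dots> \<le> (B1 * l2norm f) * (B2 * l2norm ?F)"
      unfolding ip_frame_op[OF f F \<psi> \<eta>]
      using B1 B2 f F stft_product_summable[OF f F \<psi> \<eta>]
      by (intro infsum_Cauchy_Schwarz) (auto simp: power_mult_distrib)
    finally have "l2norm ?F * l2norm ?F \<le> (B1 * B2 * l2norm f) * l2norm ?F" by (simp add: power2_eq_square algebra_simps)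
    then show ?thesis
      using B1(1) B2(1) by (cases "l2norm ?F = 0") (auto simp: mult_le_cancel_right less_le)
  qed
  then show ?thesis using B1(1) B2(1) by (meson mult_nonneg_nonneg)
qed

text \<open>Moving \<open>Zop q\<close> past the synthesis shifts creates the unbounded factor
  \<open>z \<bullet> q\<close>, but the analysis coefficients absorb this same factor as
  \<open>Zop q\<close> on \<open>f\<close> minus \<open>Zop q\<close> on \<open>\<psi>\<close>.
  Hence the commutator consists of two frame operators with altered windows and contains no growing
  factor.\<close>

lemma Zop_frame_op:
  assumes "f \<in> schwartz" "\<psi> \<in> schwartz" "\<eta> \<in> schwartz"
  shows "Zop q (frame_op \<psi> \<eta> f) = (\<lambda>x. frame_op \<psi> \<eta> (Zop q f) x + (frame_op \<psi> (Zop q \<eta>) f x - frame_op (Zop q \<psi>) \<eta> f x))"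
proof (rule schwartz_weak_eq)
  fix g :: "'a \<Rightarrow> complex" assume g: "g \<in> schwartz"
  note S = assms g
  have V: "ip h (tf_shift z (Zop q \<theta>)) = ip (Zop q h) (tf_shift z \<theta>) - of_real (z \<bullet> q) * ip h (tf_shift z \<theta>)"
    if "h \<in> schwartz" "\<theta> \<in> schwartz" for h \<theta> z
  proof -
    have "ip (Zop q h) (tf_shift z \<theta>) = ip h (Zop q (tf_shift z \<theta>))"
      using that by (intro ip_Zop schwartz_tf_shift)
    also have "\<dots> = ip h (tf_shift z (Zop q \<theta>)) + of_real (z \<bullet> q) * ip h (tf_shift z \<theta>)"
      using that by (simp add: Zop_tf_shift ip_add_right ip_cmult_right schwartz_tf_shift schwartz_Zop schwartz_cmult)
    finally show ?thesis by simp
  qed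
  have "ip (Zop q (frame_op \<psi> \<eta> f)) g = ip (frame_op \<psi> \<eta> f) (Zop q g)"
    using S by (intro ip_Zop) auto
  also have "\<dots> = (\<Sum>\<^sub>\<infinity>z\<in>\<Lambda>. ip f (tf_shift z \<psi>) * cnj (ip (Zop q g) (tf_shift z \<eta>)))"
    using S by (intro ip_frame_op) auto
  also have "\<dots> = (\<Sum>\<^sub>\<infinity>z\<in>\<Lambda>. ip (Zop q f) (tf_shift z \<psi>) * cnj (ip g (tf_shift z \<eta>))
      + (ip f (tf_shift z \<psi>) * cnj (ip g (tf_shift z (Zop q \<eta>)))
         - ip f (tf_shift z (Zop q \<psi>)) * cnj (ip g (tf_shift z \<eta>))))"
    using assms g by (intro infsum_cong) (simp add: V algebra_simps)
  also have "\<dots> = ip (frame_op \<psi> \<eta> (Zop q f)) g + (ip (frame_op \<psi> (Zop q \<eta>) f) g - ip (frame_op (Zop q \<psi>) \<eta> f) g)"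
  proof -
    have hs: "((\<lambda>z. ip h (tf_shift z \<psi>') * cnj (ip g (tf_shift z \<eta>'))) has_sum ip (frame_op \<psi>' \<eta>' h) g) \<Lambda>"
      if "h \<in> schwartz" "\<psi>' \<in> schwartz" "\<eta>' \<in> schwartz" for h \<psi>' \<eta>'
      using that g has_sum_infsum[OF stft_product_summable'[of h g \<psi>' \<eta>']] by (simp add: ip_frame_op)
    have "((\<lambda>z. - (ip f (tf_shift z (Zop q \<psi>)) * cnj (ip g (tf_shift z \<eta>)))) has_sum - ip (frame_op (Zop q \<psi>) \<eta> f) g) \<Lambda>"
      using hs[of f "Zop q \<psi>" \<eta>] S by (simp add: has_sum_uminus)
    from infsumI[OF has_sum_add[OF hs[of "Zop q f" \<psi> \<eta>] has_sum_add[OF hs[of f \<psi> "Zop q \<eta>"] this]]] S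
    show ?thesis by simp
  qed
  also have "\<dots> = ip (\<lambda>x. frame_op \<psi> \<eta> (Zop q f) x + (frame_op \<psi> (Zop q \<eta>) f x - frame_op (Zop q \<psi>) \<eta> f x)) g"
    using S by (simp add: ip_add_left ip_diff_left)
  finally show "ip (Zop q (frame_op \<psi> \<eta> f)) g
     = ip (\<lambda>x. frame_op \<psi> \<eta> (Zop q f) x + (frame_op \<psi> (Zop q \<eta>) f x - frame_op (Zop q \<psi>) \<eta> f x)) g" .
qed (use assms in \<open>auto intro!: schwartz_frame_op schwartz_Zop schwartz_add schwartz_diff\<close>)

end

section \<open>The dual window\<close>

text \<open>The ratio is left unspecified, since it deteriorates with each further power of
  \<open>Zop\<close>. No lower bound is asked for: the definition is applied to norms.\<close>

definition geometric :: "(nat \<Rightarrow> real) \<Rightarrow> bool" where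
  "geometric a \<longleftrightarrow> (\<exists>C r. 0 \<le> C \<and> 0 < r \<and> r < 1 \<and> (\<forall>n. a n \<le> C * r ^ n))"

lemma geometric_add: assumes "geometric a" "geometric b" shows "geometric (\<lambda>n. a n + b n)"
proof -
  obtain C r where 1: "0 \<le> C" "0 < r" "r < 1" "\<And>n. a n \<le> C * r ^ n" using assms(1) by (auto simp: geometric_def)
  obtain D s where 2: "0 \<le> D" "0 < s" "s < 1" "\<And>n. b n \<le> D * s ^ n" using assms(2) by (auto simp: geometric_def)
  have "a n + b n \<le> (C + D) * (max r s) ^ n" for n
  proof -
    have "a n \<le> C * (max r s) ^ n"
      by (rule order_trans[OF 1(4)]) (use 1 in \<open>auto intro!: mult_left_mono power_mono\<close>)
    moreover have "b n \<le> D * (max r s) ^ n"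
      by (rule order_trans[OF 2(4)]) (use 2 in \<open>auto intro!: mult_left_mono power_mono\<close>)
    ultimately show ?thesis by (simp add: distrib_right)
  qed
  then show ?thesis
    unfolding geometric_def using 1 2 by (intro exI[of _ "C + D"] exI[of _ "max r s"]) auto
qed

lemma geometric_cmult: assumes "geometric a" "0 \<le> c" shows "geometric (\<lambda>n. c * a n)"
proof -
  obtain C r where 1: "0 \<le> C" "0 < r" "r < 1" "\<And>n. a n \<le> C * r ^ n" using assms(1) by (auto simp: geometric_def)
  then have "c * a n \<le> (c * C) * r ^ n" for n
    using assms(2) mult_left_mono[OF 1(4), of c n] by (simp add: mult.assoc)
  then show ?thesis unfolding geometric_def using 1 assms(2) by (intro exI[of _ "c * C"] exI[of _ r]) auto
qed

lemma geometric_0: "geometric (\<lambda>_. 0)"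
  unfolding geometric_def by (intro exI[of _ 0] exI[of _ "1/2"]) auto

lemma geometric_sum: "(\<And>i. i \<in> I \<Longrightarrow> geometric (a i)) \<Longrightarrow> geometric (\<lambda>n. \<Sum>i\<in>I. a i n)"
  by (induction I rule: infinite_finite_induct) (auto simp: geometric_0 geometric_add)

lemma geometric_recursive:
  assumes b: "geometric b" and q: "0 \<le> q" "q < 1" and a: "\<And>n. a (Suc n) \<le> q * a n + b n"
  shows "geometric a"
proof -
  obtain D r where 1: "0 \<le> D" "0 < r" "r < 1" "\<And>n. b n \<le> D * r ^ n" using b by (auto simp: geometric_def)
  \<comment> \<open>A ratio strictly above both \<open>q\<close> and \<open>r\<close>. The margin
    \<open>s - q\<close> absorbs the inhomogeneous term \<open>b\<close> in the induction step,
    which is why \<open>C\<close> contains \<open>D / (s - q)\<close>.\<close>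
  define s where "s = (1 + max q r) / 2"
  have s: "q < s" "r < s" "s < 1" using q 1 by (auto simp: s_def max_def)
  define C where "C = \<bar>a 0\<bar> + D / (s - q)"
  have "0 \<le> D / (s - q)" using 1 s by simp
  then have C: "0 \<le> C" "a 0 \<le> C" by (auto simp: C_def)
  have "C * (s - q) = \<bar>a 0\<bar> * (s - q) + D" using s by (simp add: C_def distrib_right)
  then have DC: "D \<le> C * (s - q)" using s by simp
  have "a n \<le> C * s ^ n" for n
  proof (induction n)
    case (Suc n)
    have "a (Suc n) \<le> q * (C * s ^ n) + D * r ^ n"
      using a[of n] mult_left_mono[OF Suc q(1)] 1(4)[of n] by linarith
    also have "\<dots> \<le> q * (C * s ^ n) + (C * (s - q)) * s ^ n"
      using 1 s q DC C by (intro add_left_mono mult_mono power_mono) auto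
    finally show ?case by (simp add: algebra_simps)
  qed (use C in simp)
  then show ?thesis unfolding geometric_def using C s q by (intro exI[of _ C] exI[of _ s]) auto
qed

lemma geometric_weighted_summable:
  assumes r: "0 < r" "r < (1::real)" shows "summable (\<lambda>n. real (Suc n) * r ^ n)"
  using geometric_deriv_sums[of r] r by (auto simp: sums_iff)

section \<open>Higher commutators and composition of frame operators\<close>

context tf_lattice
begin

lemma Zop_funpow_add: "f \<in> schwartz \<Longrightarrow> g \<in> schwartz \<Longrightarrow>
    (Zop q ^^ k) (\<lambda>x. f x + g x) = (\<lambda>x. (Zop q ^^ k) f x + (Zop q ^^ k) g x)"
  by (induction k) (auto simp: Zop_add schwartz_Zop_funpow)

lemma Zop_funpow_cmult: "f \<in> schwartz \<Longrightarrow>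
    (Zop q ^^ k) (\<lambda>x. c * f x) = (\<lambda>x. c * (Zop q ^^ k) f x)"
  by (induction k) (auto simp: Zop_cmult schwartz_Zop_funpow)

lemma Zop_funpow_diff: "f \<in> schwartz \<Longrightarrow> g \<in> schwartz \<Longrightarrow>
    (Zop q ^^ k) (\<lambda>x. f x - g x) = (\<lambda>x. (Zop q ^^ k) f x - (Zop q ^^ k) g x)"
  by (induction k) (auto simp: Zop_diff schwartz_Zop_funpow)

text \<open>The commutator involves only powers below \<open>k\<close>, so in the recursion for the
  Neumann iterates it is a term already controlled. The induction must range over both windows,
  because a first-order commutator replaces one of them by its image under
  \<open>Zop q\<close>.\<close>

lemma Zop_funpow_frame_op_commutator:
  assumes "\<psi> \<in> schwartz" "\<eta> \<in> schwartz"
  shows "\<exists>C\<ge>0. \<forall>f\<in>schwartz. l2norm (\<lambda>x. (Zop q ^^ k) (frame_op \<psi> \<eta> f) x - frame_op \<psi> \<eta> ((Zop q ^^ k) f) x)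
     \<le> C * (\<Sum>j<k. l2norm ((Zop q ^^ j) f))"
  using assms
proof (induction k arbitrary: \<psi> \<eta>)
  case 0
  then show ?case by (intro exI[of _ 0]) (simp add: l2norm_def)
next
  case (Suc k)
  let ?Z = "Zop q ^^ k"
  \<comment> \<open>For the two altered windows the whole expression is estimated, not merely its
    commutator; its orders up to \<open>k\<close> are exactly those permitted at stage
    \<open>Suc k\<close>.\<close>
  have bound: "\<exists>C\<ge>0. \<forall>f\<in>schwartz. l2norm (?Z (frame_op \<psi>' \<eta>' f)) \<le> C * (\<Sum>j<Suc k. l2norm ((Zop q ^^ j) f))"
    if S: "\<psi>' \<in> schwartz" "\<eta>' \<in> schwartz" for \<psi>' \<eta>'
  proof -
    obtain C where C: "C \<ge> 0" "\<And>f. f \<in> schwartz \<Longrightarrow>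
        l2norm (\<lambda>x. ?Z (frame_op \<psi>' \<eta>' f) x - frame_op \<psi>' \<eta>' (?Z f) x) \<le> C * (\<Sum>j<k. l2norm ((Zop q ^^ j) f))"
      using Suc.IH[OF S] by blast
    obtain D where D: "D \<ge> 0" "\<And>f. f \<in> schwartz \<Longrightarrow> l2norm (frame_op \<psi>' \<eta>' f) \<le> D * l2norm f"
      using frame_op_bounded[OF S] by blast
    have "l2norm (?Z (frame_op \<psi>' \<eta>' f)) \<le> (C + D) * (\<Sum>j<Suc k. l2norm ((Zop q ^^ j) f))" if f: "f \<in> schwartz" for f
    proof -
      have "l2norm (?Z (frame_op \<psi>' \<eta>' f)) = l2norm (\<lambda>x. (?Z (frame_op \<psi>' \<eta>' f) x - frame_op \<psi>' \<eta>' (?Z f) x) + frame_op \<psi>' \<eta>' (?Z f) x)"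
        by simp
      also have "\<dots> \<le> l2norm (\<lambda>x. ?Z (frame_op \<psi>' \<eta>' f) x - frame_op \<psi>' \<eta>' (?Z f) x) + l2norm (frame_op \<psi>' \<eta>' (?Z f))"
        using S f by (intro l2norm_add schwartz_diff) (auto simp: schwartz_Zop_funpow)
      also have "\<dots> \<le> C * (\<Sum>j<k. l2norm ((Zop q ^^ j) f)) + D * l2norm (?Z f)"
        by (intro add_mono C D f schwartz_Zop_funpow)
      also have "\<dots> \<le> C * (\<Sum>j<Suc k. l2norm ((Zop q ^^ j) f)) + D * (\<Sum>j<Suc k. l2norm ((Zop q ^^ j) f))"
        using C(1) D(1) by (intro add_mono mult_left_mono) (auto intro: sum_nonneg)
      finally show ?thesis by (simp add: distrib_right)
    qed
    then show ?thesis using C(1) D(1) by (meson add_nonneg_nonneg)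
  qed
  obtain C1 where C1: "C1 \<ge> 0" "\<And>f. f \<in> schwartz \<Longrightarrow>
      l2norm (\<lambda>x. ?Z (frame_op \<psi> \<eta> f) x - frame_op \<psi> \<eta> (?Z f) x) \<le> C1 * (\<Sum>j<k. l2norm ((Zop q ^^ j) f))"
    using Suc.IH[OF Suc.prems] by blast
  obtain C2 where C2: "C2 \<ge> 0" "\<And>f. f \<in> schwartz \<Longrightarrow> l2norm (?Z (frame_op \<psi> (Zop q \<eta>) f)) \<le> C2 * (\<Sum>j<Suc k. l2norm ((Zop q ^^ j) f))"
    using bound[OF Suc.prems(1) schwartz_Zop[OF Suc.prems(2)]] by blast
  obtain C3 where C3: "C3 \<ge> 0" "\<And>f. f \<in> schwartz \<Longrightarrow> l2norm (?Z (frame_op (Zop q \<psi>) \<eta> f)) \<le> C3 * (\<Sum>j<Suc k. l2norm ((Zop q ^^ j) f))"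
    using bound[OF schwartz_Zop[OF Suc.prems(1)] Suc.prems(2)] by blast
  have "l2norm (\<lambda>x. (Zop q ^^ Suc k) (frame_op \<psi> \<eta> f) x - frame_op \<psi> \<eta> ((Zop q ^^ Suc k) f) x)
     \<le> (C1 + (C2 + C3)) * (\<Sum>j<Suc k. l2norm ((Zop q ^^ j) f))" if f: "f \<in> schwartz" for f
  proof -
    let ?s = "\<Sum>j<Suc k. l2norm ((Zop q ^^ j) f)"
    have 1: "(Zop q ^^ Suc k) (frame_op \<psi> \<eta> f)
      = (\<lambda>x. ?Z (frame_op \<psi> \<eta> (Zop q f)) x + (?Z (frame_op \<psi> (Zop q \<eta>) f) x - ?Z (frame_op (Zop q \<psi>) \<eta> f) x))"
      using Suc.prems f by (simp add: funpow_Suc_right Zop_frame_op Zop_funpow_add Zop_funpow_diff del: funpow.simps)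
    have 2: "(Zop q ^^ Suc k) f = ?Z (Zop q f)"
      by (simp add: funpow_Suc_right del: funpow.simps)
    have "l2norm (\<lambda>x. (Zop q ^^ Suc k) (frame_op \<psi> \<eta> f) x - frame_op \<psi> \<eta> ((Zop q ^^ Suc k) f) x)
       = l2norm (\<lambda>x. (?Z (frame_op \<psi> \<eta> (Zop q f)) x - frame_op \<psi> \<eta> (?Z (Zop q f)) x)
            + (?Z (frame_op \<psi> (Zop q \<eta>) f) x - ?Z (frame_op (Zop q \<psi>) \<eta> f) x))"
      unfolding 1 2 by (simp add: algebra_simps)
    also have "\<dots> \<le> l2norm (\<lambda>x. ?Z (frame_op \<psi> \<eta> (Zop q f)) x - frame_op \<psi> \<eta> (?Z (Zop q f)) x)
       + l2norm (\<lambda>x. ?Z (frame_op \<psi> (Zop q \<eta>) f) x - ?Z (frame_op (Zop q \<psi>) \<eta> f) x)"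
      using Suc.prems f by (intro l2norm_add schwartz_diff) (auto simp: schwartz_Zop_funpow)
    also have "l2norm (\<lambda>x. ?Z (frame_op \<psi> (Zop q \<eta>) f) x - ?Z (frame_op (Zop q \<psi>) \<eta> f) x)
       \<le> l2norm (?Z (frame_op \<psi> (Zop q \<eta>) f)) + l2norm (?Z (frame_op (Zop q \<psi>) \<eta> f))"
      using Suc.prems f by (intro l2norm_diff) (auto simp: schwartz_Zop_funpow)
    also have "\<dots> \<le> C2 * ?s + C3 * ?s"
      by (intro add_mono C2 C3 f)
    also have "l2norm (\<lambda>x. ?Z (frame_op \<psi> \<eta> (Zop q f)) x - frame_op \<psi> \<eta> (?Z (Zop q f)) x) \<le> C1 * (\<Sum>j<k. l2norm ((Zop q ^^ j) (Zop q f)))"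
      using f by (intro C1) simp
    also have "C1 * (\<Sum>j<k. l2norm ((Zop q ^^ j) (Zop q f))) \<le> C1 * ?s"
    proof (intro mult_left_mono C1)
      have "(\<Sum>j<k. l2norm ((Zop q ^^ j) (Zop q f))) = (\<Sum>j<k. l2norm ((Zop q ^^ Suc j) f))"
        by (simp add: funpow_swap1)
      also have "\<dots> \<le> ?s"
        by (subst sum.lessThan_Suc_shift) simp
      finally show "(\<Sum>j<k. l2norm ((Zop q ^^ j) (Zop q f))) \<le> ?s" .
    qed
    finally show ?thesis by (simp add: algebra_simps)
  qed
  then show ?case using C1(1) C2(1) C3(1) by (meson add_nonneg_nonneg)
qed

text \<open>The triangle inequality for an infinite superposition, obtained by pairing the sum with
  itself and using that shifts preserve the L2 norm.\<close>

lemma l2norm_synth: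
  assumes \<eta>: "\<eta> \<in> schwartz" and c: "rapid c" and sc: "(\<lambda>z. norm (c z)) summable_on \<Lambda>"
  shows "l2norm (synth \<eta> c) \<le> (\<Sum>\<^sub>\<infinity>z\<in>\<Lambda>. norm (c z)) * l2norm \<eta>"
proof -
  let ?g = "synth \<eta> c"
  have g: "?g \<in> schwartz" by (rule schwartz_synth[OF \<eta> c])
  have sm: "(\<lambda>z. norm (c z * ip (tf_shift z \<eta>) ?g)) summable_on \<Lambda>"
    using tempered_synth_summable[OF \<eta> c tempered_dist_of_fun[OF g]]
    by (simp add: norm_mult ip_cnj[of "tf_shift _ \<eta>" ?g])
  have "(l2norm ?g)\<^sup>2 = norm (ip ?g ?g)" unfolding ip_self by (simp del: of_real_power)
  also have "\<dots> \<le> (\<Sum>\<^sub>\<infinity>z\<in>\<Lambda>. norm (c z * ip (tf_shift z \<eta>) ?g))"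
    unfolding ip_synth[OF \<eta> c g] by (rule norm_infsum_bound[OF sm])
  also have "\<dots> \<le> (\<Sum>\<^sub>\<infinity>z\<in>\<Lambda>. norm (c z) * (l2norm \<eta> * l2norm ?g))"
  proof (rule infsum_mono[OF sm])
    show "(\<lambda>z. norm (c z) * (l2norm \<eta> * l2norm ?g)) summable_on \<Lambda>" by (rule summable_on_cmult_left[OF sc])
    show "norm (c z * ip (tf_shift z \<eta>) ?g) \<le> norm (c z) * (l2norm \<eta> * l2norm ?g)" for z
      unfolding norm_mult using ip_Cauchy_Schwarz[OF schwartz_tf_shift[OF \<eta>] g, of z]
      by (intro mult_left_mono) (auto simp: l2norm_tf_shift[OF \<eta>])
  qed
  also have "\<dots> = (\<Sum>\<^sub>\<infinity>z\<in>\<Lambda>. norm (c z)) * (l2norm \<eta> * l2norm ?g)"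
    by (rule infsum_cmult_left) (use sc in simp)
  finally have *: "l2norm ?g * l2norm ?g \<le> ((\<Sum>\<^sub>\<infinity>z\<in>\<Lambda>. norm (c z)) * l2norm \<eta>) * l2norm ?g"
    by (simp add: power2_eq_square mult.assoc)
  have "0 \<le> (\<Sum>\<^sub>\<infinity>z\<in>\<Lambda>. norm (c z)) * l2norm \<eta>" by (intro mult_nonneg_nonneg infsum_nonneg) auto
  with * show ?thesis by (cases "l2norm ?g = 0") (auto simp: mult_le_cancel_right less_le)
qed

lemma rapid_summable: "rapid c \<Longrightarrow> (\<lambda>z. norm (c z)) summable_on \<Lambda>"
  unfolding rapid_def using lattice_summable_norm by blast

lemma rapid_add: "rapid c \<Longrightarrow> rapid d \<Longrightarrow> rapid (\<lambda>z. c z + d z)"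
  unfolding rapid_def
proof
  fix k assume "\<forall>k. \<exists>C. \<forall>z\<in>\<Lambda>. norm (c z) \<le> C / japanese z ^ k" "\<forall>k. \<exists>C. \<forall>z\<in>\<Lambda>. norm (d z) \<le> C / japanese z ^ k"
  then obtain C D where C: "\<And>z. z \<in> \<Lambda> \<Longrightarrow> norm (c z) \<le> C / japanese z ^ k"
    and D: "\<And>z. z \<in> \<Lambda> \<Longrightarrow> norm (d z) \<le> D / japanese z ^ k" by blast
  have "norm (c z + d z) \<le> (C + D) / japanese z ^ k" if "z \<in> \<Lambda>" for z
    using norm_triangle_ineq[of "c z" "d z"] C[OF that] D[OF that] by (simp add: add_divide_distrib)
  then show "\<exists>C. \<forall>z\<in>\<Lambda>. norm (c z + d z) \<le> C / japanese z ^ k" by blast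
qed

lemma rapid_cmult: "rapid c \<Longrightarrow> rapid (\<lambda>z. a * c z)"
  unfolding rapid_def
proof
  fix k assume "\<forall>k. \<exists>C. \<forall>z\<in>\<Lambda>. norm (c z) \<le> C / japanese z ^ k"
  then obtain C where C: "\<And>z. z \<in> \<Lambda> \<Longrightarrow> norm (c z) \<le> C / japanese z ^ k" by blast
  have "norm (a * c z) \<le> (norm a * C) / japanese z ^ k" if "z \<in> \<Lambda>" for z
    using mult_left_mono[OF C[OF that], of "norm a"] by (simp add: norm_mult)
  then show "\<exists>C. \<forall>z\<in>\<Lambda>. norm (a * c z) \<le> C / japanese z ^ k" by blast
qed

lemma synth_summable:
  assumes "\<eta> \<in> schwartz" "rapid c"
  shows "(\<lambda>z. c z * tf_shift z \<eta> x) summable_on \<Lambda>"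
proof -
  obtain D where D: "\<And>y. norm (\<eta> y) \<le> D" using schwartz_bounded[OF assms(1)] by blast
  have "\<exists>C\<ge>0. \<forall>z\<in>\<Lambda>. norm (c z * tf_shift z \<eta> x) \<le> C / japanese z ^ K"
    by (rule rapid_norm_summable[OF assms(2), of _ D 0]) (simp add: norm_tf_shift D)
  then obtain C where "\<And>z. z \<in> \<Lambda> \<Longrightarrow> norm (c z * tf_shift z \<eta> x) \<le> C / japanese z ^ K" by blast
  from abs_summable_summable[OF lattice_summable_norm[OF this]] show ?thesis .
qed

lemma synth_add:
  assumes "\<eta> \<in> schwartz" "rapid c" "rapid d"
  shows "synth \<eta> (\<lambda>z. c z + d z) = (\<lambda>x. synth \<eta> c x + synth \<eta> d x)"
  unfolding synth_def using assms by (simp add: distrib_right infsum_add synth_summable)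

lemma synth_cmult: "synth \<eta> (\<lambda>z. a * c z) = (\<lambda>x. a * synth \<eta> c x)"
  unfolding synth_def by (simp add: mult.assoc infsum_cmult_right')

lemma frame_op_cmult_right:
  assumes "g \<in> schwartz" "\<psi> \<in> schwartz" "\<eta> \<in> schwartz"
  shows "frame_op \<psi> (\<lambda>x. c * \<eta> x) g = (\<lambda>x. c * frame_op \<psi> \<eta> g x)"
  unfolding frame_op_def synth_def tf_shift_cmult by (simp add: mult.left_commute infsum_cmult_right')

lemma frame_op_add_right:
  assumes "g \<in> schwartz" "\<psi> \<in> schwartz" "\<eta> \<in> schwartz" "\<theta> \<in> schwartz"
  shows "frame_op \<psi> (\<lambda>x. \<eta> x + \<theta> x) g = (\<lambda>x. frame_op \<psi> \<eta> g x + frame_op \<psi> \<theta> g x)"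
  unfolding frame_op_def synth_def tf_shift_add distrib_left
  using assms by (simp add: infsum_add synth_summable rapid_stft)

lemma frame_op_diff_right:
  assumes "g \<in> schwartz" "\<psi> \<in> schwartz" "\<eta> \<in> schwartz" "\<theta> \<in> schwartz"
  shows "frame_op \<psi> (\<lambda>x. \<eta> x - \<theta> x) g = (\<lambda>x. frame_op \<psi> \<eta> g x - frame_op \<psi> \<theta> g x)"
  using frame_op_add_right[OF assms(1-3) schwartz_cmult[OF assms(4)], of "-1"] frame_op_cmult_right[OF assms(1,2,4), of "-1"] by simp

text \<open>Since frame operators commute with lattice shifts, an operator applied to the synthesis
  window can be taken out of the sum. Polynomials in \<open>S\<close> acting on the window thus
  become polynomials in \<open>S\<close> acting on the result.\<close>

lemma frame_op_frame_op:
  assumes "g \<in> schwartz" "\<phi> \<in> schwartz" "\<psi> \<in> schwartz" "\<eta> \<in> schwartz" "\<theta> \<in> schwartz"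
  shows "frame_op \<phi> (frame_op \<eta> \<theta> \<psi>) g = frame_op \<eta> \<theta> (frame_op \<phi> \<psi> g)"
proof (rule schwartz_weak_eq)
  fix h :: "'a \<Rightarrow> complex" assume h: "h \<in> schwartz"
  have "ip (frame_op \<eta> \<theta> (frame_op \<phi> \<psi> g)) h = ip (frame_op \<phi> \<psi> g) (frame_op \<theta> \<eta> h)"
    using assms h by (intro frame_op_sym) auto
  also have "\<dots> = (\<Sum>\<^sub>\<infinity>z\<in>\<Lambda>. ip g (tf_shift z \<phi>) * cnj (ip (frame_op \<theta> \<eta> h) (tf_shift z \<psi>)))"
    using assms h by (intro ip_frame_op) auto
  also have "\<dots> = (\<Sum>\<^sub>\<infinity>z\<in>\<Lambda>. ip g (tf_shift z \<phi>) * cnj (ip h (tf_shift z (frame_op \<eta> \<theta> \<psi>))))"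
    using assms h by (intro infsum_cong) (simp add: frame_op_sym frame_op_tf_shift[symmetric])
  also have "\<dots> = ip (frame_op \<phi> (frame_op \<eta> \<theta> \<psi>) g) h"
    using assms h by (intro ip_frame_op[symmetric]) auto
  finally show "ip (frame_op \<phi> (frame_op \<eta> \<theta> \<psi>) g) h = ip (frame_op \<eta> \<theta> (frame_op \<phi> \<psi> g)) h" by simp
qed (use assms in auto)

end

section \<open>The Neumann series of the frame operator\<close>

locale tf_frame = tf_lattice +
  fixes \<phi> :: "'a \<Rightarrow> complex" and A B :: real
  assumes window: "\<phi> \<in> schwartz"
    and A_pos: "0 < A" and A_le_B: "A \<le> B"
    and frame_lower: "\<And>f. f \<in> schwartz \<Longrightarrow> A * (l2norm f)\<^sup>2 \<le> (\<Sum>\<^sub>\<infinity>z\<in>\<Lambda>. (norm (ip f (tf_shift z \<phi>)))\<^sup>2)"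
    and frame_upper: "\<And>f. f \<in> schwartz \<Longrightarrow> (\<Sum>\<^sub>\<infinity>z\<in>\<Lambda>. (norm (ip f (tf_shift z \<phi>)))\<^sup>2) \<le> B * (l2norm f)\<^sup>2"
begin

abbreviation S :: "('a \<Rightarrow> complex) \<Rightarrow> 'a \<Rightarrow> complex" where "S \<equiv> frame_op \<phi> \<phi>"

definition \<kappa> :: complex where "\<kappa> = of_real (1 / B)"

definition R :: "('a \<Rightarrow> complex) \<Rightarrow> 'a \<Rightarrow> complex" where
  "R f = (\<lambda>x. f x - \<kappa> * S f x)"

text \<open>The value that expanding the squared norm of \<open>R f\<close> yields directly. It is
  coarser than \<open>1 - A / B\<close> but still below 1.\<close>

definition q where "q = sqrt (1 - A / B)"

lemma B_pos: "0 < B"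
  using A_pos A_le_B by simp

lemma \<kappa>_cnj [simp]: "cnj \<kappa> = \<kappa>" and \<kappa>_norm: "norm \<kappa> = 1 / B"
  using B_pos by (auto simp: \<kappa>_def norm_divide)

lemma q: "0 \<le> q" "q < 1"
  using A_pos A_le_B by (auto simp: q_def)

lemma schwartz_S [simp]: "f \<in> schwartz \<Longrightarrow> S f \<in> schwartz"
  by (rule schwartz_frame_op[OF _ window window])

lemma schwartz_R [simp]: "f \<in> schwartz \<Longrightarrow> R f \<in> schwartz"
  unfolding R_def by simp

lemma schwartz_R_funpow [simp]: "f \<in> schwartz \<Longrightarrow> (R ^^ n) f \<in> schwartz"
  by (induction n) auto

text \<open>With \<open>Q f\<close> the frame sum, \<open>ip (S f) f\<close> equals
  \<open>Q f\<close>, and Cauchy-Schwarz over the lattice together with the upper frame bound gives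
  \<open>(l2norm (S f))^2 \<le> B * Q f\<close>. Expanding the square leaves at most
  \<open>(l2norm f)^2 - Q f / B\<close>, to which the lower frame bound applies.\<close>

lemma R_contraction:
  assumes f: "f \<in> schwartz" shows "l2norm (R f) \<le> q * l2norm f"
proof -
  define Q where "Q f = (\<Sum>\<^sub>\<infinity>z\<in>\<Lambda>. (norm (ip f (tf_shift z \<phi>)))\<^sup>2)" for f
  have Q0: "0 \<le> Q f" for f unfolding Q_def by (intro infsum_nonneg) auto
  have Qs: "(\<lambda>z. (norm (ip f (tf_shift z \<phi>)))\<^sup>2) summable_on \<Lambda>" if "f \<in> schwartz" for f
    using bessel[OF window] that by blast
  have ipS: "ip (S f) f = of_real (Q f)" if "f \<in> schwartz" for f
  proof -
    have "ip (S f) f = (\<Sum>\<^sub>\<infinity>z\<in>\<Lambda>. of_real ((norm (ip f (tf_shift z \<phi>)))\<^sup>2))"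
      using that window by (simp add: ip_frame_op complex_norm_square del: of_real_power)
    also have "\<dots> = of_real (Q f)"
      unfolding Q_def using has_sum_of_real[OF has_sum_infsum[OF Qs[OF that]]] by (rule infsumI)
    finally show ?thesis .
  qed
  have "l2norm (S f) \<le> sqrt (Q f) * sqrt B"
  proof -
    have "(l2norm (S f))\<^sup>2 = norm (ip (S f) (S f))" unfolding ip_self by (simp del: of_real_power)
    also have "\<dots> \<le> sqrt (Q f) * (sqrt B * l2norm (S f))"
      unfolding ip_frame_op[OF f schwartz_S[OF f] window window]
      using Qs f frame_upper[OF schwartz_S[OF f]] Q0 stft_product_summable[OF f schwartz_S[OF f] window window] B_pos
      by (intro infsum_Cauchy_Schwarz) (auto simp: power_mult_distrib Q_def[symmetric])
    finally have "l2norm (S f) * l2norm (S f) \<le> (sqrt (Q f) * sqrt B) * l2norm (S f)" by (simp add: power2_eq_square algebra_simps)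
    moreover have "0 \<le> sqrt (Q f) * sqrt B" using Q0 B_pos by (intro mult_nonneg_nonneg) auto
    ultimately show ?thesis by (cases "l2norm (S f) = 0") (auto simp: mult_le_cancel_right less_le)
  qed
  then have "(l2norm (S f))\<^sup>2 \<le> (sqrt (Q f) * sqrt B)\<^sup>2" by (rule power_mono) simp
  then have S2: "(l2norm (S f))\<^sup>2 \<le> Q f * B" using Q0 B_pos by (simp add: power_mult_distrib)
  have "complex_of_real ((l2norm (R f))\<^sup>2)
     = ip f f - \<kappa> * ip f (S f) - \<kappa> * ip (S f) f + \<kappa> * \<kappa> * ip (S f) (S f)"
    unfolding ip_self[symmetric] R_def using f
    by (simp add: ip_diff_left ip_diff_right ip_cmult_left ip_cmult_right algebra_simps)
  also have "ip f (S f) = ip (S f) f" using frame_op_sym[OF f f window window] by simp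
  also have "ip f f - \<kappa> * ip (S f) f - \<kappa> * ip (S f) f + \<kappa> * \<kappa> * ip (S f) (S f)
     = complex_of_real ((l2norm f)\<^sup>2 - 2 / B * Q f + 1 / B * (1 / B) * (l2norm (S f))\<^sup>2)"
    unfolding ipS[OF f] ip_self by (simp add: \<kappa>_def)
  finally have "(l2norm (R f))\<^sup>2 = (l2norm f)\<^sup>2 - 2 / B * Q f + 1 / B * (1 / B) * (l2norm (S f))\<^sup>2"
    by (simp only: of_real_eq_iff)
  also have "\<dots> \<le> (l2norm f)\<^sup>2 - 2 / B * Q f + 1 / B * (1 / B) * (Q f * B)"
    using S2 B_pos by (intro add_left_mono mult_left_mono) auto
  also have "\<dots> = (l2norm f)\<^sup>2 - 1 / B * Q f" using B_pos by (simp add: field_simps)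
  also have "\<dots> \<le> (l2norm f)\<^sup>2 - 1 / B * (A * (l2norm f)\<^sup>2)"
    using frame_lower[OF f] B_pos by (intro diff_left_mono mult_left_mono) (auto simp: Q_def)
  also have "\<dots> = (q * l2norm f)\<^sup>2"
    using A_pos A_le_B by (simp add: q_def power_mult_distrib algebra_simps)
  finally show ?thesis by (rule power2_le_imp_le) (simp add: q)
qed

lemma R_funpow_contraction: "f \<in> schwartz \<Longrightarrow> l2norm ((R ^^ n) f) \<le> q ^ n * l2norm f"
proof (induction n)
  case (Suc n)
  have "l2norm ((R ^^ Suc n) f) \<le> q * l2norm ((R ^^ n) f)" using Suc.prems by (simp add: R_contraction)
  also have "\<dots> \<le> q * (q ^ n * l2norm f)" using Suc q by (intro mult_left_mono) auto
  finally show ?case by (simp add: mult.assoc)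
qed simp

text \<open>\<open>R\<close> commutes with \<open>Zop p ^^ k\<close> up to moments of lower order,
  which decay geometrically by the induction hypothesis. What remains is a linear recursion in
  \<open>n\<close> with factor \<open>q\<close>, the same contraction constant for every
  \<open>k\<close>.\<close>

lemma R_funpow_Zop_geometric:
  assumes f: "f \<in> schwartz" shows "geometric (\<lambda>n. l2norm ((Zop p ^^ k) ((R ^^ n) f)))"
proof (induction k rule: less_induct)
  case (less k)
  let ?Z = "Zop p ^^ k"
  obtain C where C: "C \<ge> 0" "\<And>f. f \<in> schwartz \<Longrightarrow>
      l2norm (\<lambda>x. ?Z (S f) x - S (?Z f) x) \<le> C * (\<Sum>j<k. l2norm ((Zop p ^^ j) f))"
    using Zop_funpow_frame_op_commutator[OF window window] by blast
  have step: "l2norm (?Z (R g)) \<le> q * l2norm (?Z g) + (C / B) * (\<Sum>j<k. l2norm ((Zop p ^^ j) g))" if g: "g \<in> schwartz" for g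
  proof -
    note Zg = schwartz_Zop_funpow[OF g, of k p] and ZS = schwartz_Zop_funpow[OF schwartz_S[OF g], of k p]
    have "?Z (R g) = (\<lambda>x. R (?Z g) x - \<kappa> * (?Z (S g) x - S (?Z g) x))"
      using g unfolding R_def by (simp add: Zop_funpow_diff Zop_funpow_cmult algebra_simps)
    then have "l2norm (?Z (R g)) = l2norm (\<lambda>x. R (?Z g) x - \<kappa> * (?Z (S g) x - S (?Z g) x))" by simp
    also have "\<dots> \<le> l2norm (R (?Z g)) + l2norm (\<lambda>x. \<kappa> * (?Z (S g) x - S (?Z g) x))"
      using Zg ZS by (intro l2norm_diff schwartz_cmult schwartz_diff) auto
    also have "l2norm (\<lambda>x. \<kappa> * (?Z (S g) x - S (?Z g) x)) = (1 / B) * l2norm (\<lambda>x. ?Z (S g) x - S (?Z g) x)"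
      unfolding l2norm_cmult \<kappa>_norm ..
    also have "l2norm (R (?Z g)) + \<dots> \<le> q * l2norm (?Z g) + (1 / B) * (C * (\<Sum>j<k. l2norm ((Zop p ^^ j) g)))"
      using B_pos by (intro add_mono mult_left_mono C R_contraction Zg g) auto
    finally show ?thesis by simp
  qed
  have "geometric (\<lambda>n. (C / B) * (\<Sum>j<k. l2norm ((Zop p ^^ j) ((R ^^ n) f))))"
    using C(1) B_pos less by (intro geometric_cmult geometric_sum) auto
  then show ?case
    by (rule geometric_recursive[OF _ q]) (use step f in auto)
qed

lemma R_funpow_energy_geometric: "f \<in> schwartz \<Longrightarrow> geometric (\<lambda>n. energy k ((R ^^ n) f))"
  unfolding energy_def by (intro geometric_sum R_funpow_Zop_geometric)

lemma R_funpow_stft: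
  assumes f: "f \<in> schwartz"
  shows "\<exists>C r. 0 \<le> C \<and> 0 < r \<and> r < 1 \<and> (\<forall>n z. norm (ip ((R ^^ n) f) (tf_shift z \<phi>)) \<le> C * r ^ n / japanese z ^ k)"
proof -
  obtain C where C: "C \<ge> 0" "\<And>f z. f \<in> schwartz \<Longrightarrow> japanese z ^ k * norm (ip f (tf_shift z \<phi>)) \<le> C * energy k f"
    using stft_bound[OF window] by blast
  obtain D r where D: "0 \<le> D" "0 < r" "r < 1" "\<And>n. energy k ((R ^^ n) f) \<le> D * r ^ n"
    using R_funpow_energy_geometric[OF f, of k] by (auto simp: geometric_def)
  have "norm (ip ((R ^^ n) f) (tf_shift z \<phi>)) \<le> (C * D) * r ^ n / japanese z ^ k" for n z
  proof -
    have "japanese z ^ k * norm (ip ((R ^^ n) f) (tf_shift z \<phi>)) \<le> C * (D * r ^ n)"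
      using C(2)[of "(R ^^ n) f" z] mult_left_mono[OF D(4) C(1), of n] f by simp
    then show ?thesis by (simp add: field_simps)
  qed
  then show ?thesis using C(1) D by (meson mult_nonneg_nonneg)
qed

text \<open>
  Formally \<open>\<gamma> = S\<inverse> \<phi> = S (S\<inverse>)\<^sup>2 \<phi>\<close> with \<open>(S\<inverse>)\<^sup>2 = B\<^sup>-\<^sup>2 \<Sum>\<^sub>n (n+1) R\<^sup>n\<close>; the outer \<open>S\<close> makes \<open>\<gamma>\<close> a
  superposition of time-frequency shifts of \<open>\<phi>\<close>, so that only its coefficients must be summed.
\<close>

definition dual_coeff :: "'a \<times> 'a \<Rightarrow> complex" where
  "dual_coeff z = (\<Sum>n. of_nat (Suc n) * (\<kappa> * \<kappa>) * ip ((R ^^ n) \<phi>) (tf_shift z \<phi>))"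

definition dual_coeff_upto :: "nat \<Rightarrow> 'a \<times> 'a \<Rightarrow> complex" where
  "dual_coeff_upto N z = (\<Sum>n<N. of_nat (Suc n) * (\<kappa> * \<kappa>) * ip ((R ^^ n) \<phi>) (tf_shift z \<phi>))"

definition \<gamma> :: "'a \<Rightarrow> complex" where "\<gamma> = synth \<phi> dual_coeff"

text \<open>The error sequence depends on \<open>k\<close> but is uniform in \<open>z\<close>. Its
  value at \<open>N = 0\<close> yields the rapid decrease of \<open>dual_coeff\<close>, its limit
  the convergence of the truncated windows.\<close>

lemma dual_coeff_tail:
  "\<exists>e. e \<longlonglongrightarrow> 0 \<and> (\<forall>N z. norm (dual_coeff z - dual_coeff_upto N z) \<le> e N / japanese z ^ k)"
proof -
  obtain C r where C: "0 \<le> C" "0 < r" "r < 1"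
    "\<And>n z. norm (ip ((R ^^ n) \<phi>) (tf_shift z \<phi>)) \<le> C * r ^ n / japanese z ^ k"
    using R_funpow_stft[OF window] by blast
  define b where "b n = C / B\<^sup>2 * (real (Suc n) * r ^ n)" for n
  have b: "summable b" unfolding b_def using C by (intro summable_mult geometric_weighted_summable)
  define t where "t z n = of_nat (Suc n) * (\<kappa> * \<kappa>) * ip ((R ^^ n) \<phi>) (tf_shift z \<phi>)" for z n
  have t: "norm (t z n) \<le> b n / japanese z ^ k" for z n
  proof -
    have "norm (t z n) = real (Suc n) / B\<^sup>2 * norm (ip ((R ^^ n) \<phi>) (tf_shift z \<phi>))"
      unfolding t_def norm_mult norm_of_nat \<kappa>_norm by (simp add: power2_eq_square)
    also have "\<dots> \<le> real (Suc n) / B\<^sup>2 * (C * r ^ n / japanese z ^ k)"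
      by (intro mult_left_mono C) auto
    also have "\<dots> = b n / japanese z ^ k" by (simp add: b_def)
    finally show ?thesis .
  qed
  have bz: "summable (\<lambda>n. b n / japanese z ^ k)" for z by (rule summable_divide[OF b])
  have ts: "summable (\<lambda>n. norm (t z n))" for z
    by (rule summable_comparison_test'[OF bz[of z], of 0]) (use t in simp)
  have "norm (dual_coeff z - dual_coeff_upto N z) \<le> (\<Sum>n. b (n + N)) / japanese z ^ k" for N z
  proof -
    have "dual_coeff z - dual_coeff_upto N z = (\<Sum>n. t z (n + N))"
      using suminf_split_initial_segment[OF summable_norm_cancel[OF ts[of z]], of N]
      by (simp add: dual_coeff_def dual_coeff_upto_def t_def)
    also have "norm \<dots> \<le> (\<Sum>n. norm (t z (n + N)))"
      by (rule summable_norm[OF summable_ignore_initial_segment[OF ts]])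
    also have "\<dots> \<le> (\<Sum>n. b (n + N) / japanese z ^ k)"
      by (rule suminf_le[OF t summable_ignore_initial_segment[OF ts] summable_ignore_initial_segment[OF bz]])
    also have "\<dots> = (\<Sum>n. b (n + N)) / japanese z ^ k"
      by (rule suminf_divide[OF summable_ignore_initial_segment[OF b]])
    finally show ?thesis .
  qed
  moreover have "(\<lambda>N. \<Sum>n. b (n + N)) \<longlonglongrightarrow> 0"
    using suminf_exist_split[OF _ b] by (auto simp: LIMSEQ_iff)
  ultimately show ?thesis by blast
qed

lemma rapid_dual_coeff_upto: "rapid (dual_coeff_upto N)"
proof (induction N)
  case 0
  then show ?case by (auto simp: rapid_def dual_coeff_upto_def intro!: exI[of _ 0])
next
  case (Suc N)
  have "dual_coeff_upto (Suc N) = (\<lambda>z. dual_coeff_upto N z + of_nat (Suc N) * (\<kappa> * \<kappa>) * ip ((R ^^ N) \<phi>) (tf_shift z \<phi>))"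
    by (auto simp: dual_coeff_upto_def)
  then show ?case
    using Suc window by (auto intro!: rapid_add rapid_cmult rapid_stft)
qed

lemma rapid_dual_coeff: "rapid dual_coeff"
  unfolding rapid_def
proof
  fix k
  obtain e where "\<And>N z. norm (dual_coeff z - dual_coeff_upto N z) \<le> e N / japanese z ^ k"
    using dual_coeff_tail[of k] by blast
  from this[of _ 0] have "norm (dual_coeff z) \<le> e 0 / japanese z ^ k" for z
    by (simp add: dual_coeff_upto_def)
  then show "\<exists>C. \<forall>z\<in>\<Lambda>. norm (dual_coeff z) \<le> C / japanese z ^ k" by blast
qed

lemma schwartz_dual [simp]: "\<gamma> \<in> schwartz"
  unfolding \<gamma>_def by (rule schwartz_synth[OF window rapid_dual_coeff])

text \<open>Convergence in L2 suffices here: membership of \<open>\<gamma>\<close> in the Schwartz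
  space is settled by its coefficients, and the reproducing identity is verified weakly.\<close>

lemma dual_approx: "(\<lambda>N. l2norm (\<lambda>x. \<gamma> x - synth \<phi> (dual_coeff_upto N) x)) \<longlonglongrightarrow> 0"
proof -
  obtain e where e: "e \<longlonglongrightarrow> 0" "\<And>N z. norm (dual_coeff z - dual_coeff_upto N z) \<le> e N / japanese z ^ K"
    using dual_coeff_tail[of K] by blast
  define s where "s = (\<Sum>\<^sub>\<infinity>z\<in>\<Lambda>. 1 / japanese z ^ K)"
  have "l2norm (\<lambda>x. \<gamma> x - synth \<phi> (dual_coeff_upto N) x) \<le> e N * s * l2norm \<phi>" for N
  proof -
    let ?c = "\<lambda>z. dual_coeff z + (-1) * dual_coeff_upto N z"
    have r: "rapid ?c" by (intro rapid_add rapid_cmult rapid_dual_coeff rapid_dual_coeff_upto)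
    have "(\<lambda>x. \<gamma> x - synth \<phi> (dual_coeff_upto N) x) = synth \<phi> ?c"
      unfolding \<gamma>_def using synth_add[OF window rapid_dual_coeff rapid_cmult[OF rapid_dual_coeff_upto[of N]], of "-1"]
        synth_cmult[of \<phi> "-1" "dual_coeff_upto N"] by simp
    then have "l2norm (\<lambda>x. \<gamma> x - synth \<phi> (dual_coeff_upto N) x) \<le> (\<Sum>\<^sub>\<infinity>z\<in>\<Lambda>. norm (?c z)) * l2norm \<phi>"
      using l2norm_synth[OF window r rapid_summable[OF r]] by simp
    also have "(\<Sum>\<^sub>\<infinity>z\<in>\<Lambda>. norm (?c z)) \<le> (\<Sum>\<^sub>\<infinity>z\<in>\<Lambda>. e N * (1 / japanese z ^ K))"
      by (rule infsum_mono[OF rapid_summable[OF r] summable_on_cmult_right[OF lattice_summable]]) (use e in simp)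
    also have "\<dots> = e N * s" unfolding s_def by (rule infsum_cmult_right) (use lattice_summable in simp)
    finally show ?thesis by (simp add: mult_right_mono)
  qed
  then have "\<forall>\<^sub>F N in sequentially. norm (l2norm (\<lambda>x. \<gamma> x - synth \<phi> (dual_coeff_upto N) x)) \<le> e N * s * l2norm \<phi>"
    by simp
  moreover have "(\<lambda>N. e N * s * l2norm \<phi>) \<longlonglongrightarrow> 0"
    by (intro tendsto_mult_left_zero e)
  ultimately show ?thesis by (rule Lim_null_comparison)
qed

lemma R_diff: "f \<in> schwartz \<Longrightarrow> g \<in> schwartz \<Longrightarrow> R (\<lambda>x. f x - g x) = (\<lambda>x. R f x - R g x)"
  unfolding R_def using window by (simp add: frame_op_diff algebra_simps)

lemma R_cmult: "f \<in> schwartz \<Longrightarrow> R (\<lambda>x. c * f x) = (\<lambda>x. c * R f x)"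
  unfolding R_def using window by (simp add: frame_op_cmult algebra_simps)

lemma R_funpow_diff: "f \<in> schwartz \<Longrightarrow> g \<in> schwartz \<Longrightarrow>
    (R ^^ n) (\<lambda>x. f x - g x) = (\<lambda>x. (R ^^ n) f x - (R ^^ n) g x)"
  by (induction n) (auto simp: R_diff)

lemma R_funpow_cmult: "f \<in> schwartz \<Longrightarrow> (R ^^ n) (\<lambda>x. c * f x) = (\<lambda>x. c * (R ^^ n) f x)"
  by (induction n) (auto simp: R_cmult)

lemma frame_op_R:
  assumes "\<psi> \<in> schwartz" "g \<in> schwartz" shows "frame_op \<phi> (R \<psi>) g = R (frame_op \<phi> \<psi> g)"
  unfolding R_def using assms window by (simp add: frame_op_diff_right frame_op_cmult_right frame_op_frame_op)

lemma frame_op_R_funpow: "g \<in> schwartz \<Longrightarrow> frame_op \<phi> ((R ^^ n) \<phi>) g = (R ^^ n) (S g)"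
  by (induction n) (auto simp: frame_op_R window)

text \<open>As operators acting on \<open>g\<close> this is
  \<open>\<kappa>^2 S R^n S = R^n (1 - R)^2\<close>, because
  \<open>\<kappa> S = 1 - R\<close>.\<close>

lemma frame_op_S_R_funpow:
  assumes g: "g \<in> schwartz"
  shows "(\<kappa> * \<kappa>) * frame_op \<phi> (S ((R ^^ n) \<phi>)) g x
    = (R ^^ n) g x - 2 * (R ^^ Suc n) g x + (R ^^ Suc (Suc n)) g x"
proof -
  have S: "\<kappa> * S f x = f x - R f x" for f x by (simp add: R_def)
  have Rn: "\<kappa> * (R ^^ n) (S g) x = (R ^^ n) g x - (R ^^ Suc n) g x" for n x
  proof -
    have "\<kappa> * (R ^^ n) (S g) x = (R ^^ n) (\<lambda>x. \<kappa> * S g x) x"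
      using g by (simp only: R_funpow_cmult schwartz_S)
    also have "(\<lambda>x. \<kappa> * S g x) = (\<lambda>x. g x - R g x)" by (simp only: S)
    also have "(R ^^ n) (\<lambda>x. g x - R g x) x = (R ^^ n) g x - (R ^^ n) (R g) x"
      using g by (simp add: R_funpow_diff)
    finally show ?thesis by (simp add: funpow_swap1)
  qed
  have "(\<kappa> * \<kappa>) * frame_op \<phi> (S ((R ^^ n) \<phi>)) g x
      = \<kappa> * (\<kappa> * S ((R ^^ n) (S g)) x)"
    using g window by (simp add: frame_op_frame_op frame_op_R_funpow mult.assoc)
  also have "\<dots> = \<kappa> * (R ^^ n) (S g) x - \<kappa> * (R ^^ Suc n) (S g) x"
    unfolding S by (simp add: right_diff_distrib)
  also have "\<dots> = (R ^^ n) g x - 2 * (R ^^ Suc n) g x + (R ^^ Suc (Suc n)) g x"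
    unfolding Rn by simp
  finally show ?thesis .
qed

text \<open>The telescoping identity: the sum of \<open>(n + 1) R^n (1 - R)^2\<close> over
  \<open>n < N\<close> equals \<open>1 - (N + 1) R^N + N R^(N+1)\<close>.\<close>

lemma frame_op_dual_upto:
  assumes g: "g \<in> schwartz"
  shows "frame_op \<phi> (synth \<phi> (dual_coeff_upto N)) g
     = (\<lambda>x. g x - (of_nat (Suc N) * (R ^^ N) g x - of_nat N * (R ^^ Suc N) g x))"
proof (induction N)
  case 0
  have "synth \<phi> (dual_coeff_upto 0) = (\<lambda>_. 0)" by (simp add: synth_def dual_coeff_upto_def)
  then show ?case by (simp add: frame_op_def synth_def tf_shift_def)
next
  case (Suc N)
  have "synth \<phi> (dual_coeff_upto (Suc N))
      = synth \<phi> (\<lambda>z. dual_coeff_upto N z + of_nat (Suc N) * (\<kappa> * \<kappa>) * ip ((R ^^ N) \<phi>) (tf_shift z \<phi>))"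
    by (simp add: dual_coeff_upto_def[abs_def])
  also have "\<dots> = (\<lambda>x. synth \<phi> (dual_coeff_upto N) x + of_nat (Suc N) * (\<kappa> * \<kappa>) * S ((R ^^ N) \<phi>) x)"
    using window by (simp only: synth_add rapid_dual_coeff_upto rapid_cmult rapid_stft schwartz_R_funpow synth_cmult frame_op_def)
  finally have "frame_op \<phi> (synth \<phi> (dual_coeff_upto (Suc N))) g
     = (\<lambda>x. frame_op \<phi> (synth \<phi> (dual_coeff_upto N)) g x + of_nat (Suc N) * (\<kappa> * \<kappa>) * frame_op \<phi> (S ((R ^^ N) \<phi>)) g x)"
    using g window by (simp add: frame_op_add_right frame_op_cmult_right schwartz_synth rapid_dual_coeff_upto)
  also have "\<dots> = (\<lambda>x. g x - (of_nat (Suc N) * (R ^^ N) g x - of_nat N * (R ^^ Suc N) g x)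
      + of_nat (Suc N) * ((\<kappa> * \<kappa>) * frame_op \<phi> (S ((R ^^ N) \<phi>)) g x))"
    unfolding Suc by (simp only: mult.assoc)
  also have "\<dots> = (\<lambda>x. g x - (of_nat (Suc (Suc N)) * (R ^^ Suc N) g x - of_nat (Suc N) * (R ^^ Suc (Suc N)) g x))"
    unfolding frame_op_S_R_funpow[OF g] by (simp add: algebra_simps)
  finally show ?case .
qed

text \<open>Two errors tend to zero when tested against \<open>h\<close>: replacing
  \<open>\<gamma>\<close> by a truncation, controlled in L2 through the summable coefficients of
  \<open>g\<close>, and the telescoped remainder, of size \<open>(N + 1) * q ^ N\<close>.\<close>

theorem dual_window:
  assumes g: "g \<in> schwartz" shows "frame_op \<phi> \<gamma> g = g"
proof (rule schwartz_weak_eq)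
  fix h :: "'a \<Rightarrow> complex" assume h: "h \<in> schwartz"
  let ?\<gamma> = "\<lambda>N. synth \<phi> (dual_coeff_upto N)"
  have \<gamma>N: "?\<gamma> N \<in> schwartz" for N by (rule schwartz_synth[OF window rapid_dual_coeff_upto])
  define s where "s = (\<Sum>\<^sub>\<infinity>z\<in>\<Lambda>. norm (ip g (tf_shift z \<phi>)))"
  have rg: "rapid (\<lambda>z. ip g (tf_shift z \<phi>))" by (rule rapid_stft[OF g window])
  have 1: "norm (ip (frame_op \<phi> \<gamma> g) h - ip (frame_op \<phi> (?\<gamma> N) g) h) \<le> s * l2norm (\<lambda>x. \<gamma> x - ?\<gamma> N x) * l2norm h" for N
  proof -
    let ?d = "\<lambda>x. \<gamma> x - ?\<gamma> N x"
    have d: "?d \<in> schwartz" using \<gamma>N by simp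
    have F: "frame_op \<phi> ?d g \<in> schwartz" by (rule schwartz_frame_op[OF g window d])
    have "ip (frame_op \<phi> \<gamma> g) h - ip (frame_op \<phi> (?\<gamma> N) g) h = ip (frame_op \<phi> ?d g) h"
      using g h \<gamma>N window by (simp add: frame_op_diff_right ip_diff_left)
    also have "norm \<dots> \<le> l2norm (frame_op \<phi> ?d g) * l2norm h" by (rule ip_Cauchy_Schwarz[OF F h])
    also have "\<dots> \<le> (s * l2norm ?d) * l2norm h"
      unfolding frame_op_def s_def by (intro mult_right_mono l2norm_synth d rg rapid_summable) simp
    finally show ?thesis .
  qed
  have 2: "norm (ip (frame_op \<phi> (?\<gamma> N) g) h - ip g h) \<le> 2 * (real (Suc N) * q ^ N) * l2norm g * l2norm h" for N
  proof -
    let ?r = "\<lambda>x. of_nat (Suc N) * (R ^^ N) g x - of_nat N * (R ^^ Suc N) g x"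
    have r: "?r \<in> schwartz" using g by (intro schwartz_diff schwartz_cmult schwartz_R_funpow)
    have "l2norm ?r \<le> l2norm (\<lambda>x. of_nat (Suc N) * (R ^^ N) g x) + l2norm (\<lambda>x. of_nat N * (R ^^ Suc N) g x)"
      using g by (intro l2norm_diff schwartz_cmult schwartz_R_funpow)
    also have "\<dots> = real (Suc N) * l2norm ((R ^^ N) g) + real N * l2norm ((R ^^ Suc N) g)"
      by (simp only: l2norm_cmult norm_of_nat)
    also have "\<dots> \<le> real (Suc N) * (q ^ N * l2norm g) + real (Suc N) * (q ^ N * l2norm g)"
    proof (intro add_mono mult_mono)
      have "l2norm ((R ^^ Suc N) g) \<le> q ^ Suc N * l2norm g" by (rule R_funpow_contraction[OF g])
      also have "\<dots> \<le> q ^ N * l2norm g" using q by (intro mult_right_mono power_decreasing) auto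
      finally show "l2norm ((R ^^ Suc N) g) \<le> q ^ N * l2norm g" .
    qed (use R_funpow_contraction[OF g] q in auto)
    finally have nr: "l2norm ?r \<le> 2 * (real (Suc N) * q ^ N) * l2norm g" by (simp only: mult_2 distrib_right mult.assoc)
    have "ip (frame_op \<phi> (?\<gamma> N) g) h - ip g h = - ip ?r h"
      unfolding frame_op_dual_upto[OF g] by (subst ip_diff_left[OF g r h]) simp
    then have "norm (ip (frame_op \<phi> (?\<gamma> N) g) h - ip g h) = norm (ip ?r h)" by (simp only: norm_minus_cancel)
    also have "\<dots> \<le> l2norm ?r * l2norm h" by (rule ip_Cauchy_Schwarz[OF r h])
    also have "\<dots> \<le> 2 * (real (Suc N) * q ^ N) * l2norm g * l2norm h" by (rule mult_right_mono[OF nr]) simp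
    finally show ?thesis .
  qed
  \<comment> \<open>The ratio may be zero (a tight frame, \<open>A = B\<close>). The weighted
    geometric series was treated for positive ratios, so this case is separate; from
    \<open>N = 1\<close> on all its terms vanish.\<close>
  have qN: "(\<lambda>N. real (Suc N) * q ^ N) \<longlonglongrightarrow> 0"
  proof (cases "q = 0")
    case True
    show ?thesis by (rule LIMSEQ_imp_Suc) (simp add: True)
  next
    case False
    then show ?thesis using q by (intro summable_LIMSEQ_zero geometric_weighted_summable) auto
  qed
  have "(\<lambda>N. s * l2norm (\<lambda>x. \<gamma> x - ?\<gamma> N x) * l2norm h + 2 * (real (Suc N) * q ^ N) * l2norm g * l2norm h) \<longlonglongrightarrow> s * 0 * l2norm h + 2 * 0 * l2norm g * l2norm h"
    by (intro tendsto_intros dual_approx qN)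
  moreover have "norm (ip (frame_op \<phi> \<gamma> g) h - ip g h) \<le> s * l2norm (\<lambda>x. \<gamma> x - ?\<gamma> N x) * l2norm h + 2 * (real (Suc N) * q ^ N) * l2norm g * l2norm h" for N
    using 1[of N] 2[of N] norm_triangle_ineq[of "ip (frame_op \<phi> \<gamma> g) h - ip (frame_op \<phi> (?\<gamma> N) g) h" "ip (frame_op \<phi> (?\<gamma> N) g) h - ip g h"]
    by simp
  ultimately have "norm (ip (frame_op \<phi> \<gamma> g) h - ip g h) \<le> s * 0 * l2norm h + 2 * 0 * l2norm g * l2norm h"
    by (intro LIMSEQ_le_const) auto
  then show "ip (frame_op \<phi> \<gamma> g) h = ip g h" by simp
qed (use g window in auto)

end

section \<open>Wigner distributions\<close>

text \<open>Differentiation under the integral sign. A majorant is demanded only for parameters near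
  \<open>p0\<close>: the bump of a Wigner integrand moves with the parameter, so no global majorant
  is to be expected.\<close>

lemma has_derivative_integral_dominated:
  fixes F :: "'b::euclidean_space \<Rightarrow> 'c::euclidean_space \<Rightarrow> complex"
  assumes deriv: "\<And>p t. ((\<lambda>p. F p t) has_derivative F' p t) (at p)"
    and intF: "\<And>p. integrable lborel (F p)"
    and meas: "\<And>h. (\<lambda>t. F' p0 t h) \<in> borel_measurable borel"
    and bound: "\<And>p t h. dist p p0 < 1 \<Longrightarrow> norm (F' p t h) \<le> norm h * G t"
    and G: "integrable lborel G"
  shows "((\<lambda>p. LINT t|lborel. F p t) has_derivative (\<lambda>h. LINT t|lborel. F' p0 t h)) (at p0)"
proof -
  have intF': "integrable lborel (\<lambda>t. F' p0 t h)" for h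
  proof (rule Bochner_Integration.integrable_bound)
    show "integrable lborel (\<lambda>t. norm h * G t)" using G by simp
    show "AE t in lborel. norm (F' p0 t h) \<le> norm (norm h * G t)"
    proof (rule AE_I2)
      fix t
      have "norm (F' p0 t h) \<le> norm h * G t" using bound[of p0] by simp
      also have "\<dots> \<le> norm (norm h * G t)" by simp
      finally show "norm (F' p0 t h) \<le> norm (norm h * G t)" .
    qed
  qed (use meas in simp)
  note lin = has_derivative_linear[OF deriv]
  have bl: "bounded_linear (\<lambda>h. LINT t|lborel. F' p0 t h)"
  proof (rule bounded_linear_intro)
    show "(LINT t|lborel. F' p0 t (x + y)) = (LINT t|lborel. F' p0 t x) + (LINT t|lborel. F' p0 t y)" for x y
      by (simp add: linear_add[OF lin] intF')
    show "(LINT t|lborel. F' p0 t (r *\<^sub>R x)) = r *\<^sub>R (LINT t|lborel. F' p0 t x)" for r x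
      by (simp add: linear_scale[OF lin])
    show "norm (LINT t|lborel. F' p0 t x) \<le> norm x * (LINT t|lborel. G t)" for x
      using Bochner_Integration.integral_norm_bound_integral[OF intF'[of x], of "\<lambda>t. norm x * G t"] G bound[of p0] by simp
  qed
  have inc: "norm (F (p0 + h) t - F p0 t) \<le> norm h * G t" if h: "norm h < 1" for h t
  proof -
    define g where "g s = F (p0 + s *\<^sub>R h) t" for s
    have g: "(g has_derivative (\<lambda>k. F' (p0 + s *\<^sub>R h) t (k *\<^sub>R h))) (at s)" for s
      unfolding g_def by (rule has_derivative_compose[OF _ deriv]) (auto intro!: derivative_eq_intros)
    have "\<exists>s\<in>{0<..<1}. norm (g 1 - g 0) \<le> norm (F' (p0 + s *\<^sub>R h) t ((1 - 0) *\<^sub>R h))"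
      using g by (intro mvt_general) (auto intro!: continuous_at_imp_continuous_on has_derivative_continuous)
    then obtain s where s: "0 < s" "s < 1" "norm (g 1 - g 0) \<le> norm (F' (p0 + s *\<^sub>R h) t h)" by auto
    have "norm (s *\<^sub>R h) \<le> norm h" using s by (auto intro!: mult_left_le_one_le)
    then have "dist (p0 + s *\<^sub>R h) p0 < 1" using h by (simp add: dist_norm)
    from order_trans[OF s(3) bound[OF this]] show ?thesis by (simp add: g_def)
  qed
  have "((\<lambda>h. norm ((LINT t|lborel. F (p0 + h) t) - (LINT t|lborel. F p0 t) - (LINT t|lborel. F' p0 t h)) / norm h) \<longlongrightarrow> 0) (at 0)"
    unfolding tendsto_at_iff_sequentially
  proof (intro allI impI)
    fix X :: "nat \<Rightarrow> 'b" assume X0: "\<forall>i. X i \<in> UNIV - {0}" and X: "X \<longlonglongrightarrow> 0"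
    define s where "s n t = (1 / norm (X n)) *\<^sub>R (F (p0 + X n) t - F p0 t - F' p0 t (X n))" for n t
    \<comment> \<open>The mean value bound on increments covers steps shorter than 1, whereas the
      majorant must serve every index; so finitely many terms are shifted away.\<close>
    obtain N where N: "\<And>n. n \<ge> N \<Longrightarrow> norm (X n) < 1"
      using X unfolding LIMSEQ_iff by (metis diff_zero zero_less_one)
    have "(\<lambda>n. LINT t|lborel. s (n + N) t) \<longlonglongrightarrow> (LINT t::'c|lborel. (0::complex))"
    proof (rule integral_dominated_convergence[where w = "\<lambda>t. 2 * G t" and s = "\<lambda>n. s (n + N)" and f = "\<lambda>_. 0"])
      show "s (n + N) \<in> borel_measurable lborel" for n
        unfolding s_def using intF intF' by (intro borel_measurable_integrable) (auto intro!: integrable_scaleR_right Bochner_Integration.integrable_diff)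
      show "integrable lborel (\<lambda>t. 2 * G t)" using G by simp
      show "AE t in lborel. (\<lambda>n. s (n + N) t) \<longlonglongrightarrow> 0"
      proof (rule AE_I2)
        fix t
        have "filterlim X (at 0) sequentially"
          using X X0 by (auto simp: filterlim_at)
        moreover have "((\<lambda>h. norm (F (p0 + h) t - F p0 t - F' p0 t h) / norm h) \<longlongrightarrow> 0) (at 0)"
          using deriv[of t p0] by (simp add: has_derivative_at)
        ultimately have "(\<lambda>n. norm (F (p0 + X n) t - F p0 t - F' p0 t (X n)) / norm (X n)) \<longlonglongrightarrow> 0"
          by (rule filterlim_compose[rotated])
        then have "(\<lambda>n. norm (s n t)) \<longlonglongrightarrow> 0" by (simp add: s_def)
        then have "(\<lambda>n. s n t) \<longlonglongrightarrow> 0" by (simp add: tendsto_norm_zero_iff)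
        then show "(\<lambda>n. s (n + N) t) \<longlonglongrightarrow> 0" by (rule LIMSEQ_ignore_initial_segment)
      qed
      show "AE t in lborel. norm (s (n + N) t) \<le> 2 * G t" for n
      proof (rule AE_I2)
        fix t
        have X1: "norm (X (n + N)) < 1" and X2: "0 < norm (X (n + N))" using N X0 by auto
        have "norm (F (p0 + X (n + N)) t - F p0 t - F' p0 t (X (n + N))) \<le> norm (X (n + N)) * G t + norm (X (n + N)) * G t"
        proof -
          have "norm (F' p0 t (X (n + N))) \<le> norm (X (n + N)) * G t" using bound[of p0] by simp
          then show ?thesis
            using norm_triangle_ineq4[of "F (p0 + X (n + N)) t - F p0 t" "F' p0 t (X (n + N))"]
              inc[OF X1, of t] by linarith
        qed
        then show "norm (s (n + N) t) \<le> 2 * G t"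
          using X2 unfolding s_def norm_scaleR by (simp add: divide_le_eq mult_ac)
      qed
    qed auto
    then have "(\<lambda>n. LINT t|lborel. s n t) \<longlonglongrightarrow> 0"
      using LIMSEQ_offset[of "\<lambda>n. LINT t|lborel. s n t" N 0] by simp
    then have "(\<lambda>n. norm (LINT t|lborel. s n t)) \<longlonglongrightarrow> 0" by (rule tendsto_norm_zero)
    moreover have "norm (LINT t|lborel. s n t)
       = norm ((LINT t|lborel. F (p0 + X n) t) - (LINT t|lborel. F p0 t) - (LINT t|lborel. F' p0 t (X n))) / norm (X n)" for n
    proof -
      have "(LINT t|lborel. s n t) = (1 / norm (X n)) *\<^sub>R ((LINT t|lborel. F (p0 + X n) t) - (LINT t|lborel. F p0 t) - (LINT t|lborel. F' p0 t (X n)))"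
        unfolding s_def using intF intF' by simp
      then show ?thesis by simp
    qed
    ultimately show "((\<lambda>h. norm ((LINT t|lborel. F (p0 + h) t) - (LINT t|lborel. F p0 t) - (LINT t|lborel. F' p0 t h)) / norm h) \<circ> X) \<longlonglongrightarrow> 0"
      by (simp add: o_def)
  qed
  with bl show ?thesis by (simp add: has_derivative_at)
qed

section \<open>Decay and differentiability of Wigner distributions\<close>

definition wigner_integrand ::
    "('a::euclidean_space \<Rightarrow> complex) \<Rightarrow> ('a \<Rightarrow> complex) \<Rightarrow> 'a \<times> 'a \<Rightarrow> 'a \<Rightarrow> complex" where
  "wigner_integrand g f p t = g (fst p + t /\<^sub>R 2) * cnj (f (fst p - t /\<^sub>R 2)) * cis (- (t \<bullet> snd p))"

lemma wigner_eq: "wigner g f p = (LINT t|lborel. wigner_integrand g f p t)"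
  by (simp add: wigner_def wigner_integrand_def split_def)

lemma japanese_double: "japanese (2 *\<^sub>R x) \<le> 2 * japanese x"
proof -
  have "japanese (2 *\<^sub>R x) \<le> sqrt (4 * (1 + (norm x)\<^sup>2))"
    unfolding japanese_def by (intro real_sqrt_le_mono) (simp add: power_mult_distrib)
  also have "\<dots> = 2 * japanese x" unfolding japanese_def real_sqrt_mult by simp
  finally show ?thesis .
qed

lemma wigner_integrand_measurable:
  assumes "g \<in> schwartz" "f \<in> schwartz"
  shows "wigner_integrand g f p \<in> borel_measurable borel"
proof -
  note [continuous_intros] = continuous_on_compose2[OF schwartz_continuous[OF assms(1)]]
    continuous_on_compose2[OF schwartz_continuous[OF assms(2)]]
  have "continuous_on UNIV (wigner_integrand g f p)"
    unfolding wigner_integrand_def[abs_def] by (intro continuous_intros) auto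
  then show ?thesis by (rule borel_measurable_continuous_onI)
qed

text \<open>All decay is taken from \<open>f\<close>, whose argument
  \<open>fst p - t /\<^sub>R 2\<close> is small for \<open>t\<close> near
  \<open>2 *\<^sub>R fst p\<close>. The function \<open>g\<close> enters only through its supremum,
  with a constant independent of it; this prepares continuity in \<open>g\<close>.\<close>

lemma wigner_integrand_bound:
  fixes f :: "'a::euclidean_space \<Rightarrow> complex"
  assumes f: "f \<in> schwartz"
  shows "\<exists>C\<ge>0. \<forall>g M. (\<forall>y. norm (g y) \<le> M) \<longrightarrow>
    (\<forall>p t. norm (wigner_integrand g f p t) \<le> (C * M) / japanese (t - 2 *\<^sub>R fst p) ^ (2 * DIM('a)))"
proof -
  let ?D = "2 * DIM('a)"
  obtain C where C: "0 < C" "\<And>y. norm (f y) \<le> C / japanese y ^ ?D"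
    using decay_bounded[OF schwartz_decay[OF f]] by blast
  have "norm (wigner_integrand g f p t) \<le> ((C * 2 ^ ?D) * M) / japanese (t - 2 *\<^sub>R fst p) ^ ?D"
    if M: "\<forall>y. norm (g y) \<le> M" for g M p t
  proof -
    have M0: "0 \<le> M" using M order_trans[OF norm_ge_zero] by blast
    have "t - 2 *\<^sub>R fst p = - (2 *\<^sub>R (fst p - t /\<^sub>R 2))" by (simp add: scaleR_right_diff_distrib)
    then have "japanese (t - 2 *\<^sub>R fst p) = japanese (2 *\<^sub>R (fst p - t /\<^sub>R 2))" by (simp only: japanese_minus)
    then have "japanese (t - 2 *\<^sub>R fst p) ^ ?D \<le> (2 * japanese (fst p - t /\<^sub>R 2)) ^ ?D"
      using power_mono[OF japanese_double[of "fst p - t /\<^sub>R 2"], of ?D] by simp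
    then have j: "1 / japanese (fst p - t /\<^sub>R 2) ^ ?D \<le> 2 ^ ?D / japanese (t - 2 *\<^sub>R fst p) ^ ?D"
      by (simp add: power_mult_distrib field_simps)
    have "norm (wigner_integrand g f p t) = norm (g (fst p + t /\<^sub>R 2)) * norm (f (fst p - t /\<^sub>R 2))"
      by (simp add: wigner_integrand_def norm_mult)
    also have "\<dots> \<le> M * (C / japanese (fst p - t /\<^sub>R 2) ^ ?D)"
      using M C(2) M0 by (intro mult_mono) auto
    also have "\<dots> = (M * C) * (1 / japanese (fst p - t /\<^sub>R 2) ^ ?D)" by simp
    also have "\<dots> \<le> (M * C) * (2 ^ ?D / japanese (t - 2 *\<^sub>R fst p) ^ ?D)"
      using j M0 C(1) by (intro mult_left_mono) auto
    finally show ?thesis by (simp add: mult_ac)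
  qed
  then show ?thesis using C(1) by (intro exI[of _ "C * 2 ^ ?D"]) auto
qed

lemma wigner_integrand_bound':
  fixes f :: "'a::euclidean_space \<Rightarrow> complex"
  assumes "g \<in> schwartz" "f \<in> schwartz"
  shows "\<exists>C\<ge>0. \<forall>p t. norm (wigner_integrand g f p t) \<le> C / japanese (t - 2 *\<^sub>R fst p) ^ (2 * DIM('a))"
proof -
  obtain M where M: "0 < M" "\<And>y. norm (g y) \<le> M" using schwartz_bounded[OF assms(1)] by blast
  obtain C where "C \<ge> 0" "\<And>p t. norm (wigner_integrand g f p t) \<le> (C * M) / japanese (t - 2 *\<^sub>R fst p) ^ (2 * DIM('a))"
    using wigner_integrand_bound[OF assms(2)] M(2) by blast
  then show ?thesis using M(1) by (intro exI[of _ "C * M"]) auto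
qed

lemma wigner_integrable:
  assumes "g \<in> schwartz" "f \<in> schwartz"
  shows "integrable lborel (wigner_integrand g f p)"
proof -
  obtain C where "\<And>t. norm (wigner_integrand g f p t) \<le> C / japanese (t - 2 *\<^sub>R fst p) ^ (2 * DIM('a))"
    using wigner_integrand_bound'[OF assms] by blast
  then show ?thesis by (intro integrable_decay wigner_integrand_measurable assms)
qed

lemma wigner_bound:
  fixes f :: "'a::euclidean_space \<Rightarrow> complex"
  assumes f: "f \<in> schwartz"
  shows "\<exists>C\<ge>0. \<forall>g\<in>schwartz. \<forall>M. (\<forall>y. norm (g y) \<le> M) \<longrightarrow> (\<forall>p. norm (wigner g f p) \<le> C * M)"
proof -
  obtain C where C: "C \<ge> 0" "\<And>g M p t. (\<forall>y. norm (g y) \<le> M) \<Longrightarrow>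
    norm (wigner_integrand g f p t) \<le> (C * M) / japanese (t - 2 *\<^sub>R fst p) ^ (2 * DIM('a))"
    using wigner_integrand_bound[OF f] by blast
  have "norm (wigner g f p) \<le> (C * japanese_int TYPE('a)) * M"
    if "g \<in> schwartz" "\<forall>y. norm (g y) \<le> M" for g M p
    unfolding wigner_eq
    using integral_decay_bound[OF wigner_integrand_measurable[OF that(1) f] C(2)[OF that(2)], of p] by (simp add: mult_ac)
  then show ?thesis using C(1) japanese_int_nonneg by (intro exI[of _ "C * japanese_int TYPE('a)"]) auto
qed

lemma wigner_integrand_linear:
  "wigner_integrand (\<lambda>x. g x + g' x) f p t = wigner_integrand g f p t + wigner_integrand g' f p t"
  "wigner_integrand (\<lambda>x. c * g x) f p t = c * wigner_integrand g f p t"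
  by (simp_all add: wigner_integrand_def algebra_simps)

lemma wigner_add_left: "g \<in> schwartz \<Longrightarrow> g' \<in> schwartz \<Longrightarrow> f \<in> schwartz \<Longrightarrow>
    wigner (\<lambda>x. g x + g' x) f p = wigner g f p + wigner g' f p"
  unfolding wigner_eq wigner_integrand_linear by (intro Bochner_Integration.integral_add wigner_integrable)

lemma wigner_cmult_left: "wigner (\<lambda>x. c * g x) f p = c * wigner g f p"
  unfolding wigner_eq wigner_integrand_linear by simp

lemma wigner_integrand_has_derivative_t:
  assumes g: "g \<in> schwartz" and f: "f \<in> schwartz"
  shows "(wigner_integrand g f p has_derivative (\<lambda>h.
     (1 / 2) * wigner_integrand (pd h g) f p t - (1 / 2) * wigner_integrand g (pd h f) p t
      - \<i> * of_real (h \<bullet> snd p) * wigner_integrand g f p t)) (at t)"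
proof -
  have 1: "((\<lambda>t. g (fst p + t /\<^sub>R 2)) has_derivative (\<lambda>h. pd (h /\<^sub>R 2) g (fst p + t /\<^sub>R 2))) (at t)"
    by (rule has_derivative_compose[OF _ schwartz_has_derivative[OF g]]) (auto intro!: derivative_eq_intros)
  have "((\<lambda>t. f (fst p - t /\<^sub>R 2)) has_derivative (\<lambda>h. pd (- (h /\<^sub>R 2)) f (fst p - t /\<^sub>R 2))) (at t)"
    by (rule has_derivative_compose[OF _ schwartz_has_derivative[OF f]]) (auto intro!: derivative_eq_intros)
  note 2 = has_derivative_cnj[OF this]
  have 3: "((\<lambda>t. cis (- (t \<bullet> snd p))) has_derivative (\<lambda>h. \<i> * of_real (h \<bullet> - snd p) * cis (t \<bullet> - snd p))) (at t)"
    using has_derivative_cis_inner[of "- snd p" t] by simp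
  have s: "pd ((1 / 2) *\<^sub>R h) g x = (1 / 2) * pd h g x" "pd (- ((1 / 2) *\<^sub>R h)) f x = - (1 / 2) * pd h f x" for h x
    by (simp_all add: scaleR_conv_of_real linear_scale[OF pd_linear[OF g]] linear_scale[OF pd_linear[OF f]]
        linear_neg[OF pd_linear[OF f]])
  show ?thesis
    unfolding wigner_integrand_def[abs_def]
    by (rule has_derivative_eq_rhs[OF has_derivative_mult[OF has_derivative_mult[OF 1 2] 3]])
      (auto simp: s algebra_simps)
qed

text \<open>In position, the arguments of \<open>g\<close> and \<open>f\<close> add up to twice the
  coordinate \<open>fst p\<close>. In frequency, \<open>snd p\<close> is produced by differentiating
  the exponential in \<open>t\<close>, and integration by parts distributes this derivative over
  \<open>g\<close> and \<open>f\<close>.\<close>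

lemma wigner_coordinate:
  fixes f g :: "'a::euclidean_space \<Rightarrow> complex"
  assumes g: "g \<in> schwartz" and f: "f \<in> schwartz"
  shows "of_real (p \<bullet> q) * wigner g f p = (1 / 2) * (wigner (Zop q g) f p + wigner g (Zop q f) p)"
proof -
  let ?D = "2 * DIM('a)"
  let ?W = "\<lambda>g f. wigner_integrand g f p"
  let ?b = "snd q"
  define F' where "F' t h = (1 / 2) * ?W (pd h g) f t - (1 / 2) * ?W g (pd h f) t - \<i> * of_real (h \<bullet> snd p) * ?W g f t" for t h
  have bnd: "\<exists>C\<ge>0. \<forall>t. norm (?W g f t) \<le> C / japanese t ^ ?D" if gf: "g \<in> schwartz" "f \<in> schwartz" for g f
  proof -
    obtain C where C: "C \<ge> 0" "\<And>t. norm (?W g f t) \<le> C / japanese (t - 2 *\<^sub>R fst p) ^ ?D"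
      using wigner_integrand_bound'[OF gf] by blast
    have "norm (?W g f t) \<le> (C * 2 ^ ?D * japanese (2 *\<^sub>R fst p) ^ ?D) / japanese t ^ ?D" for t
    proof -
      have "C * japanese t ^ ?D \<le> C * (2 ^ ?D * japanese (2 *\<^sub>R fst p) ^ ?D * japanese (t - 2 *\<^sub>R fst p) ^ ?D)"
        by (intro mult_left_mono japanese_diff_power C)
      then have "C / japanese (t - 2 *\<^sub>R fst p) ^ ?D \<le> (C * 2 ^ ?D * japanese (2 *\<^sub>R fst p) ^ ?D) / japanese t ^ ?D"
        by (simp add: field_simps)
      with C(2)[of t] show ?thesis by linarith
    qed
    then show ?thesis using C(1) by (intro exI[of _ "C * 2 ^ ?D * japanese (2 *\<^sub>R fst p) ^ ?D"]) auto
  qed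
  note pg = schwartz_pd_any[OF g, of ?b] and pf = schwartz_pd_any[OF f, of ?b]
  obtain C1 where C1: "C1 \<ge> 0" "\<And>t. norm (?W g f t) \<le> C1 / japanese t ^ ?D" using bnd[OF g f] by blast
  obtain C2 where C2: "C2 \<ge> 0" "\<And>t. norm (?W (pd ?b g) f t) \<le> C2 / japanese t ^ ?D" using bnd[OF pg f] by blast
  obtain C3 where C3: "C3 \<ge> 0" "\<And>t. norm (?W g (pd ?b f) t) \<le> C3 / japanese t ^ ?D" using bnd[OF g pf] by blast
  define C where "C = C1 + C2 + C3 + \<bar>?b \<bullet> snd p\<bar> * C1"
  have "(LINT t|lborel. F' t ?b) = 0"
  proof (rule integral_directional_derivative_zero[where F = "?W g f" and F' = F' and C = C])
    show "(?W g f has_derivative F' t) (at t)" for t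
      unfolding F'_def by (rule wigner_integrand_has_derivative_t[OF g f])
    note [measurable] = wigner_integrand_measurable[OF g f] wigner_integrand_measurable[OF pg f] wigner_integrand_measurable[OF g pf]
    show "(\<lambda>t. F' t ?b) \<in> borel_measurable borel" unfolding F'_def by measurable
    show "norm (?W g f t) \<le> C / japanese t ^ ?D" for t
      by (rule order_trans[OF C1(2) divide_right_mono]) (use C1 C2 C3 in \<open>auto simp: C_def\<close>)
    show "norm (F' t ?b) \<le> C / japanese t ^ ?D" for t
    proof -
      have "norm (F' t ?b) \<le> norm ((1 / 2) * ?W (pd ?b g) f t) + norm ((1 / 2) * ?W g (pd ?b f) t)
          + norm (\<i> * of_real (?b \<bullet> snd p) * ?W g f t)"
        unfolding F'_def by (intro order_trans[OF norm_triangle_ineq4] add_mono norm_triangle_ineq4 order_refl)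
      also have "\<dots> = 1 / 2 * norm (?W (pd ?b g) f t) + 1 / 2 * norm (?W g (pd ?b f) t) + \<bar>?b \<bullet> snd p\<bar> * norm (?W g f t)"
        by (simp add: norm_mult)
      also have "\<dots> \<le> 1 * (C2 / japanese t ^ ?D) + 1 * (C3 / japanese t ^ ?D) + \<bar>?b \<bullet> snd p\<bar> * (C1 / japanese t ^ ?D)"
        by (intro add_mono mult_mono C1 C2 C3) auto
      also have "\<dots> = (C2 + C3 + \<bar>?b \<bullet> snd p\<bar> * C1) / japanese t ^ ?D" by (simp add: add_divide_distrib)
      also have "\<dots> \<le> C / japanese t ^ ?D" using C1 by (intro divide_right_mono) (auto simp: C_def)
      finally show ?thesis .
    qed
  qed
  then have ibp: "(1 / 2) * wigner (pd ?b g) f p - (1 / 2) * wigner g (pd ?b f) p = \<i> * of_real (?b \<bullet> snd p) * wigner g f p"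
    unfolding F'_def wigner_eq using g f pg pf by (simp add: wigner_integrable)
  have "wigner (Zop q g) f p + wigner g (Zop q f) p = (LINT t|lborel. ?W (Zop q g) f t + ?W g (Zop q f) t)"
    unfolding wigner_eq using g f by (intro Bochner_Integration.integral_add[symmetric] wigner_integrable schwartz_Zop)
  also have "\<dots> = (LINT t|lborel. 2 * of_real (fst p \<bullet> fst q) * ?W g f t - \<i> * (?W (pd ?b g) f t - ?W g (pd ?b f) t))"
    by (intro Bochner_Integration.integral_cong refl)
      (simp add: wigner_integrand_def Zop_def inner_add_left inner_diff_left algebra_simps)
  also have "\<dots> = 2 * of_real (fst p \<bullet> fst q) * wigner g f p - \<i> * (wigner (pd ?b g) f p - wigner g (pd ?b f) p)"
    unfolding wigner_eq using g f pg pf by (simp add: wigner_integrable)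
  also have "wigner (pd ?b g) f p - wigner g (pd ?b f) p = 2 * \<i> * of_real (?b \<bullet> snd p) * wigner g f p"
    using ibp by (simp add: field_simps)
  finally show ?thesis
    by (simp add: inner_prod_def algebra_simps inner_commute)
qed

text \<open>Each factor \<open>p \<bullet> q\<close> is spent on one \<open>Zop q\<close>. The
  induction varies \<open>f\<close> but keeps \<open>g\<close> inside the conclusion, bounded by
  suprema, so that the constant does not depend on \<open>g\<close>.\<close>

lemma wigner_coordinate_bound:
  fixes f :: "'a::euclidean_space \<Rightarrow> complex"
  assumes "f \<in> schwartz"
  shows "\<exists>C\<ge>0. \<forall>g\<in>schwartz. \<forall>M. (\<forall>j\<le>k. \<forall>y. norm ((Zop q ^^ j) g y) \<le> M) \<longrightarrow>
    (\<forall>p. \<bar>p \<bullet> q\<bar> ^ k * norm (wigner g f p) \<le> C * M)"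
  using assms
proof (induction k arbitrary: f)
  case 0
  then show ?case using wigner_bound[OF 0] by simp
next
  case (Suc k)
  obtain C1 where C1': "C1 \<ge> 0 \<and> (\<forall>g\<in>schwartz. \<forall>M. (\<forall>j\<le>k. \<forall>y. norm ((Zop q ^^ j) g y) \<le> M) \<longrightarrow>
      (\<forall>p. \<bar>p \<bullet> q\<bar> ^ k * norm (wigner g f p) \<le> C1 * M))"
    using Suc.IH[OF Suc.prems] by (rule exE)
  then have C1: "C1 \<ge> 0" "\<And>g M p. g \<in> schwartz \<Longrightarrow> (\<forall>j\<le>k. \<forall>y. norm ((Zop q ^^ j) g y) \<le> M) \<Longrightarrow>
      \<bar>p \<bullet> q\<bar> ^ k * norm (wigner g f p) \<le> C1 * M" by auto
  obtain C2 where C2': "C2 \<ge> 0 \<and> (\<forall>g\<in>schwartz. \<forall>M. (\<forall>j\<le>k. \<forall>y. norm ((Zop q ^^ j) g y) \<le> M) \<longrightarrow>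
      (\<forall>p. \<bar>p \<bullet> q\<bar> ^ k * norm (wigner g (Zop q f) p) \<le> C2 * M))"
    using Suc.IH[OF schwartz_Zop[OF Suc.prems]] by (rule exE)
  then have C2: "C2 \<ge> 0" "\<And>g M p. g \<in> schwartz \<Longrightarrow> (\<forall>j\<le>k. \<forall>y. norm ((Zop q ^^ j) g y) \<le> M) \<Longrightarrow>
      \<bar>p \<bullet> q\<bar> ^ k * norm (wigner g (Zop q f) p) \<le> C2 * M" by auto
  have "\<bar>p \<bullet> q\<bar> ^ Suc k * norm (wigner g f p) \<le> (C1 + C2) * M"
    if g: "g \<in> schwartz" and M: "\<forall>j\<le>Suc k. \<forall>y. norm ((Zop q ^^ j) g y) \<le> M" for g M p
  proof -
    have M0: "0 \<le> M" using M order_trans[OF norm_ge_zero] by blast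
    have M1: "\<forall>j\<le>k. \<forall>y. norm ((Zop q ^^ j) (Zop q g) y) \<le> M"
    proof (intro allI impI)
      fix j y assume "j \<le> k"
      then have "norm ((Zop q ^^ Suc j) g y) \<le> M" using M by auto
      then show "norm ((Zop q ^^ j) (Zop q g) y) \<le> M" by (simp add: funpow_swap1)
    qed
    have "\<bar>p \<bullet> q\<bar> * norm (wigner g f p) = norm ((1 / 2) * (wigner (Zop q g) f p + wigner g (Zop q f) p))"
      unfolding wigner_coordinate[OF g Suc.prems, symmetric] by (simp add: norm_mult)
    also have "\<dots> = norm (wigner (Zop q g) f p + wigner g (Zop q f) p) / 2"
      by (simp add: norm_mult)
    also have "\<dots> \<le> norm (wigner (Zop q g) f p) + norm (wigner g (Zop q f) p)"
      using norm_triangle_ineq[of "wigner (Zop q g) f p" "wigner g (Zop q f) p"]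
        norm_ge_zero[of "wigner (Zop q g) f p"] norm_ge_zero[of "wigner g (Zop q f) p"] by linarith
    finally have "\<bar>p \<bullet> q\<bar> ^ k * (\<bar>p \<bullet> q\<bar> * norm (wigner g f p))
        \<le> \<bar>p \<bullet> q\<bar> ^ k * (norm (wigner (Zop q g) f p) + norm (wigner g (Zop q f) p))"
      by (rule mult_left_mono) simp
    also have "\<dots> \<le> C1 * M + C2 * M"
      unfolding distrib_left using g M M1 by (intro add_mono C1 C2) (auto simp: schwartz_Zop)
    finally show ?thesis by (simp add: algebra_simps)
  qed
  then show ?case using C1(1) C2(1) by (intro exI[of _ "C1 + C2"]) auto
qed

text \<open>One seminorm of \<open>g\<close> with a constant independent of \<open>g\<close>: this
  is what makes \<open>weyl_form b f\<close> tempered.\<close>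

lemma wigner_decay:
  fixes f :: "'a::euclidean_space \<Rightarrow> complex"
  assumes f: "f \<in> schwartz"
  shows "\<exists>C\<ge>0. \<forall>g\<in>schwartz. \<forall>p. japanese p ^ k * norm (wigner g f p) \<le> C * schwartz_seminorm k g"
proof -
  have "\<forall>q. \<exists>C\<ge>0. \<forall>g\<in>schwartz. \<forall>M. (\<forall>j\<le>k. \<forall>y. norm ((Zop q ^^ j) g y) \<le> M) \<longrightarrow>
    (\<forall>p. \<bar>p \<bullet> q\<bar> ^ k * norm (wigner g f p) \<le> C * M)"
    using wigner_coordinate_bound[OF f] by blast
  from choice[OF this] obtain C where C0: "\<forall>q. C q \<ge> 0 \<and> (\<forall>g\<in>schwartz. \<forall>M. (\<forall>j\<le>k. \<forall>y. norm ((Zop q ^^ j) g y) \<le> M) \<longrightarrow>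
    (\<forall>p. \<bar>p \<bullet> q\<bar> ^ k * norm (wigner g f p) \<le> C q * M))"
    by (rule exE)
  then have C: "\<And>q. C q \<ge> 0" "\<And>q g M p. g \<in> schwartz \<Longrightarrow> (\<forall>j\<le>k. \<forall>y. norm ((Zop q ^^ j) g y) \<le> M) \<Longrightarrow>
    \<bar>p \<bullet> q\<bar> ^ k * norm (wigner g f p) \<le> C q * M"
    by auto
  obtain E where E: "E \<ge> 0" "\<And>g M p. g \<in> schwartz \<Longrightarrow> (\<forall>y. norm (g y) \<le> M) \<Longrightarrow> norm (wigner g f p) \<le> E * M"
    using wigner_bound[OF f] by blast
  define T where "T = (real DIM('a \<times> 'a) + 1) ^ k * (E + (\<Sum>q\<in>(Basis :: ('a \<times> 'a) set). C q))"
  have "japanese p ^ k * norm (wigner g f p) \<le> T * schwartz_seminorm k g" if g: "g \<in> schwartz" for g p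
  proof -
    let ?M = "schwartz_seminorm k g"
    have Z: "\<forall>j\<le>k. \<forall>y. norm ((Zop q ^^ j) g y) \<le> ?M" if "q \<in> Basis" for q :: "'a \<times> 'a"
      using Zop_funpow_bound[OF g that, of _ 0] schwartz_seminorm_mono[OF g, of _ k]
      by (auto intro: order_trans)
    obtain q0 :: "'a \<times> 'a" where "q0 \<in> Basis" using nonempty_Basis by blast
    from Z[OF this] have "\<forall>y. norm (g y) \<le> ?M" by (auto dest: spec[of _ 0])
    note e = E(2)[OF g this]
    have "japanese p ^ k * norm (wigner g f p)
      \<le> (real DIM('a \<times> 'a) + 1) ^ k * (E * ?M + (\<Sum>q\<in>(Basis :: ('a \<times> 'a) set). C q * ?M))"
      by (rule japanese_power_boundI[OF norm_ge_zero e C(2)[OF g Z]])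
    also have "\<dots> = T * ?M"
      by (simp add: T_def distrib_left distrib_right sum_distrib_right[symmetric] mult.assoc)
    finally show ?thesis .
  qed
  moreover have "0 \<le> T"
    unfolding T_def using C(1) E(1) by (intro mult_nonneg_nonneg add_nonneg_nonneg sum_nonneg) auto
  ultimately show ?thesis by blast
qed

text \<open>Up to the factor \<open>-\<i>\<close> this is \<open>Zop\<close> in the symplectically
  rotated direction. It is chosen so that differentiating a Wigner distribution in direction
  \<open>q\<close> obeys a Leibniz rule with \<open>Yop q\<close> on either argument.\<close>

definition Yop :: "'a \<times> 'a \<Rightarrow> ('a::euclidean_space \<Rightarrow> complex) \<Rightarrow> 'a \<Rightarrow> complex" where
  "Yop q g = (\<lambda>y. - \<i> * Zop (snd q, - fst q) g y)"

lemma schwartz_Yop: "g \<in> schwartz \<Longrightarrow> Yop q g \<in> schwartz"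
  unfolding Yop_def by (intro schwartz_cmult schwartz_Zop)

lemma Yop_eq:
  assumes "g \<in> schwartz" shows "Yop q g y = pd (fst q) g y - \<i> * of_real (y \<bullet> snd q) * g y"
proof -
  have "pd (- fst q) g y = - pd (fst q) g y"
    using linear_neg[OF pd_linear[OF assms]] .
  then show ?thesis by (simp add: Yop_def Zop_def algebra_simps)
qed

lemma wigner_integrand_has_derivative:
  assumes g: "g \<in> schwartz" and f: "f \<in> schwartz"
  shows "((\<lambda>p. wigner_integrand g f p t) has_derivative
     (\<lambda>h. wigner_integrand (Yop h g) f p t + wigner_integrand g (Yop h f) p t)) (at p)"
proof -
  have 1: "((\<lambda>p. g (fst p + t /\<^sub>R 2)) has_derivative (\<lambda>h. pd (fst h) g (fst p + t /\<^sub>R 2))) (at p)"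
    by (rule has_derivative_compose[OF _ schwartz_has_derivative[OF g]]) (auto intro!: derivative_eq_intros)
  have "((\<lambda>p. f (fst p - t /\<^sub>R 2)) has_derivative (\<lambda>h. pd (fst h) f (fst p - t /\<^sub>R 2))) (at p)"
    by (rule has_derivative_compose[OF _ schwartz_has_derivative[OF f]]) (auto intro!: derivative_eq_intros)
  note 2 = has_derivative_cnj[OF this]
  have s: "(snd has_derivative snd) (at p)" by (rule bounded_linear.has_derivative[OF bounded_linear_snd has_derivative_ident])
  have 3: "((\<lambda>p. cis (snd p \<bullet> - t)) has_derivative (\<lambda>h. \<i> * of_real (snd h \<bullet> - t) * cis (snd p \<bullet> - t))) (at p)"
    by (rule has_derivative_compose[OF s has_derivative_cis_inner])
  have c: "cis (- (t \<bullet> snd p)) = cis (snd p \<bullet> - t)" for p :: "'a \<times> 'a"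
    by (simp add: inner_commute)
  show ?thesis
    unfolding wigner_integrand_def Yop_eq[OF g] Yop_eq[OF f] c
    by (rule has_derivative_eq_rhs[OF has_derivative_mult[OF has_derivative_mult[OF 1 2] 3]])
      (auto simp: fun_eq_iff inner_commute[of t] inner_add_left inner_diff_left algebra_simps)
qed

lemma wigner_has_derivative:
  fixes f g :: "'a::euclidean_space \<Rightarrow> complex"
  assumes g: "g \<in> schwartz" and f: "f \<in> schwartz"
  shows "(wigner g f has_derivative (\<lambda>h. wigner (Yop h g) f p0 + wigner g (Yop h f) p0)) (at p0)"
proof -
  let ?D = "2 * DIM('a)"
  let ?F' = "\<lambda>p t h. wigner_integrand (Yop h g) f p t + wigner_integrand g (Yop h f) p t"
  have bnd: "\<exists>C\<ge>0. \<forall>p t. dist p p0 < 1 \<longrightarrow> norm (wigner_integrand g f p t) \<le> C / japanese (t - 2 *\<^sub>R fst p0) ^ ?D"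
    if gf: "g \<in> schwartz" "f \<in> schwartz" for g f
  proof -
    obtain C where C: "C \<ge> 0" "\<And>p t. norm (wigner_integrand g f p t) \<le> C / japanese (t - 2 *\<^sub>R fst p) ^ ?D"
      using wigner_integrand_bound'[OF gf] by blast
    \<comment> \<open>Moving \<open>p\<close> by less than 1 moves the centre
      \<open>2 *\<^sub>R fst p\<close> by at most 2, where the weight is at most 3. With the factor
      2 of Peetre's inequality this makes 6.\<close>
    have "norm (wigner_integrand g f p t) \<le> (C * 6 ^ ?D) / japanese (t - 2 *\<^sub>R fst p0) ^ ?D" if p: "dist p p0 < 1" for p t
    proof -
      have "norm (2 *\<^sub>R (fst p - fst p0)) \<le> 2"
      proof -
        have "norm (fst (p - p0)) \<le> norm (p - p0)" by (metis norm_fst_le prod.collapse)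
        with p show ?thesis by (simp add: dist_norm)
      qed
      then have j3: "japanese (2 *\<^sub>R (fst p - fst p0)) \<le> 3"
        using japanese_le[of "2 *\<^sub>R (fst p - fst p0)"] by linarith
      have "japanese (t - 2 *\<^sub>R fst p0) \<le> 2 * japanese (t - 2 *\<^sub>R fst p) * japanese (2 *\<^sub>R (fst p - fst p0))"
        using japanese_add[of "t - 2 *\<^sub>R fst p" "2 *\<^sub>R (fst p - fst p0)"] by (simp add: scaleR_right_diff_distrib)
      also have "\<dots> \<le> 2 * japanese (t - 2 *\<^sub>R fst p) * 3" using j3 by (intro mult_left_mono) auto
      finally have "japanese (t - 2 *\<^sub>R fst p0) ^ ?D \<le> (6 * japanese (t - 2 *\<^sub>R fst p)) ^ ?D"
        by (intro power_mono) auto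
      then have "C * japanese (t - 2 *\<^sub>R fst p0) ^ ?D \<le> C * (6 * japanese (t - 2 *\<^sub>R fst p)) ^ ?D"
        using C(1) by (rule mult_left_mono)
      then have "C / japanese (t - 2 *\<^sub>R fst p) ^ ?D \<le> (C * 6 ^ ?D) / japanese (t - 2 *\<^sub>R fst p0) ^ ?D"
        by (simp add: field_simps power_mult_distrib)
      with C(2)[of p t] show ?thesis by linarith
    qed
    then show ?thesis using C(1) by (intro exI[of _ "C * 6 ^ ?D"]) auto
  qed
  have "\<forall>b\<in>(Basis :: ('a \<times> 'a) set). \<exists>C\<ge>0. \<forall>p t. dist p p0 < 1 \<longrightarrow> norm (?F' p t b) \<le> C / japanese (t - 2 *\<^sub>R fst p0) ^ ?D"
  proof
    fix b :: "'a \<times> 'a"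
    obtain C1 where C1: "C1 \<ge> 0" "\<And>p t. dist p p0 < 1 \<Longrightarrow> norm (wigner_integrand (Yop b g) f p t) \<le> C1 / japanese (t - 2 *\<^sub>R fst p0) ^ ?D"
      using bnd[OF schwartz_Yop[OF g] f] by blast
    obtain C2 where C2: "C2 \<ge> 0" "\<And>p t. dist p p0 < 1 \<Longrightarrow> norm (wigner_integrand g (Yop b f) p t) \<le> C2 / japanese (t - 2 *\<^sub>R fst p0) ^ ?D"
      using bnd[OF g schwartz_Yop[OF f]] by blast
    have "norm (?F' p t b) \<le> (C1 + C2) / japanese (t - 2 *\<^sub>R fst p0) ^ ?D" if "dist p p0 < 1" for p t
      using norm_triangle_ineq[of "wigner_integrand (Yop b g) f p t" "wigner_integrand g (Yop b f) p t"]
        C1(2)[OF that, of t] C2(2)[OF that, of t] by (simp add: add_divide_distrib)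
    then show "\<exists>C\<ge>0. \<forall>p t. dist p p0 < 1 \<longrightarrow> norm (?F' p t b) \<le> C / japanese (t - 2 *\<^sub>R fst p0) ^ ?D"
      using C1(1) C2(1) by (intro exI[of _ "C1 + C2"]) auto
  qed
  from bchoice[OF this] obtain C where
    CC: "\<forall>b\<in>(Basis :: ('a \<times> 'a) set). C b \<ge> 0 \<and> (\<forall>p t. dist p p0 < 1 \<longrightarrow> norm (?F' p t b) \<le> C b / japanese (t - 2 *\<^sub>R fst p0) ^ ?D)"
    by (rule exE)
  define E where "E = (\<Sum>b\<in>(Basis :: ('a \<times> 'a) set). C b)"
  have "((\<lambda>p. LINT t|lborel. wigner_integrand g f p t) has_derivative (\<lambda>h. LINT t|lborel. ?F' p0 t h)) (at p0)"
  proof (rule has_derivative_integral_dominated)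
    show d: "((\<lambda>p. wigner_integrand g f p t) has_derivative ?F' p t) (at p)" for p t
      by (rule wigner_integrand_has_derivative[OF g f])
    show "integrable lborel (wigner_integrand g f p)" for p by (rule wigner_integrable[OF g f])
    note [measurable] = wigner_integrand_measurable[OF schwartz_Yop[OF g] f] wigner_integrand_measurable[OF g schwartz_Yop[OF f]]
    show "(\<lambda>t. ?F' p0 t h) \<in> borel_measurable borel" for h by measurable
    show "integrable lborel (\<lambda>t. E / japanese (t - 2 *\<^sub>R fst p0) ^ ?D)" by (rule integrable_inverse_japanese_shift)
    show "norm (?F' p t h) \<le> norm h * (E / japanese (t - 2 *\<^sub>R fst p0) ^ ?D)" if p: "dist p p0 < 1" for p t h
    proof -
      note lin = has_derivative_linear[OF d[where p = p and t = t]]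
      have "?F' p t (\<Sum>b\<in>Basis. (h \<bullet> b) *\<^sub>R b) = (\<Sum>b\<in>Basis. (h \<bullet> b) *\<^sub>R ?F' p t b)"
        using linear_sum[OF lin, of "\<lambda>b. (h \<bullet> b) *\<^sub>R b" Basis] linear_scale[OF lin] by simp
      then have "norm (?F' p t h) = norm (\<Sum>b\<in>Basis. (h \<bullet> b) *\<^sub>R ?F' p t b)"
        by (simp add: euclidean_representation)
      also have "\<dots> \<le> (\<Sum>b\<in>Basis. norm h * (C b / japanese (t - 2 *\<^sub>R fst p0) ^ ?D))"
      proof (rule sum_norm_le)
        fix b :: "'a \<times> 'a" assume b: "b \<in> Basis"
        show "norm ((h \<bullet> b) *\<^sub>R ?F' p t b) \<le> norm h * (C b / japanese (t - 2 *\<^sub>R fst p0) ^ ?D)"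
        proof -
          have "norm (?F' p t b) \<le> C b / japanese (t - 2 *\<^sub>R fst p0) ^ ?D"
            using bspec[OF CC b] p by blast
          then show ?thesis
            unfolding norm_scaleR using Basis_le_norm[OF b, of h] by (intro mult_mono) auto
        qed
      qed
      also have "\<dots> = norm h * (E / japanese (t - 2 *\<^sub>R fst p0) ^ ?D)"
        by (simp add: E_def sum_divide_distrib sum_distrib_left)
      finally show ?thesis .
    qed
  qed
  moreover have "(LINT t|lborel. ?F' p0 t h) = wigner (Yop h g) f p0 + wigner g (Yop h f) p0" for h
    unfolding wigner_eq by (intro Bochner_Integration.integral_add wigner_integrable schwartz_Yop g f)
  ultimately show ?thesis unfolding wigner_eq[abs_def] by simp
qed

lemma schwartz_wigner:
  assumes "g \<in> schwartz" "f \<in> schwartz" shows "wigner g f \<in> schwartz"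
proof -
  have dec: "decay (wigner g f)" if "g \<in> schwartz" "f \<in> schwartz" for g f :: "'a \<Rightarrow> complex"
    unfolding decay_def using wigner_decay[OF that(2)] that(1) by blast
  have "schwartz_upto n (wigner g f)" for n
    using assms
  proof (induction n arbitrary: g f)
    case (Suc n)
    have "pd b (wigner g f) = (\<lambda>p. wigner (Yop b g) f p + wigner g (Yop b f) p)" for b
      using pd_eq[OF wigner_has_derivative[OF Suc.prems]] by blast
    moreover have "wigner g f differentiable (at p)" for p
      using wigner_has_derivative[OF Suc.prems] differentiable_def by blast
    ultimately show ?case
      using Suc.prems by (auto simp: dec intro!: schwartz_upto_add Suc.IH schwartz_Yop)
  qed (simp add: dec)
  then show ?thesis by (simp add: schwartz_iff_upto)
qed

text \<open>Substituting \<open>t + (fst z - fst w)\<close> for \<open>t\<close> centres both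
  factors at the midpoint of \<open>z\<close> and \<open>w\<close>. What remains is a modulation by
  the rotated difference of \<open>z\<close> and \<open>w\<close>. The midpoint will give
  localization near the support of the symbol, the modulation decay off the diagonal.\<close>

lemma wigner_tf_shift:
  fixes f g :: "'a::euclidean_space \<Rightarrow> complex" and z w :: "'a \<times> 'a"
  assumes g: "g \<in> schwartz" and f: "f \<in> schwartz"
  shows "wigner (tf_shift z g) (tf_shift w f) p
    = cis ((fst z - fst w) \<bullet> (snd z + snd w) / 2) * cis (p \<bullet> (snd z - snd w, fst w - fst z))
      * wigner g f (p - (z + w) /\<^sub>R 2)"
proof -
  let ?W = "wigner_integrand (tf_shift z g) (tf_shift w f) p"
  let ?m = "(z + w) /\<^sub>R 2"
  let ?c = "cis ((fst z - fst w) \<bullet> (snd z + snd w) / 2) * cis (p \<bullet> (snd z - snd w, fst w - fst z))"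
  have "wigner (tf_shift z g) (tf_shift w f) p = (LINT t|lborel. ?W (t + (fst z - fst w)))"
    unfolding wigner_eq
    by (rule lborel_integral_translate[symmetric, OF wigner_integrand_measurable[OF schwartz_tf_shift[OF g] schwartz_tf_shift[OF f]]])
  also have "\<dots> = (LINT t|lborel. ?c * wigner_integrand g f (p - ?m) t)"
  proof (intro Bochner_Integration.integral_cong refl)
    fix t
    have 1: "fst p + (t + (fst z - fst w)) /\<^sub>R 2 - fst z = fst (p - ?m) + t /\<^sub>R 2"
      "fst p - (t + (fst z - fst w)) /\<^sub>R 2 - fst w = fst (p - ?m) - t /\<^sub>R 2"
      by (simp_all add: scaleR_right_distrib scaleR_right_diff_distrib algebra_simps flip: scaleR_add_left)
    show "?W (t + (fst z - fst w)) = ?c * wigner_integrand g f (p - ?m) t"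
    proof -
      have "?W (t + (fst z - fst w))
        = (cis ((fst p + (t + (fst z - fst w)) /\<^sub>R 2) \<bullet> snd z) * cis (- ((fst p - (t + (fst z - fst w)) /\<^sub>R 2) \<bullet> snd w))
           * cis (- ((t + (fst z - fst w)) \<bullet> snd p)))
          * (g (fst (p - ?m) + t /\<^sub>R 2) * cnj (f (fst (p - ?m) - t /\<^sub>R 2)))"
        unfolding wigner_integrand_def tf_shift_def 1 by (simp add: cis_cnj mult_ac)
      also have "(cis ((fst p + (t + (fst z - fst w)) /\<^sub>R 2) \<bullet> snd z) * cis (- ((fst p - (t + (fst z - fst w)) /\<^sub>R 2) \<bullet> snd w))
           * cis (- ((t + (fst z - fst w)) \<bullet> snd p))) = ?c * cis (- (t \<bullet> snd (p - ?m)))"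
        unfolding cis_mult
        by (rule arg_cong[where f = cis]) (simp add: inner_prod_def inner_add_left inner_diff_left inner_add_right inner_diff_right inner_commute field_simps)
      finally show ?thesis by (simp add: wigner_integrand_def mult_ac)
    qed
  qed
  also have "\<dots> = ?c * wigner g f (p - ?m)" unfolding wigner_eq by simp
  finally show ?thesis .
qed

section \<open>Almost diagonalization of Weyl operators\<close>

text \<open>Its integral is the short-time Fourier transform of the symbol \<open>a\<close> on phase
  space, with window \<open>\<Phi>\<close>, position \<open>m\<close> and frequency
  \<open>\<zeta>\<close>.\<close>

definition osc_integrand ::
    "('b::euclidean_space \<Rightarrow> complex) \<Rightarrow> ('b \<Rightarrow> complex) \<Rightarrow> 'b \<Rightarrow> 'b \<Rightarrow> 'b \<Rightarrow> complex" where
  "osc_integrand a \<Phi> m \<zeta> p = a p * (cis (p \<bullet> - \<zeta>) * cnj (\<Phi> (p - m)))"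

lemma osc_integrand_measurable:
  assumes "a \<in> S00" "\<Phi> \<in> schwartz"
  shows "osc_integrand a \<Phi> m \<zeta> \<in> borel_measurable borel"
proof -
  have "continuous_on UNIV a"
    using S00_has_derivative[OF assms(1)] by (metis continuous_at_imp_continuous_on has_derivative_continuous)
  note [continuous_intros] = continuous_on_compose2[OF schwartz_continuous[OF assms(2)]]
    continuous_on_compose2[OF this]
  have "continuous_on UNIV (osc_integrand a \<Phi> m \<zeta>)"
    unfolding osc_integrand_def[abs_def] by (intro continuous_intros) auto
  then show ?thesis by (rule borel_measurable_continuous_onI)
qed

text \<open>Where \<open>a\<close> may be nonzero, \<open>p\<close> has distance at least
  \<open>\<rho>\<close> from \<open>m\<close>, so
  \<open>1 + \<rho> \<le> 2 * japanese (p - m)\<close>, and \<open>l\<close> surplus powers of decay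
  of \<open>\<Phi>\<close> become the factor \<open>(1 + \<rho>) ^ l\<close>. For
  \<open>\<rho> = 0\<close> the vanishing condition is void, which covers the general case.\<close>

lemma osc_integrand_bound:
  fixes a :: "'b::euclidean_space \<Rightarrow> complex"
  assumes "a \<in> S00" "\<Phi> \<in> schwartz"
  shows "\<exists>C\<ge>0. \<forall>m \<zeta>. \<forall>\<rho>\<ge>0. (\<forall>p. dist p m < \<rho> \<longrightarrow> a p = 0) \<longrightarrow>
    (\<forall>p. norm (osc_integrand a \<Phi> m \<zeta> p) \<le> (C / (1 + \<rho>) ^ l) / japanese (p - m) ^ (2 * DIM('b)))"
proof -
  let ?D = "2 * DIM('b)"
  obtain A where A: "0 < A" "\<And>p. norm (a p) \<le> A" using S00_bounded[OF assms(1)] by blast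
  obtain D where D: "0 < D" "\<And>p. norm (\<Phi> p) \<le> D / japanese p ^ (?D + l)"
    using decay_bounded[OF schwartz_decay[OF assms(2)]] by blast
  have "norm (osc_integrand a \<Phi> m \<zeta> p) \<le> ((A * D * 2 ^ l) / (1 + \<rho>) ^ l) / japanese (p - m) ^ ?D"
    if \<rho>: "\<rho> \<ge> 0" and van: "\<forall>p. dist p m < \<rho> \<longrightarrow> a p = 0" for m \<zeta> \<rho> p
  proof (cases "dist p m < \<rho>")
    case True
    then have "osc_integrand a \<Phi> m \<zeta> p = 0" using van by (simp add: osc_integrand_def)
    then show ?thesis using A(1) D(1) \<rho> by simp
  next
    case False
    have "\<rho> \<le> japanese (p - m)"
      using False norm_le_japanese[of "p - m"] by (simp add: dist_norm)
    then have "1 + \<rho> \<le> 2 * japanese (p - m)" using japanese_ge_1[of "p - m"] by simp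
    then have "(1 + \<rho>) ^ l \<le> (2 * japanese (p - m)) ^ l" using \<rho> by (intro power_mono) auto
    then have j: "1 / japanese (p - m) ^ l \<le> 2 ^ l / (1 + \<rho>) ^ l"
      using \<rho> by (simp add: power_mult_distrib field_simps)
    have "norm (osc_integrand a \<Phi> m \<zeta> p) = norm (a p) * norm (\<Phi> (p - m))"
      by (simp add: osc_integrand_def norm_mult)
    also have "\<dots> \<le> A * (D / japanese (p - m) ^ (?D + l))" by (intro mult_mono A D) (use A(1) in auto)
    also have "\<dots> = (A * D / japanese (p - m) ^ ?D) * (1 / japanese (p - m) ^ l)" by (simp add: power_add)
    also have "\<dots> \<le> (A * D / japanese (p - m) ^ ?D) * (2 ^ l / (1 + \<rho>) ^ l)"
      using A(1) D(1) by (intro mult_left_mono j) auto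
    finally show ?thesis by (simp add: mult_ac)
  qed
  then show ?thesis using A(1) D(1) by (intro exI[of _ "A * D * 2 ^ l"]) auto
qed

lemma osc_integrand_bound':
  fixes a :: "'b::euclidean_space \<Rightarrow> complex"
  assumes "a \<in> S00" "\<Phi> \<in> schwartz"
  shows "\<exists>C\<ge>0. \<forall>p. norm (osc_integrand a \<Phi> m \<zeta> p) \<le> C / japanese p ^ (2 * DIM('b))"
proof -
  let ?D = "2 * DIM('b)"
  obtain C where C0: "C \<ge> 0" "\<And>m \<zeta> \<rho> p. \<rho> \<ge> 0 \<Longrightarrow> (\<forall>p. dist p m < \<rho> \<longrightarrow> a p = 0) \<Longrightarrow>
    norm (osc_integrand a \<Phi> m \<zeta> p) \<le> (C / (1 + \<rho>) ^ 0) / japanese (p - m) ^ ?D"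
    using osc_integrand_bound[OF assms, of 0] by blast
  have C: "C \<ge> 0" "norm (osc_integrand a \<Phi> m \<zeta> p) \<le> C / japanese (p - m) ^ ?D" for p
    using C0(1) C0(2)[of 0 m \<zeta> p] by auto
  have "norm (osc_integrand a \<Phi> m \<zeta> p) \<le> (C * 2 ^ ?D * japanese m ^ ?D) / japanese p ^ ?D" for p
  proof -
    have "C * japanese p ^ ?D \<le> C * (2 ^ ?D * japanese m ^ ?D * japanese (p - m) ^ ?D)"
      by (intro mult_left_mono japanese_diff_power C)
    then have "C / japanese (p - m) ^ ?D \<le> (C * 2 ^ ?D * japanese m ^ ?D) / japanese p ^ ?D"
      by (simp add: field_simps)
    with C(2)[of p] show ?thesis by linarith
  qed
  then show ?thesis using C(1) by (intro exI[of _ "C * 2 ^ ?D * japanese m ^ ?D"]) auto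
qed

lemma osc_integrable:
  assumes "a \<in> S00" "\<Phi> \<in> schwartz"
  shows "integrable lborel (osc_integrand a \<Phi> m \<zeta>)"
proof -
  obtain C where "\<And>p. norm (osc_integrand a \<Phi> m \<zeta> p) \<le> C / japanese (p - 0) ^ (2 * DIM('a))"
    using osc_integrand_bound'[OF assms, of m \<zeta>] by auto
  then show ?thesis by (rule integrable_decay[OF osc_integrand_measurable[OF assms]])
qed

lemma osc_parts:
  fixes a :: "'b::euclidean_space \<Rightarrow> complex"
  assumes a: "a \<in> S00" and \<Phi>: "\<Phi> \<in> schwartz" and b: "b \<in> Basis"
  shows "\<i> * of_real (\<zeta> \<bullet> b) * (LINT p|lborel. osc_integrand a \<Phi> m \<zeta> p)
     = (LINT p|lborel. osc_integrand (pd b a) \<Phi> m \<zeta> p) + (LINT p|lborel. osc_integrand a (pd b \<Phi>) m \<zeta> p)"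
proof -
  let ?I = "\<lambda>a \<Phi>. osc_integrand a \<Phi> m \<zeta>"
  let ?D = "2 * DIM('b)"
  note pa = S00_pd[OF a b] and p\<Phi> = schwartz_pd[OF \<Phi> b]
  define F' where "F' p h = a p * (cis (p \<bullet> - \<zeta>) * cnj (pd h \<Phi> (p - m)) + \<i> * of_real (h \<bullet> - \<zeta>) * cis (p \<bullet> - \<zeta>) * cnj (\<Phi> (p - m)))
      + pd h a p * (cis (p \<bullet> - \<zeta>) * cnj (\<Phi> (p - m)))" for p h
  have F'b: "F' p b = ?I (pd b a) \<Phi> p + ?I a (pd b \<Phi>) p - \<i> * of_real (\<zeta> \<bullet> b) * ?I a \<Phi> p" for p
    by (simp add: F'_def osc_integrand_def inner_commute algebra_simps)
  obtain C1 where C1: "C1 \<ge> 0" "\<And>p. norm (?I a \<Phi> p) \<le> C1 / japanese p ^ ?D" using osc_integrand_bound'[OF a \<Phi>] by blast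
  obtain C2 where C2: "C2 \<ge> 0" "\<And>p. norm (?I (pd b a) \<Phi> p) \<le> C2 / japanese p ^ ?D" using osc_integrand_bound'[OF pa \<Phi>] by blast
  obtain C3 where C3: "C3 \<ge> 0" "\<And>p. norm (?I a (pd b \<Phi>) p) \<le> C3 / japanese p ^ ?D" using osc_integrand_bound'[OF a p\<Phi>] by blast
  define C where "C = C1 + C2 + C3 + \<bar>\<zeta> \<bullet> b\<bar> * C1"
  have "(LINT p|lborel. F' p b) = 0"
  proof (rule integral_directional_derivative_zero[where F = "?I a \<Phi>" and F' = F' and C = C])
    show "(?I a \<Phi> has_derivative F' p) (at p)" for p
    proof -
      have "((\<lambda>p. \<Phi> (p - m)) has_derivative (\<lambda>h. pd h \<Phi> (p - m))) (at p)"
        by (rule has_derivative_compose[OF _ schwartz_has_derivative[OF \<Phi>]]) (auto intro!: derivative_eq_intros)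
      then show ?thesis
        unfolding osc_integrand_def[abs_def] F'_def
        by (intro has_derivative_mult S00_has_derivative[OF a] has_derivative_cis_inner has_derivative_cnj)
    qed
    note [measurable] = osc_integrand_measurable[OF a \<Phi>] osc_integrand_measurable[OF pa \<Phi>] osc_integrand_measurable[OF a p\<Phi>]
    show "(\<lambda>p. F' p b) \<in> borel_measurable borel" unfolding F'b by measurable
    show "norm (?I a \<Phi> p) \<le> C / japanese p ^ ?D" for p
      by (rule order_trans[OF C1(2) divide_right_mono]) (use C1 C2 C3 in \<open>auto simp: C_def\<close>)
    show "norm (F' p b) \<le> C / japanese p ^ ?D" for p
    proof -
      have "norm (F' p b) \<le> norm (?I (pd b a) \<Phi> p) + norm (?I a (pd b \<Phi>) p) + norm (\<i> * of_real (\<zeta> \<bullet> b) * ?I a \<Phi> p)"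
        unfolding F'b by (intro order_trans[OF norm_triangle_ineq4] add_mono norm_triangle_ineq order_refl)
      also have "\<dots> = norm (?I (pd b a) \<Phi> p) + norm (?I a (pd b \<Phi>) p) + \<bar>\<zeta> \<bullet> b\<bar> * norm (?I a \<Phi> p)"
        by (simp add: norm_mult)
      also have "\<dots> \<le> C2 / japanese p ^ ?D + C3 / japanese p ^ ?D + \<bar>\<zeta> \<bullet> b\<bar> * (C1 / japanese p ^ ?D)"
        by (intro add_mono mult_left_mono C1 C2 C3) auto
      also have "\<dots> = (C2 + C3 + \<bar>\<zeta> \<bullet> b\<bar> * C1) / japanese p ^ ?D" by (simp add: add_divide_distrib)
      also have "\<dots> \<le> C / japanese p ^ ?D" using C1 by (intro divide_right_mono) (auto simp: C_def)
      finally show ?thesis .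
    qed
  qed
  then show ?thesis
    unfolding F'b using a \<Phi> pa p\<Phi> by (simp add: osc_integrable)
qed

text \<open>Repeated integration by parts. Each derivative falls on \<open>a\<close>, which stays in
  \<open>S00\<close>, or on \<open>\<Phi>\<close>, which stays Schwartz; so the induction ranges
  over both, and the constant is uniform in \<open>m\<close> because derivatives of \<open>a\<close>
  are bounded.\<close>

lemma osc_coordinate_bound:
  fixes a :: "'b::euclidean_space \<Rightarrow> complex"
  assumes b: "b \<in> Basis" and "a \<in> S00" "\<Phi> \<in> schwartz"
  shows "\<exists>C\<ge>0. \<forall>m \<zeta>. \<forall>\<rho>\<ge>0. (\<forall>p. dist p m < \<rho> \<longrightarrow> a p = 0) \<longrightarrow>
    (1 + \<rho>) ^ l * (\<bar>\<zeta> \<bullet> b\<bar> ^ k * norm (LINT p|lborel. osc_integrand a \<Phi> m \<zeta> p)) \<le> C"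
  using assms(2,3)
proof (induction k arbitrary: a \<Phi>)
  case 0
  obtain C where C: "C \<ge> 0" "\<And>m \<zeta> \<rho> p. \<rho> \<ge> 0 \<Longrightarrow> (\<forall>p. dist p m < \<rho> \<longrightarrow> a p = 0) \<Longrightarrow>
    norm (osc_integrand a \<Phi> m \<zeta> p) \<le> (C / (1 + \<rho>) ^ l) / japanese (p - m) ^ (2 * DIM('b))"
    using osc_integrand_bound[OF 0, of l] by blast
  have "(1 + \<rho>) ^ l * norm (LINT p|lborel. osc_integrand a \<Phi> m \<zeta> p) \<le> C * japanese_int TYPE('b)"
    if "\<rho> \<ge> 0" "\<forall>p. dist p m < \<rho> \<longrightarrow> a p = 0" for m \<zeta> \<rho>
  proof -
    have "norm (LINT p|lborel. osc_integrand a \<Phi> m \<zeta> p) \<le> C / (1 + \<rho>) ^ l * japanese_int TYPE('b)"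
      by (rule integral_decay_bound[OF osc_integrand_measurable[OF 0] C(2)[OF that]])
    then show ?thesis using that(1) by (simp add: field_simps)
  qed
  then show ?case using C(1) japanese_int_nonneg by (intro exI[of _ "C * japanese_int TYPE('b)"]) auto
next
  case (Suc k)
  obtain C1 where C1: "C1 \<ge> 0" "\<And>m \<zeta> \<rho>. \<rho> \<ge> 0 \<Longrightarrow> (\<forall>p. dist p m < \<rho> \<longrightarrow> pd b a p = 0) \<Longrightarrow>
    (1 + \<rho>) ^ l * (\<bar>\<zeta> \<bullet> b\<bar> ^ k * norm (LINT p|lborel. osc_integrand (pd b a) \<Phi> m \<zeta> p)) \<le> C1"
    using Suc.IH[OF S00_pd[OF Suc.prems(1) b] Suc.prems(2)] by blast
  obtain C2 where C2: "C2 \<ge> 0" "\<And>m \<zeta> \<rho>. \<rho> \<ge> 0 \<Longrightarrow> (\<forall>p. dist p m < \<rho> \<longrightarrow> a p = 0) \<Longrightarrow>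
    (1 + \<rho>) ^ l * (\<bar>\<zeta> \<bullet> b\<bar> ^ k * norm (LINT p|lborel. osc_integrand a (pd b \<Phi>) m \<zeta> p)) \<le> C2"
    using Suc.IH[OF Suc.prems(1) schwartz_pd[OF Suc.prems(2) b]] by blast
  have "(1 + \<rho>) ^ l * (\<bar>\<zeta> \<bullet> b\<bar> ^ Suc k * norm (LINT p|lborel. osc_integrand a \<Phi> m \<zeta> p)) \<le> C1 + C2"
    if \<rho>: "\<rho> \<ge> 0" and van: "\<forall>p. dist p m < \<rho> \<longrightarrow> a p = 0" for m \<zeta> \<rho>
  proof -
    let ?I = "\<lambda>a \<Phi>. LINT p|lborel. osc_integrand a \<Phi> m \<zeta> p"
    \<comment> \<open>The ball is open, so the derivative of \<open>a\<close> vanishes on it as well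
      and the radius is preserved.\<close>
    have van': "\<forall>p. dist p m < \<rho> \<longrightarrow> pd b a p = 0"
    proof (intro allI impI)
      fix p assume p: "dist p m < \<rho>"
      have "((\<lambda>_. 0) has_derivative (\<lambda>_. 0)) (at p)" by simp
      then have "(a has_derivative (\<lambda>_. 0)) (at p)"
        by (rule has_derivative_transform_within_open[of _ _ _ _ "ball m \<rho>"])
          (use p van in \<open>auto simp: dist_commute\<close>)
      then show "pd b a p = 0" by (rule pd_eq)
    qed
    have "\<bar>\<zeta> \<bullet> b\<bar> * norm (?I a \<Phi>) = norm (?I (pd b a) \<Phi> + ?I a (pd b \<Phi>))"
      unfolding osc_parts[OF Suc.prems b, symmetric] by (simp add: norm_mult)
    also have "\<dots> \<le> norm (?I (pd b a) \<Phi>) + norm (?I a (pd b \<Phi>))" by (rule norm_triangle_ineq)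
    finally have "((1 + \<rho>) ^ l * \<bar>\<zeta> \<bullet> b\<bar> ^ k) * (\<bar>\<zeta> \<bullet> b\<bar> * norm (?I a \<Phi>))
       \<le> ((1 + \<rho>) ^ l * \<bar>\<zeta> \<bullet> b\<bar> ^ k) * (norm (?I (pd b a) \<Phi>) + norm (?I a (pd b \<Phi>)))"
      using \<rho> by (intro mult_left_mono) auto
    also have "\<dots> \<le> C1 + C2"
      using add_mono[OF C1(2)[OF \<rho> van', of \<zeta>] C2(2)[OF \<rho> van, of \<zeta>]] by (simp add: algebra_simps)
    finally show ?thesis by (simp add: mult_ac)
  qed
  then show ?case using C1(1) C2(1) by (intro exI[of _ "C1 + C2"]) auto
qed

lemma osc_bound:
  fixes a :: "'b::euclidean_space \<Rightarrow> complex"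
  assumes "a \<in> S00" "\<Phi> \<in> schwartz"
  shows "\<exists>C\<ge>0. \<forall>m \<zeta>. \<forall>\<rho>\<ge>0. (\<forall>p. dist p m < \<rho> \<longrightarrow> a p = 0) \<longrightarrow>
    (1 + \<rho>) ^ l * (japanese \<zeta> ^ k * norm (LINT p|lborel. osc_integrand a \<Phi> m \<zeta> p)) \<le> C"
proof -
  have "\<forall>b\<in>Basis. \<exists>C\<ge>0. \<forall>m \<zeta>. \<forall>\<rho>\<ge>0. (\<forall>p. dist p m < \<rho> \<longrightarrow> a p = 0) \<longrightarrow>
    (1 + \<rho>) ^ l * (\<bar>\<zeta> \<bullet> b\<bar> ^ k * norm (LINT p|lborel. osc_integrand a \<Phi> m \<zeta> p)) \<le> C"
    using osc_coordinate_bound[OF _ assms] by blast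
  from bchoice[OF this] obtain C where
    CC: "\<forall>b\<in>Basis. C b \<ge> 0 \<and> (\<forall>m \<zeta>. \<forall>\<rho>\<ge>0. (\<forall>p. dist p m < \<rho> \<longrightarrow> a p = 0) \<longrightarrow>
    (1 + \<rho>) ^ l * (\<bar>\<zeta> \<bullet> b\<bar> ^ k * norm (LINT p|lborel. osc_integrand a \<Phi> m \<zeta> p)) \<le> C b)"
    by (rule exE)
  then have C: "\<And>b. b \<in> Basis \<Longrightarrow> C b \<ge> 0" "\<And>b m \<zeta> \<rho>. b \<in> Basis \<Longrightarrow> \<rho> \<ge> 0 \<Longrightarrow> (\<forall>p. dist p m < \<rho> \<longrightarrow> a p = 0) \<Longrightarrow>
    (1 + \<rho>) ^ l * (\<bar>\<zeta> \<bullet> b\<bar> ^ k * norm (LINT p|lborel. osc_integrand a \<Phi> m \<zeta> p)) \<le> C b"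
    by auto
  obtain b0 :: 'b where b0: "b0 \<in> Basis" using nonempty_Basis by blast
  obtain E where E: "E \<ge> 0" "\<And>m \<zeta> \<rho>. \<rho> \<ge> 0 \<Longrightarrow> (\<forall>p. dist p m < \<rho> \<longrightarrow> a p = 0) \<Longrightarrow>
    (1 + \<rho>) ^ l * norm (LINT p|lborel. osc_integrand a \<Phi> m \<zeta> p) \<le> E"
    using osc_coordinate_bound[OF b0 assms, of l 0] by (auto simp only: power_0 mult_1_left)
  define T where "T = (real DIM('b) + 1) ^ k * (E + (\<Sum>b\<in>Basis. C b))"
  have "(1 + \<rho>) ^ l * (japanese \<zeta> ^ k * norm (LINT p|lborel. osc_integrand a \<Phi> m \<zeta> p)) \<le> T"
    if \<rho>: "\<rho> \<ge> 0" "\<forall>p. dist p m < \<rho> \<longrightarrow> a p = 0" for m \<zeta> \<rho>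
  proof -
    have "japanese \<zeta> ^ k * ((1 + \<rho>) ^ l * norm (LINT p|lborel. osc_integrand a \<Phi> m \<zeta> p)) \<le> T"
      unfolding T_def
    proof (rule japanese_power_boundI)
      show "0 \<le> (1 + \<rho>) ^ l * norm (LINT p|lborel. osc_integrand a \<Phi> m \<zeta> p)" using \<rho> by simp
      show "(1 + \<rho>) ^ l * norm (LINT p|lborel. osc_integrand a \<Phi> m \<zeta> p) \<le> E" by (rule E(2)[OF \<rho>])
      show "\<bar>\<zeta> \<bullet> b\<bar> ^ k * ((1 + \<rho>) ^ l * norm (LINT p|lborel. osc_integrand a \<Phi> m \<zeta> p)) \<le> C b" if "b \<in> Basis" for b
        using C(2)[OF that \<rho>, of \<zeta>] by (simp add: mult_ac)
    qed
    then show ?thesis by (simp add: mult_ac)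
  qed
  moreover have "0 \<le> T"
    unfolding T_def using C(1) E(1) by (intro mult_nonneg_nonneg add_nonneg_nonneg sum_nonneg) auto
  ultimately show ?thesis by blast
qed

section \<open>Weyl operators tested on time-frequency shifts\<close>

definition weyl_form ::
    "('a::euclidean_space \<times> 'a \<Rightarrow> complex) \<Rightarrow> ('a \<Rightarrow> complex) \<Rightarrow> ('a \<Rightarrow> complex) \<Rightarrow> complex" where
  "weyl_form b f g = (LINT p|lborel. b p * cnj (wigner g f p))"

lemma weyl_dist_eq:
  "weyl_dist (dist_of_fun b) f g = of_real (1 / (2 * pi) ^ DIM('a)) * weyl_form b f (g :: 'a::euclidean_space \<Rightarrow> complex)"
  by (simp add: weyl_dist_def weyl_form_def dist_of_fun_def)

lemma weyl_form_integrable: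
  fixes f g :: "'a::euclidean_space \<Rightarrow> complex"
  assumes b: "b \<in> S00" and f: "f \<in> schwartz" and g: "g \<in> schwartz"
  shows "integrable lborel (\<lambda>p. b p * cnj (wigner g f p))"
  using osc_integrable[OF b schwartz_wigner[OF g f], of 0 0] by (simp add: osc_integrand_def[abs_def])

text \<open>Temperedness in the test function allows the form to be evaluated term by term on a
  frame expansion of that function.\<close>

lemma tempered_weyl_form:
  fixes f :: "'a::euclidean_space \<Rightarrow> complex"
  assumes b: "b \<in> S00" and f: "f \<in> schwartz"
  shows "weyl_form b f \<in> tempered"
proof -
  let ?D = "2 * DIM('a \<times> 'a)"
  obtain A where A: "0 < A" "\<And>p. norm (b p) \<le> A" using S00_bounded[OF b] by blast
  obtain C where C: "C \<ge> 0" "\<And>g p. g \<in> schwartz \<Longrightarrow> japanese p ^ ?D * norm (wigner g f p) \<le> C * schwartz_seminorm ?D g"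
    using wigner_decay[OF f, of ?D] by blast
  have "norm (weyl_form b f g) \<le> (A * C * japanese_int TYPE('a \<times> 'a)) * schwartz_seminorm ?D g" if g: "g \<in> schwartz" for g
  proof -
    have "norm (b p * cnj (wigner g f p)) \<le> (A * (C * schwartz_seminorm ?D g)) / japanese (p - 0) ^ ?D" for p
    proof -
      have "norm (wigner g f p) \<le> (C * schwartz_seminorm ?D g) / japanese p ^ ?D"
        using C(2)[OF g, of p] by (simp add: field_simps)
      then have "norm (b p) * norm (wigner g f p) \<le> A * ((C * schwartz_seminorm ?D g) / japanese p ^ ?D)"
        by (intro mult_mono A) (use A(1) in auto)
      then show ?thesis by (simp add: norm_mult)
    qed
    from integral_decay_bound[OF borel_measurable_integrable[OF weyl_form_integrable[OF b f g], simplified] this]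
    show ?thesis by (simp add: weyl_form_def mult_ac)
  qed
  moreover have "weyl_form b f (\<lambda>x. g x + h x) = weyl_form b f g + weyl_form b f h" if "g \<in> schwartz" "h \<in> schwartz" for g h
    unfolding weyl_form_def using that b f
    by (simp add: wigner_add_left distrib_left weyl_form_integrable)
  moreover have "weyl_form b f (\<lambda>x. c * g x) = cnj c * weyl_form b f g" for c g
    unfolding weyl_form_def wigner_cmult_left by (simp add: mult.left_commute)
  ultimately show ?thesis unfolding tempered_def by blast
qed

lemma weyl_form_tf_shift:
  fixes f g :: "'a::euclidean_space \<Rightarrow> complex" and z w :: "'a \<times> 'a"
  assumes g: "g \<in> schwartz" and f: "f \<in> schwartz"
  shows "norm (weyl_form b (tf_shift w f) (tf_shift z g))
    = norm (LINT p|lborel. osc_integrand b (wigner g f) ((z + w) /\<^sub>R 2) (snd z - snd w, fst w - fst z) p)"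
proof -
  let ?c = "cis (- ((fst z - fst w) \<bullet> (snd z + snd w) / 2))"
  have "weyl_form b (tf_shift w f) (tf_shift z g)
    = (LINT p|lborel. ?c * osc_integrand b (wigner g f) ((z + w) /\<^sub>R 2) (snd z - snd w, fst w - fst z) p)"
    unfolding weyl_form_def
    by (intro Bochner_Integration.integral_cong refl)
      (simp add: wigner_tf_shift[OF g f] osc_integrand_def cis_cnj inner_prod_def inner_diff_right mult_ac)
  then show ?thesis by (simp add: norm_mult)
qed

context tf_frame
begin

text \<open>The frequency in \<open>weyl_form_tf_shift\<close> is \<open>z - w\<close> after an
  isometric rotation, so decay in frequency is decay off the diagonal. The factor
  \<open>(1 + \<rho>) ^ l\<close> is the gain when the midpoint is far from the support of the
  symbol.\<close>

lemma weyl_form_bound: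
  assumes b: "b \<in> S00" and f: "f \<in> schwartz"
  shows "\<exists>C\<ge>0. \<forall>z w. \<forall>\<rho>\<ge>0. (\<forall>p. dist p ((z + w) /\<^sub>R 2) < \<rho> \<longrightarrow> b p = 0) \<longrightarrow>
    (1 + \<rho>) ^ l * (japanese (z - w) ^ k * norm (weyl_form b (tf_shift w f) (tf_shift z \<gamma>))) \<le> C"
proof -
  obtain C where C: "C \<ge> 0" "\<And>m \<zeta> \<rho>. \<rho> \<ge> 0 \<Longrightarrow> (\<forall>p. dist p m < \<rho> \<longrightarrow> b p = 0) \<Longrightarrow>
    (1 + \<rho>) ^ l * (japanese \<zeta> ^ k * norm (LINT p|lborel. osc_integrand b (wigner \<gamma> f) m \<zeta> p)) \<le> C"
    using osc_bound[OF b schwartz_wigner[OF schwartz_dual f]] by blast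
  have "japanese (snd z - snd w, fst w - fst z) = japanese (z - w)" for z w :: "'a \<times> 'a"
    by (simp add: japanese_def norm_prod_def norm_minus_commute add.commute)
  with C(2) have "(1 + \<rho>) ^ l * (japanese (z - w) ^ k * norm (weyl_form b (tf_shift w f) (tf_shift z \<gamma>))) \<le> C"
    if "\<rho> \<ge> 0" "\<forall>p. dist p ((z + w) /\<^sub>R 2) < \<rho> \<longrightarrow> b p = 0" for z w \<rho>
    unfolding weyl_form_tf_shift[OF schwartz_dual f] using that by metis
  then show ?thesis using C(1) by blast
qed

lemma rapid_weyl_form:
  assumes b: "b \<in> S00" and f: "f \<in> schwartz"
  shows "rapid (\<lambda>z. weyl_form b f (tf_shift z \<gamma>))"
  unfolding rapid_def
proof
  fix k
  obtain C where C: "C \<ge> 0" "\<And>z w \<rho>. \<rho> \<ge> 0 \<Longrightarrow> (\<forall>p. dist p ((z + w) /\<^sub>R 2) < \<rho> \<longrightarrow> b p = 0) \<Longrightarrow>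
    (1 + \<rho>) ^ 0 * (japanese (z - w) ^ k * norm (weyl_form b (tf_shift w f) (tf_shift z \<gamma>))) \<le> C"
    using weyl_form_bound[OF b f, of 0 k] by blast
  have "norm (weyl_form b f (tf_shift z \<gamma>)) \<le> C / japanese z ^ k" for z
    using C(2)[of 0 z 0] by (simp add: field_simps)
  then show "\<exists>C. \<forall>z\<in>\<Lambda>. norm (weyl_form b f (tf_shift z \<gamma>)) \<le> C / japanese z ^ k" by blast
qed

text \<open>The test function is expanded with synthesis window \<open>\<gamma>\<close> and the
  tempered form applied term by term; reading the result as a pairing exhibits a Schwartz witness
  for the definite description. Uniqueness is weak equality.\<close>

lemma weyl_eq:
  assumes b: "b \<in> S00" and f: "f \<in> schwartz"
  shows "weyl b f = (\<lambda>x. of_real (1 / (2 * pi) ^ DIM('a)) * synth \<phi> (\<lambda>z. weyl_form b f (tf_shift z \<gamma>)) x)"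
proof -
  let ?c = "complex_of_real (1 / (2 * pi) ^ DIM('a))"
  let ?l = "\<lambda>z. weyl_form b f (tf_shift z \<gamma>)"
  let ?h = "\<lambda>x. ?c * synth \<phi> ?l x"
  note r = rapid_weyl_form[OF b f]
  have h: "?h \<in> schwartz" by (intro schwartz_cmult schwartz_synth window r)
  have eq: "dist_of_fun ?h g = weyl_dist (dist_of_fun b) f g" if g: "g \<in> schwartz" for g
  proof -
    have "weyl_form b f g = weyl_form b f (synth \<gamma> (\<lambda>z. ip g (tf_shift z \<phi>)))"
      using dual_window[OF g] by (simp add: frame_op_def)
    also have "\<dots> = (\<Sum>\<^sub>\<infinity>z\<in>\<Lambda>. cnj (ip g (tf_shift z \<phi>)) * ?l z)"
      by (rule tempered_synth[OF schwartz_dual rapid_stft[OF g window] tempered_weyl_form[OF b f]])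
    also have "\<dots> = (\<Sum>\<^sub>\<infinity>z\<in>\<Lambda>. ?l z * ip (tf_shift z \<phi>) g)"
      by (simp add: ip_cnj[of "tf_shift _ \<phi>" g] mult.commute)
    also have "\<dots> = ip (synth \<phi> ?l) g" by (rule ip_synth[OF window r g, symmetric])
    finally show ?thesis by (simp only: weyl_dist_eq ip_cmult_left)
  qed
  show ?thesis
    unfolding weyl_def
  proof (rule the_equality)
    show "?h \<in> schwartz \<and> (\<forall>g\<in>schwartz. dist_of_fun ?h g = weyl_dist (dist_of_fun b) f g)"
      using h eq by blast
  next
    fix h' assume "h' \<in> schwartz \<and> (\<forall>g\<in>schwartz. dist_of_fun h' g = weyl_dist (dist_of_fun b) f g)"
    then show "h' = ?h" using h eq by (intro schwartz_weak_eq) auto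
  qed
qed

text \<open>The expansion in \<open>weyl_eq\<close> synthesizes with \<open>\<phi>\<close>, the dual
  window being confined to the coefficients. Hence the samples of the transform with window
  \<open>\<phi>\<close> on the lattice determine those of the image.\<close>

lemma stft_weyl_ext:
  assumes a: "a \<in> S00" and u: "u \<in> tempered"
  defines "b \<equiv> \<lambda>z. cnj (a z)"
  shows "stft \<phi> (weyl_ext a u) w = of_real (1 / (2 * pi) ^ DIM('a)) *
      (\<Sum>\<^sub>\<infinity>z\<in>\<Lambda>. cnj (weyl_form b (tf_shift w \<phi>) (tf_shift z \<gamma>)) * stft \<phi> u z)"
proof -
  have b: "b \<in> S00" unfolding b_def by (rule S00_cnj[OF a])
  note f = schwartz_tf_shift[OF window, of w]
  have "stft \<phi> (weyl_ext a u) w = u (weyl b (tf_shift w \<phi>))" by (simp add: stft_def weyl_ext_def b_def)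
  also have "\<dots> = cnj (of_real (1 / (2 * pi) ^ DIM('a))) * u (synth \<phi> (\<lambda>z. weyl_form b (tf_shift w \<phi>) (tf_shift z \<gamma>)))"
    unfolding weyl_eq[OF b f] by (rule tempered_cmult[OF u schwartz_synth[OF window rapid_weyl_form[OF b f]]])
  finally show ?thesis
    by (simp only: tempered_synth[OF window rapid_weyl_form[OF b f] u] stft_def complex_cnj_complex_of_real)
qed

text \<open>Reduces decay on a cone to a bound for single matrix entries: after translating the
  lattice by \<open>w\<close>, the sum over \<open>z\<close> is the fixed number
  \<open>s\<close>.\<close>

lemma stft_weyl_ext_bound:
  assumes a: "a \<in> S00" and u: "u \<in> tempered"
    and bound: "\<And>w z. w \<in> \<Lambda> \<inter> \<Gamma> \<Longrightarrow> z \<in> \<Lambda> \<Longrightarrow>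
      japanese w ^ N * (norm (weyl_form (\<lambda>z. cnj (a z)) (tf_shift w \<phi>) (tf_shift z \<gamma>)) * norm (stft \<phi> u z)) \<le> C / japanese (z - w) ^ K"
  shows "bdd_above ((\<lambda>w. japanese w ^ N * norm (stft \<phi> (weyl_ext a u) w)) ` (\<Lambda> \<inter> \<Gamma>))"
proof -
  let ?c = "1 / (2 * pi) ^ DIM('a)"
  let ?t = "\<lambda>w z. cnj (weyl_form (\<lambda>z. cnj (a z)) (tf_shift w \<phi>) (tf_shift z \<gamma>)) * stft \<phi> u z"
  define s where "s = (\<Sum>\<^sub>\<infinity>z\<in>\<Lambda>. 1 / japanese z ^ K)"
  have "japanese w ^ N * norm (stft \<phi> (weyl_ext a u) w) \<le> ?c * (C * s)" if w: "w \<in> \<Lambda> \<inter> \<Gamma>" for w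
  proof -
    have bij: "bij_betw (\<lambda>z. z - w) \<Lambda> \<Lambda>" using lattice_bij[OF lattice_minus, of w] w by simp
    have sh: "(\<lambda>z. C * (1 / japanese (z - w) ^ K)) summable_on \<Lambda>"
      using summable_on_reindex_bij_betw[OF bij, of "\<lambda>z. 1 / japanese z ^ K"] lattice_summable
      by (intro summable_on_cmult_right) simp
    have t: "japanese w ^ N * norm (?t w z) \<le> C * (1 / japanese (z - w) ^ K)" if "z \<in> \<Lambda>" for z
      using bound[OF w that] by (simp add: norm_mult)
    have jt: "(\<lambda>z. japanese w ^ N * norm (?t w z)) summable_on \<Lambda>"
      by (rule summable_on_comparison_test[OF sh]) (use t in auto)
    then have ts: "(\<lambda>z. norm (?t w z)) summable_on \<Lambda>"
      using summable_on_cmult_right'[of "japanese w ^ N" "\<lambda>z. norm (?t w z)" \<Lambda>] by simp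
    have "japanese w ^ N * norm (stft \<phi> (weyl_ext a u) w) = ?c * (japanese w ^ N * norm (\<Sum>\<^sub>\<infinity>z\<in>\<Lambda>. ?t w z))"
      unfolding stft_weyl_ext[OF a u] norm_mult norm_of_real by simp
    also have "\<dots> \<le> ?c * (C * s)"
    proof (intro mult_left_mono)
      have "japanese w ^ N * norm (\<Sum>\<^sub>\<infinity>z\<in>\<Lambda>. ?t w z) \<le> japanese w ^ N * (\<Sum>\<^sub>\<infinity>z\<in>\<Lambda>. norm (?t w z))"
        by (intro mult_left_mono norm_infsum_bound ts) auto
      also have "japanese w ^ N * (\<Sum>\<^sub>\<infinity>z\<in>\<Lambda>. norm (?t w z)) = (\<Sum>\<^sub>\<infinity>z\<in>\<Lambda>. japanese w ^ N * norm (?t w z))"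
        by (rule infsum_cmult_right'[symmetric])
      also have "\<dots> \<le> (\<Sum>\<^sub>\<infinity>z\<in>\<Lambda>. C * (1 / japanese (z - w) ^ K))"
        by (rule infsum_mono[OF jt sh t])
      also have "\<dots> = C * (\<Sum>\<^sub>\<infinity>z\<in>\<Lambda>. 1 / japanese (z - w) ^ K)"
        by (rule infsum_cmult_right')
      also have "(\<Sum>\<^sub>\<infinity>z\<in>\<Lambda>. 1 / japanese (z - w) ^ K) = s"
        unfolding s_def using infsum_reindex_bij_betw[OF bij, of "\<lambda>z. 1 / japanese z ^ K"] by simp
      finally show "japanese w ^ N * norm (\<Sum>\<^sub>\<infinity>z\<in>\<Lambda>. ?t w z) \<le> C * s" .
    qed simp
    finally show ?thesis .
  qed
  then show ?thesis by (rule bdd_aboveI2)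
qed

text \<open>By Peetre, the growth \<open>japanese z ^ M\<close> of the transform of \<open>u\<close>
  costs \<open>japanese w ^ M\<close> and \<open>japanese (z - w) ^ M\<close>. The
  \<open>N + M\<close> powers of \<open>japanese w\<close> are then each traded for
  \<open>E * (1 + \<rho>) * japanese (z - w)\<close>. With \<open>K\<close> powers left for
  summability this explains the exponents \<open>N + M\<close> and
  \<open>N + M + M + K\<close>.\<close>

lemma weyl_off_diagonal:
  assumes a: "a \<in> S00" and u: "u \<in> tempered" and E: "0 \<le> E"
  shows "\<exists>C. \<forall>w z. \<forall>\<rho>\<ge>0. (\<forall>p. dist p ((z + w) /\<^sub>R 2) < \<rho> \<longrightarrow> a p = 0) \<longrightarrow>
     japanese w \<le> E * (1 + \<rho>) * japanese (z - w) \<longrightarrow>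
     japanese w ^ N * (norm (weyl_form (\<lambda>z. cnj (a z)) (tf_shift w \<phi>) (tf_shift z \<gamma>)) * norm (stft \<phi> u z)) \<le> C / japanese (z - w) ^ K"
proof -
  let ?L = "\<lambda>w z. norm (weyl_form (\<lambda>z. cnj (a z)) (tf_shift w \<phi>) (tf_shift z \<gamma>))"
  obtain D M where D: "0 \<le> D" "\<And>z. norm (stft \<phi> u z) \<le> D * japanese z ^ M"
    using tempered_tf_shift_bound[OF u window] by (auto simp: stft_def)
  obtain C where C: "C \<ge> 0" "\<And>z w \<rho>. \<rho> \<ge> 0 \<Longrightarrow> (\<forall>p. dist p ((z + w) /\<^sub>R 2) < \<rho> \<longrightarrow> cnj (a p) = 0) \<Longrightarrow>
    (1 + \<rho>) ^ (N + M) * (japanese (z - w) ^ (N + M + M + K) * ?L w z) \<le> C"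
    using weyl_form_bound[OF S00_cnj[OF a] window, of "N + M" "N + M + M + K"] by blast
  have "japanese w ^ N * (?L w z * norm (stft \<phi> u z)) \<le> (D * 2 ^ M * E ^ (N + M) * C) / japanese (z - w) ^ K"
    if \<rho>: "\<rho> \<ge> 0" and van: "\<forall>p. dist p ((z + w) /\<^sub>R 2) < \<rho> \<longrightarrow> a p = 0"
      and far: "japanese w \<le> E * (1 + \<rho>) * japanese (z - w)" for w z \<rho>
  proof -
    let ?j = "japanese (z - w)"
    have "norm (stft \<phi> u z) \<le> D * (2 ^ M * japanese w ^ M * ?j ^ M)"
      using D(2)[of z] mult_left_mono[OF japanese_diff_power[of z M w] D(1)] by linarith
    then have "japanese w ^ N * (?L w z * norm (stft \<phi> u z)) \<le> japanese w ^ N * (?L w z * (D * (2 ^ M * japanese w ^ M * ?j ^ M)))"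
      by (intro mult_left_mono) auto
    also have "\<dots> = (D * 2 ^ M * ?L w z * ?j ^ M) * japanese w ^ (N + M)"
      by (simp add: power_add mult_ac)
    also have "\<dots> \<le> (D * 2 ^ M * ?L w z * ?j ^ M) * (E * (1 + \<rho>) * ?j) ^ (N + M)"
      using far D(1) by (intro mult_left_mono power_mono) auto
    also have "\<dots> = (D * 2 ^ M * E ^ (N + M)) * ((1 + \<rho>) ^ (N + M) * (?j ^ (N + M + M + K) * ?L w z)) / ?j ^ K"
      by (simp add: power_add power_mult_distrib)
    also have "\<dots> \<le> (D * 2 ^ M * E ^ (N + M)) * C / ?j ^ K"
      using \<rho> van D(1) E by (intro divide_right_mono mult_left_mono C(2)) auto
    finally show ?thesis by simp
  qed
  then show ?thesis by blast
qed

end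

text \<open>By homogeneity everything is read off the unit sphere. The new cone is so narrow that a
  perturbation of \<open>w\<close> of relative size \<open>\<delta>\<close> stays inside the old
  one.\<close>

lemma cone_neighbourhood:
  fixes z0 :: "'b::euclidean_space"
  assumes \<Gamma>: "open_conic \<Gamma>" "z0 \<in> \<Gamma>"
  obtains \<Gamma>' \<delta> where "open_conic \<Gamma>'" "z0 \<in> \<Gamma>'" "0 < \<delta>" "\<delta> < 1"
    "\<And>w p. w \<in> \<Gamma>' \<Longrightarrow> norm (p - w) < \<delta> * norm w \<Longrightarrow> p \<in> \<Gamma>"
proof -
  have z0: "z0 \<noteq> 0" using \<Gamma> by (auto simp: open_conic_def)
  define e where "e = z0 /\<^sub>R norm z0"
  have "e \<in> \<Gamma>" unfolding e_def using \<Gamma> z0 by (auto simp: open_conic_def)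
  then obtain r where r: "0 < r" "ball e r \<subseteq> \<Gamma>"
    using \<Gamma> by (auto simp: open_conic_def open_contains_ball)
  \<comment> \<open>Half of \<open>r\<close> is for the direction of \<open>w\<close>, the other
    half for the relative perturbation. The cap 1/2 secures \<open>\<delta> < 1\<close>, on which
    later constants rely.\<close>
  define \<delta> where "\<delta> = min (r / 2) (1 / 2)"
  have \<delta>: "0 < \<delta>" "\<delta> < 1" "2 * \<delta> \<le> r" using r by (auto simp: \<delta>_def)
  define \<Gamma>' where "\<Gamma>' = (- {0}) \<inter> (\<lambda>w. w /\<^sub>R norm w) -` ball e \<delta>"
  have "continuous_on (- {0}) (\<lambda>w::'b. w /\<^sub>R norm w)" by (intro continuous_intros) auto
  then have "open \<Gamma>'" unfolding \<Gamma>'_def by (rule continuous_open_preimage) auto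
  moreover have "(t *\<^sub>R x) /\<^sub>R norm (t *\<^sub>R x) = x /\<^sub>R norm x" if "0 < t" for t and x :: 'b
  proof -
    have "inverse (t * norm x) * t = inverse (norm x)" using that by (simp add: field_simps)
    then show ?thesis using that by (simp add: mult.commute)
  qed
  ultimately have 1: "open_conic \<Gamma>'"
    unfolding open_conic_def \<Gamma>'_def by (auto simp del: norm_scaleR scaleR_scaleR)
  have 2: "z0 \<in> \<Gamma>'" using z0 \<delta> by (simp add: \<Gamma>'_def e_def)
  have 3: "p \<in> \<Gamma>" if w: "w \<in> \<Gamma>'" and p: "norm (p - w) < \<delta> * norm w" for w p
  proof -
    have w0: "0 < norm w" using w by (auto simp: \<Gamma>'_def)
    have "norm (p /\<^sub>R norm w - w /\<^sub>R norm w) = norm (p - w) / norm w"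
      by (simp add: scaleR_right_diff_distrib[symmetric] divide_inverse mult.commute)
    also have "\<dots> < \<delta>" using p w0 by (simp add: divide_less_eq)
    finally have "dist (p /\<^sub>R norm w) (w /\<^sub>R norm w) < \<delta>" by (simp add: dist_norm)
    moreover have "dist (w /\<^sub>R norm w) e < \<delta>" using w by (simp add: \<Gamma>'_def dist_commute)
    ultimately have "dist (p /\<^sub>R norm w) e < r"
      using dist_triangle[of "p /\<^sub>R norm w" e "w /\<^sub>R norm w"] \<delta> by linarith
    then have "p /\<^sub>R norm w \<in> \<Gamma>" using r(2) by (auto simp: dist_commute)
    then have "norm w *\<^sub>R (p /\<^sub>R norm w) \<in> \<Gamma>" using \<Gamma> w0 unfolding open_conic_def by blast
    then show ?thesis using w0 by simp
  qed
  show ?thesis by (rule that[OF 1 2 \<delta>(1,2) 3])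
qed

lemma japanese_le_far:
  assumes \<delta>: "0 < \<delta>" "\<delta> < 1" and far: "\<not> norm (z - w) < \<delta> * norm w"
  shows "japanese w \<le> (1 / \<delta>) * japanese (z - w)"
proof -
  have "\<delta> * norm w \<le> norm (z - w)" using far by simp
  then have "(\<delta> * norm w)\<^sup>2 \<le> (norm (z - w))\<^sup>2" by (rule power_mono) (use \<delta> in auto)
  moreover have "\<delta>\<^sup>2 \<le> 1" using \<delta> by (simp add: power_le_one)
  ultimately have "\<delta>\<^sup>2 * (1 + (norm w)\<^sup>2) \<le> 1 + (norm (z - w))\<^sup>2" by (simp add: power_mult_distrib distrib_left)
  then have "sqrt (\<delta>\<^sup>2 * (1 + (norm w)\<^sup>2)) \<le> japanese (z - w)"
    unfolding japanese_def by (rule real_sqrt_le_mono)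
  then have "\<delta> * japanese w \<le> japanese (z - w)"
    using \<delta> by (simp add: japanese_def real_sqrt_mult)
  then show ?thesis using \<delta> by (simp add: field_simps)
qed

section \<open>Decay of the transform of the image in cones\<close>

context tf_frame
begin

text \<open>For \<open>z\<close> close to \<open>w\<close> relative to its size, \<open>z\<close>
  lies in the larger cone, and the weight moves from \<open>w\<close> to \<open>z\<close>, where the
  transform of \<open>u\<close> decays. For the other \<open>z\<close>, \<open>japanese w\<close> is
  at most a multiple of \<open>japanese (z - w)\<close>, and off-diagonal decay with
  \<open>\<rho> = 0\<close> suffices.\<close>

lemma weyl_ext_decay_cone:
  assumes a: "a \<in> S00" and u: "u \<in> tempered" and \<Gamma>: "open_conic \<Gamma>" "z0 \<in> \<Gamma>"
    and dec: "\<And>N. bdd_above ((\<lambda>z. japanese z ^ N * norm (stft \<phi> u z)) ` (\<Lambda> \<inter> \<Gamma>))"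
  shows "\<exists>\<Gamma>'. open_conic \<Gamma>' \<and> z0 \<in> \<Gamma>' \<and>
    (\<forall>N. bdd_above ((\<lambda>z. japanese z ^ N * norm (stft \<phi> (weyl_ext a u) z)) ` (\<Lambda> \<inter> \<Gamma>')))"
proof -
  let ?L = "\<lambda>w z. norm (weyl_form (\<lambda>z. cnj (a z)) (tf_shift w \<phi>) (tf_shift z \<gamma>))"
  obtain \<Gamma>' \<delta> where \<Gamma>': "open_conic \<Gamma>'" "z0 \<in> \<Gamma>'" and \<delta>: "0 < \<delta>" "\<delta> < 1"
    and near: "\<And>w p. w \<in> \<Gamma>' \<Longrightarrow> norm (p - w) < \<delta> * norm w \<Longrightarrow> p \<in> \<Gamma>"
    using cone_neighbourhood[OF \<Gamma>] by blast
  have "bdd_above ((\<lambda>z. japanese z ^ N * norm (stft \<phi> (weyl_ext a u) z)) ` (\<Lambda> \<inter> \<Gamma>'))" for N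
  proof -
    have "0 \<le> 1 / \<delta>" using \<delta> by simp
    from weyl_off_diagonal[OF a u this, of N]
    obtain C1 where C1: "\<And>w z \<rho>. \<rho> \<ge> 0 \<Longrightarrow> (\<forall>p. dist p ((z + w) /\<^sub>R 2) < \<rho> \<longrightarrow> a p = 0) \<Longrightarrow>
     japanese w \<le> (1 / \<delta>) * (1 + \<rho>) * japanese (z - w) \<Longrightarrow>
     japanese w ^ N * (?L w z * norm (stft \<phi> u z)) \<le> C1 / japanese (z - w) ^ K"
      by blast
    obtain D where D: "\<And>z. z \<in> \<Lambda> \<inter> \<Gamma> \<Longrightarrow> japanese z ^ N * norm (stft \<phi> u z) \<le> D"
      using dec[of N] by (auto simp: bdd_above_def)
    obtain C2 where C2: "C2 \<ge> 0" "\<And>z w \<rho>. \<rho> \<ge> 0 \<Longrightarrow> (\<forall>p. dist p ((z + w) /\<^sub>R 2) < \<rho> \<longrightarrow> cnj (a p) = 0) \<Longrightarrow>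
      (1 + \<rho>) ^ 0 * (japanese (z - w) ^ (N + K) * ?L w z) \<le> C2"
      using weyl_form_bound[OF S00_cnj[OF a] window, of 0 "N + K"] by blast
    have "japanese w ^ N * (?L w z * norm (stft \<phi> u z)) \<le> max C1 (2 ^ N * C2 * D) / japanese (z - w) ^ K"
      if w: "w \<in> \<Lambda> \<inter> \<Gamma>'" and z: "z \<in> \<Lambda>" for w z
    proof (cases "norm (z - w) < \<delta> * norm w")
      case True
      then have "z \<in> \<Lambda> \<inter> \<Gamma>" using near[of w z] w z by auto
      note Dz = D[OF this]
      have D0: "0 \<le> D" by (rule order_trans[OF _ Dz]) simp
      have Lz: "japanese (z - w) ^ (N + K) * ?L w z \<le> C2" using C2(2)[of 0 z w] by simp
      have "japanese w ^ N \<le> 2 ^ N * japanese z ^ N * japanese (z - w) ^ N"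
        using japanese_diff_power[of w N z] by (simp add: japanese_minus_commute[of w z])
      then have "japanese w ^ N * (?L w z * norm (stft \<phi> u z))
          \<le> (2 ^ N * japanese z ^ N * japanese (z - w) ^ N) * (?L w z * norm (stft \<phi> u z))"
        by (rule mult_right_mono) simp
      also have "\<dots> = 2 ^ N * ((japanese (z - w) ^ (N + K) * ?L w z) * (japanese z ^ N * norm (stft \<phi> u z))) / japanese (z - w) ^ K"
        by (simp add: power_add)
      also have "\<dots> \<le> 2 ^ N * (C2 * D) / japanese (z - w) ^ K"
        using C2(1) by (intro divide_right_mono mult_left_mono mult_mono Lz Dz) auto
      also have "\<dots> \<le> max C1 (2 ^ N * C2 * D) / japanese (z - w) ^ K"
        by (intro divide_right_mono) auto
      finally show ?thesis .
    next
      case False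
      have "japanese w ^ N * (?L w z * norm (stft \<phi> u z)) \<le> C1 / japanese (z - w) ^ K"
        using japanese_le_far[OF \<delta> False] by (intro C1[of 0]) auto
      also have "\<dots> \<le> max C1 (2 ^ N * C2 * D) / japanese (z - w) ^ K"
        by (intro divide_right_mono) auto
      finally show ?thesis .
    qed
    then show ?thesis by (rule stft_weyl_ext_bound[OF a u])
  qed
  with \<Gamma>' show ?thesis by blast
qed

text \<open>Here \<open>u\<close> contributes no decay, so every pair must satisfy the trading
  inequality of \<open>weyl_off_diagonal\<close>. Distant \<open>z\<close> and bounded
  \<open>w\<close> satisfy it with \<open>\<rho> = 0\<close>. For \<open>z\<close> near a large
  \<open>w\<close>, the symbol vanishes on a ball about the midpoint whose radius is proportional to
  \<open>norm w\<close>.\<close>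

lemma weyl_ext_decay_conesupp:
  assumes a: "a \<in> S00" and u: "u \<in> tempered" and \<Gamma>: "open_conic \<Gamma>" "z0 \<in> \<Gamma>"
    and cpt: "compact (closure (supp a \<inter> \<Gamma>))"
  shows "\<exists>\<Gamma>'. open_conic \<Gamma>' \<and> z0 \<in> \<Gamma>' \<and>
    (\<forall>N. bdd_above ((\<lambda>z. japanese z ^ N * norm (stft \<phi> (weyl_ext a u) z)) ` (\<Lambda> \<inter> \<Gamma>')))"
proof -
  let ?L = "\<lambda>w z. norm (weyl_form (\<lambda>z. cnj (a z)) (tf_shift w \<phi>) (tf_shift z \<gamma>))"
  obtain \<Gamma>' \<delta> where \<Gamma>': "open_conic \<Gamma>'" "z0 \<in> \<Gamma>'" and \<delta>: "0 < \<delta>" "\<delta> < 1"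
    and near: "\<And>w p. w \<in> \<Gamma>' \<Longrightarrow> norm (p - w) < \<delta> * norm w \<Longrightarrow> p \<in> \<Gamma>"
    using cone_neighbourhood[OF \<Gamma>] by blast
  have "bounded (supp a \<inter> \<Gamma>)"
    using compact_imp_bounded[OF cpt] closure_subset bounded_subset by blast
  then obtain T where T: "0 < T" "\<And>p. p \<in> supp a \<inter> \<Gamma> \<Longrightarrow> norm p \<le> T"
    by (auto simp: bounded_pos)
  \<comment> \<open>If \<open>norm w \<ge> T1\<close>, points within
    \<open>\<delta> * norm w\<close> of \<open>w\<close> have norm greater than \<open>T\<close>,
    hence lie beyond the bounded part of the support in the cone.\<close>
  define T1 where "T1 = T / (1 - \<delta>)"
  have T1: "0 < T1" using T \<delta> by (simp add: T1_def)
  \<comment> \<open>Both factors are at least 1, so \<open>E\<close> dominates each: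
    \<open>1 + T1\<close> serves bounded \<open>w\<close>, and \<open>2 / \<delta>\<close> the two
    other cases.\<close>
  define E where "E = (1 + T1) * (2 / \<delta>)"
  have E0: "0 \<le> E" using T1 \<delta> by (simp add: E_def)
  have E1: "1 + T1 \<le> E" "2 / \<delta> \<le> E"
  proof -
    have d2: "1 \<le> 2 / \<delta>" using \<delta> by (simp add: field_simps)
    have "(1 + T1) * 1 \<le> (1 + T1) * (2 / \<delta>)" using T1 by (intro mult_left_mono d2) auto
    then show "1 + T1 \<le> E" by (simp add: E_def)
    have "1 * (2 / \<delta>) \<le> (1 + T1) * (2 / \<delta>)" using T1 \<delta> by (intro mult_right_mono) auto
    then show "2 / \<delta> \<le> E" by (simp add: E_def)
  qed
  have \<rho>: "\<exists>\<rho>\<ge>0. (\<forall>p. dist p ((z + w) /\<^sub>R 2) < \<rho> \<longrightarrow> a p = 0) \<and> japanese w \<le> E * (1 + \<rho>) * japanese (z - w)"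
    if w: "w \<in> \<Gamma>'" for w z
  proof (cases "norm (z - w) < \<delta> * norm w")
    case False
    have "japanese w \<le> (1 / \<delta>) * japanese (z - w)" by (rule japanese_le_far[OF \<delta> False])
    also have "\<dots> \<le> E * japanese (z - w)"
      using E1 \<delta> by (intro mult_right_mono) (auto intro: order_trans[OF _ E1(2)] simp: field_simps)
    finally show ?thesis by (intro exI[of _ 0]) auto
  next
    case True
    show ?thesis
    proof (cases "norm w \<le> T1")
      case True
      have "japanese w \<le> 1 + T1" using japanese_le[of w] True by simp
      also have "\<dots> \<le> E * 1" using E1 by simp
      also have "\<dots> \<le> E * japanese (z - w)" by (intro mult_left_mono japanese_ge_1 E0)
      finally show ?thesis by (intro exI[of _ 0]) auto
    next
      case large: False
      \<comment> \<open>The midpoint is within \<open>\<delta> * norm w / 2\<close> of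
        \<open>w\<close>; a ball of that same radius about it therefore stays within
        \<open>\<delta> * norm w\<close> of \<open>w\<close>.\<close>
      define \<rho> where "\<rho> = \<delta> * norm w / 2"
      have \<rho>0: "0 \<le> \<rho>" using \<delta> by (simp add: \<rho>_def)
      have "a p = 0" if p: "dist p ((z + w) /\<^sub>R 2) < \<rho>" for p
      proof (rule ccontr)
        assume "a p \<noteq> 0"
        then have supp: "p \<in> supp a" using closure_subset[of "{x. a x \<noteq> 0}"] by (auto simp: supp_def)
        have "(z + w) /\<^sub>R 2 - w = (z - w) /\<^sub>R 2"
        proof -
          have "(z - w) /\<^sub>R 2 = (z + w) /\<^sub>R 2 - (w + w) /\<^sub>R 2"
            unfolding scaleR_right_diff_distrib[symmetric] by simp
          moreover have "(w + w) /\<^sub>R 2 = w" using scaleR_half_double[of w] by simp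
          ultimately show ?thesis by simp
        qed
        then have "dist ((z + w) /\<^sub>R 2) w = norm ((z - w) /\<^sub>R 2)" by (simp only: dist_norm)
        then have "norm (p - w) \<le> dist p ((z + w) /\<^sub>R 2) + norm ((z - w) /\<^sub>R 2)"
          using dist_triangle[of p w "(z + w) /\<^sub>R 2"] by (simp only: dist_norm[of p w])
        also have "\<dots> < \<delta> * norm w" using p True by (simp add: \<rho>_def)
        finally have pw: "norm (p - w) < \<delta> * norm w" .
        from near[OF w this] T(2) supp have "norm p \<le> T" by blast
        moreover have "norm w - norm (p - w) \<le> norm p"
          using norm_triangle_ineq2[of w "w - p"] by (simp add: norm_minus_commute)
        ultimately have "(1 - \<delta>) * norm w < T" using pw by (simp add: algebra_simps)
        then have "norm w < T1" using \<delta> by (simp add: T1_def field_simps)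
        with large show False by simp
      qed
      moreover have "japanese w \<le> E * (1 + \<rho>) * japanese (z - w)"
      proof -
        have "(2 / \<delta>) * (1 + \<rho>) = 2 / \<delta> + norm w" using \<delta> by (simp add: \<rho>_def field_simps)
        moreover have "1 \<le> 2 / \<delta>" using \<delta> by (simp add: field_simps)
        ultimately have "japanese w \<le> (2 / \<delta>) * (1 + \<rho>)"
          using japanese_le[of w] by linarith
        also have "\<dots> \<le> E * (1 + \<rho>)" using \<rho>0 by (intro mult_right_mono E1) auto
        also have "\<dots> = E * (1 + \<rho>) * 1" by simp
        also have "\<dots> \<le> E * (1 + \<rho>) * japanese (z - w)"
          using E0 \<rho>0 by (intro mult_left_mono japanese_ge_1) auto
        finally show ?thesis .
      qed
      ultimately show ?thesis using \<rho>0 by blast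
    qed
  qed
  have "bdd_above ((\<lambda>z. japanese z ^ N * norm (stft \<phi> (weyl_ext a u) z)) ` (\<Lambda> \<inter> \<Gamma>'))" for N
  proof -
    obtain C where C: "\<And>w z \<rho>. \<rho> \<ge> 0 \<Longrightarrow> (\<forall>p. dist p ((z + w) /\<^sub>R 2) < \<rho> \<longrightarrow> a p = 0) \<Longrightarrow>
     japanese w \<le> E * (1 + \<rho>) * japanese (z - w) \<Longrightarrow>
     japanese w ^ N * (?L w z * norm (stft \<phi> u z)) \<le> C / japanese (z - w) ^ K"
      using weyl_off_diagonal[OF a u E0, of N] by blast
    have "japanese w ^ N * (?L w z * norm (stft \<phi> u z)) \<le> C / japanese (z - w) ^ K"
      if "w \<in> \<Lambda> \<inter> \<Gamma>'" for w z
      using \<rho>[of w z] that C by blast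
    then show ?thesis by (rule stft_weyl_ext_bound[OF a u])
  qed
  with \<Gamma>' show ?thesis by blast
qed

end

section \<open>The Gabor lattice\<close>

lemma summable_on_int_inverse_square:
  fixes \<alpha> :: real
  assumes "\<alpha> > 0"
  shows "(\<lambda>k::int. 1 / (1 + (\<alpha> * of_int k)\<^sup>2)) summable_on UNIV"
proof -
  have "summable (\<lambda>n. 1 / (1 + (\<alpha> * real n)\<^sup>2))"
  proof (rule summable_comparison_test'[of "\<lambda>n. 1 / \<alpha>\<^sup>2 * (1 / real n ^ 2)" 1])
    show "summable (\<lambda>n. 1 / \<alpha>\<^sup>2 * (1 / real n ^ 2))"
      using inverse_power_summable[of 2, where 'a = real] by (intro summable_mult) (simp add: divide_inverse)
    show "norm (1 / (1 + (\<alpha> * real n)\<^sup>2)) \<le> 1 / \<alpha>\<^sup>2 * (1 / real n ^ 2)" if "n \<ge> 1" for n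
    proof -
      have "1 / (1 + (\<alpha> * real n)\<^sup>2) \<le> 1 / (\<alpha> * real n)\<^sup>2"
        using that assms by (intro divide_left_mono mult_pos_pos) (auto intro: add_pos_nonneg)
      then show ?thesis by (simp add: power_mult_distrib)
    qed
  qed
  then have nat: "(\<lambda>n. 1 / (1 + (\<alpha> * real n)\<^sup>2)) summable_on UNIV"
    by (rule summable_nonneg_imp_summable_on) simp
  have "(\<lambda>k::int. 1 / (1 + (\<alpha> * of_int k)\<^sup>2)) summable_on range int"
    using nat by (subst summable_on_reindex) (auto simp: o_def)
  moreover have "(\<lambda>k::int. 1 / (1 + (\<alpha> * of_int k)\<^sup>2)) summable_on range (\<lambda>n. - int n)"
    using nat by (subst summable_on_reindex) (auto simp: o_def inj_def)
  ultimately have "(\<lambda>k::int. 1 / (1 + (\<alpha> * of_int k)\<^sup>2)) summable_on (range int \<union> range (\<lambda>n. - int n))"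
    by (rule summable_on_union)
  moreover have "range int \<union> range (\<lambda>n. - int n) = UNIV"
  proof -
    have "k \<in> range int \<union> range (\<lambda>n. - int n)" for k
      by (cases k rule: int_cases2) auto
    then show ?thesis by blast
  qed
  ultimately show ?thesis by simp
qed

text \<open>Absolute summability in the sense of \<open>Infinite_Set_Sum\<close> is inherited by
  products over \<open>PiE\<close>, which over the whole index type is the set of all
  functions.\<close>

lemma summable_on_prod_functions:
  fixes \<alpha> :: real
  assumes "\<alpha> > 0"
  shows "(\<lambda>k::'n::finite \<Rightarrow> int. \<Prod>i\<in>UNIV. 1 / (1 + (\<alpha> * of_int (k i))\<^sup>2)) summable_on UNIV"
proof -
  have "Infinite_Set_Sum.abs_summable_on (\<lambda>k::int. 1 / (1 + (\<alpha> * of_int k)\<^sup>2)) UNIV"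
    using summable_on_int_inverse_square[OF assms] by (simp add: abs_summable_equivalent[symmetric])
  then have "Infinite_Set_Sum.abs_summable_on
      (\<lambda>k. \<Prod>i\<in>(UNIV :: 'n set). 1 / (1 + (\<alpha> * of_int (k i))\<^sup>2)) (PiE UNIV (\<lambda>_. UNIV))"
    by (intro abs_summable_on_prod_PiE) auto
  then show ?thesis
    by (simp add: abs_summable_equivalent[symmetric] abs_prod PiE_UNIV_domain)
qed

definition lattice_point :: "real \<Rightarrow> real \<Rightarrow> ('n \<Rightarrow> int) \<times> ('n \<Rightarrow> int) \<Rightarrow> (real ^ 'n) \<times> (real ^ 'n)" where
  "lattice_point \<alpha> \<beta> kl = ((\<chi> i. \<alpha> * of_int (fst kl i)), (\<chi> i. \<beta> * of_int (snd kl i)))"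

lemma gabor_lattice_eq:
  "(gabor_lattice \<alpha> \<beta> :: ((real ^ 'n) \<times> (real ^ 'n)) set) = range (lattice_point \<alpha> \<beta>)"
proof
  show "(gabor_lattice \<alpha> \<beta> :: ((real ^ 'n) \<times> (real ^ 'n)) set) \<subseteq> range (lattice_point \<alpha> \<beta>)"
  proof
    fix z :: "(real ^ 'n) \<times> (real ^ 'n)" assume "z \<in> gabor_lattice \<alpha> \<beta>"
    then obtain k l where "z = lattice_point \<alpha> \<beta> (k, l)"
      by (auto simp: gabor_lattice_def lattice_point_def)
    then show "z \<in> range (lattice_point \<alpha> \<beta>)" by (rule range_eqI)
  qed
qed (auto simp: gabor_lattice_def lattice_point_def)

lemma inj_lattice_point: "\<alpha> > 0 \<Longrightarrow> \<beta> > 0 \<Longrightarrow> inj (lattice_point \<alpha> \<beta>)"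
  by (rule injI) (auto simp: lattice_point_def vec_eq_iff prod_eq_iff fun_eq_iff)

text \<open>A lattice point has \<open>2 * CARD('n)\<close> coordinates, each of which consumes a
  factor \<open>(japanese z)^2\<close>; hence the exponent \<open>4 * CARD('n)\<close>.\<close>

lemma japanese_lattice_point:
  fixes kl :: "('n::finite \<Rightarrow> int) \<times> ('n \<Rightarrow> int)"
  shows "1 / japanese (lattice_point \<alpha> \<beta> kl) ^ (4 * CARD('n))
    \<le> (\<Prod>i\<in>UNIV. 1 / (1 + (\<alpha> * of_int (fst kl i))\<^sup>2)) * (\<Prod>i\<in>UNIV. 1 / (1 + (\<beta> * of_int (snd kl i))\<^sup>2))"
proof -
  let ?z = "lattice_point \<alpha> \<beta> kl"
  have j: "(japanese ?z)\<^sup>2 = 1 + (norm (fst ?z))\<^sup>2 + (norm (snd ?z))\<^sup>2"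
    by (simp add: japanese_def norm_prod_def)
  have c: "(v $ i)\<^sup>2 \<le> (norm v)\<^sup>2" for v :: "real ^ 'n" and i
    using component_le_norm_cart[of v i] by (simp add: abs_le_square_iff[symmetric])
  have 1: "1 + (\<alpha> * of_int (fst kl i))\<^sup>2 \<le> (japanese ?z)\<^sup>2" for i
  proof -
    have "(\<alpha> * of_int (fst kl i))\<^sup>2 = (fst ?z $ i)\<^sup>2" by (simp add: lattice_point_def)
    then show ?thesis using c[of "fst ?z" i] zero_le_power2[of "norm (snd ?z)"] unfolding j by linarith
  qed
  have 2: "1 + (\<beta> * of_int (snd kl i))\<^sup>2 \<le> (japanese ?z)\<^sup>2" for i
  proof -
    have "(\<beta> * of_int (snd kl i))\<^sup>2 = (snd ?z $ i)\<^sup>2" by (simp add: lattice_point_def)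
    then show ?thesis using c[of "snd ?z" i] zero_le_power2[of "norm (fst ?z)"] unfolding j by linarith
  qed
  have "(\<Prod>i\<in>(UNIV::'n set). 1 / (japanese ?z)\<^sup>2) \<le> (\<Prod>i\<in>UNIV. 1 / (1 + (\<alpha> * of_int (fst kl i))\<^sup>2))"
    using 1 by (intro prod_mono conjI divide_left_mono mult_pos_pos) (auto intro: add_pos_nonneg)
  moreover have "(\<Prod>i\<in>(UNIV::'n set). 1 / (japanese ?z)\<^sup>2) \<le> (\<Prod>i\<in>UNIV. 1 / (1 + (\<beta> * of_int (snd kl i))\<^sup>2))"
    using 2 by (intro prod_mono conjI divide_left_mono mult_pos_pos) (auto intro: add_pos_nonneg)
  ultimately have "(\<Prod>i\<in>(UNIV::'n set). 1 / (japanese ?z)\<^sup>2) * (\<Prod>i\<in>(UNIV::'n set). 1 / (japanese ?z)\<^sup>2)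
     \<le> (\<Prod>i\<in>UNIV. 1 / (1 + (\<alpha> * of_int (fst kl i))\<^sup>2)) * (\<Prod>i\<in>UNIV. 1 / (1 + (\<beta> * of_int (snd kl i))\<^sup>2))"
    by (intro mult_mono prod_nonneg) auto
  moreover have "(\<Prod>i\<in>(UNIV::'n set). 1 / (japanese ?z)\<^sup>2) * (\<Prod>i\<in>(UNIV::'n set). 1 / (japanese ?z)\<^sup>2)
     = 1 / japanese ?z ^ (4 * CARD('n))"
    by (simp add: power_mult[symmetric] power_add[symmetric] power_divide)
  ultimately show ?thesis by simp
qed

lemma tf_lattice_gabor_lattice:
  assumes "\<alpha> > 0" "\<beta> > 0"
  shows "tf_lattice (gabor_lattice \<alpha> \<beta> :: ((real ^ 'n) \<times> (real ^ 'n)) set) (4 * CARD('n))"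
proof
  let ?L = "gabor_lattice \<alpha> \<beta> :: ((real ^ 'n) \<times> (real ^ 'n)) set"
  have "lattice_point \<alpha> \<beta> ((\<lambda>_. 0), (\<lambda>_. 0)) = (0 :: (real ^ 'n) \<times> (real ^ 'n))"
    by (simp add: lattice_point_def vec_eq_iff prod_eq_iff)
  then show "0 \<in> ?L" unfolding gabor_lattice_eq by (metis rangeI)
  show "z + w \<in> ?L" if zw: "z \<in> ?L" "w \<in> ?L" for z w
  proof -
    obtain k l where "z = lattice_point \<alpha> \<beta> k" "w = lattice_point \<alpha> \<beta> l"
      using zw unfolding gabor_lattice_eq by blast
    then have "z + w = lattice_point \<alpha> \<beta> ((\<lambda>i. fst k i + fst l i), (\<lambda>i. snd k i + snd l i))"
      by (simp add: lattice_point_def vec_eq_iff prod_eq_iff distrib_left)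
    then show ?thesis unfolding gabor_lattice_eq by blast
  qed
  show "- z \<in> ?L" if z: "z \<in> ?L" for z
  proof -
    obtain k where "z = lattice_point \<alpha> \<beta> k"
      using z unfolding gabor_lattice_eq by blast
    then have "- z = lattice_point \<alpha> \<beta> ((\<lambda>i. - fst k i), (\<lambda>i. - snd k i))"
      by (simp add: lattice_point_def vec_eq_iff prod_eq_iff)
    then show ?thesis unfolding gabor_lattice_eq by blast
  qed
  show "infinite ?L"
  proof
    assume "finite ?L"
    then have "finite (UNIV :: (('n \<Rightarrow> int) \<times> ('n \<Rightarrow> int)) set)"
      unfolding gabor_lattice_eq using inj_lattice_point[OF assms] by (rule finite_imageD)
    moreover have "inj (\<lambda>m::int. ((\<lambda>_::'n. m), (\<lambda>_::'n. m)))" by (auto simp: inj_def fun_eq_iff)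
    ultimately have "finite (UNIV :: int set)" by (meson finite_imageD finite_subset subset_UNIV)
    then show False using infinite_UNIV_int by blast
  qed
  show "(\<lambda>z. 1 / japanese z ^ (4 * CARD('n))) summable_on ?L"
    unfolding gabor_lattice_eq summable_on_reindex[OF inj_lattice_point[OF assms]]
  proof (rule summable_on_comparison_test)
    let ?f = "\<lambda>\<alpha> (k::'n \<Rightarrow> int). \<Prod>i\<in>UNIV. 1 / (1 + (\<alpha> * real_of_int (k i))\<^sup>2)"
    have "(\<lambda>(k, l). ?f \<alpha> k * ?f \<beta> l) summable_on (UNIV \<times> UNIV)"
    proof (rule summable_on_SigmaI[where g = "\<lambda>k. ?f \<alpha> k * infsum (?f \<beta>) UNIV"])
      show "((\<lambda>l. case (k, l) of (k, l) \<Rightarrow> ?f \<alpha> k * ?f \<beta> l) has_sum ?f \<alpha> k * infsum (?f \<beta>) UNIV) UNIV" for k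
        unfolding prod.case
        by (rule has_sum_cmult_right[OF has_sum_infsum[OF summable_on_prod_functions[OF assms(2)]]])
      show "(\<lambda>k. ?f \<alpha> k * infsum (?f \<beta>) UNIV) summable_on UNIV"
        by (rule summable_on_cmult_left[OF summable_on_prod_functions[OF assms(1)]])
    qed (auto intro!: mult_nonneg_nonneg prod_nonneg)
    then show "(\<lambda>kl. ?f \<alpha> (fst kl) * ?f \<beta> (snd kl)) summable_on UNIV" by (simp add: split_def)
    show "((\<lambda>z. 1 / japanese z ^ (4 * CARD('n))) \<circ> lattice_point \<alpha> \<beta>) kl \<le> ?f \<alpha> (fst kl) * ?f \<beta> (snd kl)" for kl
      unfolding o_def by (rule japanese_lattice_point)
  qed simp
qed

theorem theorem5p1:
  fixes a :: "(real ^ 'n) \<times> (real ^ 'n) \<Rightarrow> complex"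
    and u :: "(real ^ 'n \<Rightarrow> complex) \<Rightarrow> complex"
    and \<phi> :: "real ^ 'n \<Rightarrow> complex"
    and \<alpha> \<beta> :: real
  assumes "a \<in> S00"
    and "u \<in> tempered"
    and "\<phi> \<in> schwartz" and "\<phi> \<noteq> (\<lambda>_. 0)"
    and "\<alpha> > 0" and "\<beta> > 0"
    and "gabor_frame \<phi> \<alpha> \<beta>"
  shows "WF_G \<phi> \<alpha> \<beta> (weyl_ext a u) \<subseteq> WF_G \<phi> \<alpha> \<beta> u \<inter> conesupp a"
proof -
  let ?L = "gabor_lattice \<alpha> \<beta> :: ((real ^ 'n) \<times> (real ^ 'n)) set"
  obtain A B where AB: "0 < A" "0 < B" and frame: "\<forall>f \<in> borel_measurable lborel.
     integrable lborel (\<lambda>x. (norm (f x))\<^sup>2) \<longrightarrow>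
       (\<lambda>z. (norm (dist_of_fun f (tf_shift z \<phi>)))\<^sup>2) summable_on ?L \<and>
       A * (LINT x|lborel. (norm (f x))\<^sup>2) \<le> (\<Sum>\<^sub>\<infinity>z\<in>?L. (norm (dist_of_fun f (tf_shift z \<phi>)))\<^sup>2) \<and>
       (\<Sum>\<^sub>\<infinity>z\<in>?L. (norm (dist_of_fun f (tf_shift z \<phi>)))\<^sup>2) \<le> B * (LINT x|lborel. (norm (f x))\<^sup>2)"
    using assms(7) unfolding gabor_frame_def by blast
  \<comment> \<open>The locale asks for ordered frame bounds, while \<open>gabor_frame\<close>
    provides two unrelated positive constants; \<open>min A B\<close> is still a lower
    bound.\<close>
  have low: "min A B * (l2norm f)\<^sup>2 \<le> (\<Sum>\<^sub>\<infinity>z\<in>?L. (norm (ip f (tf_shift z \<phi>)))\<^sup>2)"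
    and up: "(\<Sum>\<^sub>\<infinity>z\<in>?L. (norm (ip f (tf_shift z \<phi>)))\<^sup>2) \<le> B * (l2norm f)\<^sup>2" if f: "f \<in> schwartz" for f
  proof -
    have "f \<in> borel_measurable lborel" using schwartz_measurable[OF f] by simp
    with frame schwartz_norm2_integrable[OF f]
    have "A * (l2norm f)\<^sup>2 \<le> (\<Sum>\<^sub>\<infinity>z\<in>?L. (norm (ip f (tf_shift z \<phi>)))\<^sup>2)"
      "(\<Sum>\<^sub>\<infinity>z\<in>?L. (norm (ip f (tf_shift z \<phi>)))\<^sup>2) \<le> B * (l2norm f)\<^sup>2"
      unfolding l2norm_square by blast+
    moreover have "min A B * (l2norm f)\<^sup>2 \<le> A * (l2norm f)\<^sup>2" by (intro mult_right_mono) auto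
    ultimately show "min A B * (l2norm f)\<^sup>2 \<le> (\<Sum>\<^sub>\<infinity>z\<in>?L. (norm (ip f (tf_shift z \<phi>)))\<^sup>2)"
      "(\<Sum>\<^sub>\<infinity>z\<in>?L. (norm (ip f (tf_shift z \<phi>)))\<^sup>2) \<le> B * (l2norm f)\<^sup>2" by linarith+
  qed
  interpret tf_frame ?L "4 * CARD('n)" \<phi> "min A B" B
    using AB low up assms(3)
    by (intro tf_frame.intro tf_lattice_gabor_lattice tf_frame_axioms.intro assms) auto
  show ?thesis
  proof
    fix z0 assume z0: "z0 \<in> WF_G \<phi> \<alpha> \<beta> (weyl_ext a u)"
    then have nz: "z0 \<noteq> 0" and no: "\<not> (\<exists>\<Gamma>. open_conic \<Gamma> \<and> z0 \<in> \<Gamma> \<and>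
       (\<forall>N. bdd_above ((\<lambda>z. japanese z ^ N * norm (stft \<phi> (weyl_ext a u) z)) ` (?L \<inter> \<Gamma>))))"
      unfolding WF_G_def by auto
    have "z0 \<in> WF_G \<phi> \<alpha> \<beta> u"
    proof (rule ccontr)
      assume "z0 \<notin> WF_G \<phi> \<alpha> \<beta> u"
      then obtain \<Gamma> where "open_conic \<Gamma>" "z0 \<in> \<Gamma>"
        "\<And>N. bdd_above ((\<lambda>z. japanese z ^ N * norm (stft \<phi> u z)) ` (?L \<inter> \<Gamma>))"
        using nz unfolding WF_G_def by auto
      from weyl_ext_decay_cone[OF assms(1,2) this] no show False by blast
    qed
    moreover have "z0 \<in> conesupp a"
    proof (rule ccontr)
      assume "z0 \<notin> conesupp a"
      then obtain \<Gamma> where "open_conic \<Gamma>" "z0 \<in> \<Gamma>" "compact (closure (supp a \<inter> \<Gamma>))"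
        using nz unfolding conesupp_def by auto
      from weyl_ext_decay_conesupp[OF assms(1,2) this] no show False by blast
    qed
    ultimately show "z0 \<in> WF_G \<phi> \<alpha> \<beta> u \<inter> conesupp a" by blast
  qed
qed

end
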